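(* Suppose that there exists $\alpha\in(0,1]$ such that $$a_i\le i^{-\alpha+o(1)}\qquad\text{and}\qquad A_i=i^{1-\alpha+o(1)}\qquad\text{as } i\to\infty .$$ Then the random tree $\mathcal T$ built by aggregation from the sequence $(a_i)_{i\ge1}$ is almost surely a compact real tree of Hausdorff dimension $\alpha^{-1}$.
   Context: Let $\mathbf a=(a_i)_{i\ge 1}$ be a (deterministic) sequence of positive real numbers and $A_i=a_1+\dots+a_i$. The random trees $(\mathcal T_n)_{n\ge1}$ are built as follows: $\mathcal T_1$ is a closed segment of length $a_1$, rooted at one of its ends $\rho$; recursively, conditionally on $\mathcal T_1,\dots,\mathcal T_n$, pick a point of $\mathcal T_n$ uniformly (according to the length measure on $\mathcal T_n$ normalized to be a probability) and obtain $\mathcal T_{n+1}$ by gluing one end of a new closed segment ("branch") of length $a_{n+1}$ at this point. Concretely, $\mathcal T_1=\{(x,0,0,\dots):x\in[0,a_1]\}\subset\ell^1(\mathbb R)$ and $\mathcal T_{n+1}=\mathcal T_n\cup\{(u_1,\dots,u_n,x,0,0,\dots):x\in[0,a_{n+1}]\}$ where $(u_1,\dots,u_n,0,\dots)$ is the uniform point of $\mathcal T_n$. The tree $\mathcal T$ is the completion (closure in $\ell^1(\mathbb R)$) of the increasing union $\bigcup_n\mathcal T_n$, endowed with its length metric. Notation: $x_i\le i^{\beta+o(1)}$ means that for every $\varepsilon>0$, $x_i\le i^{\beta+\varepsilon}$ for all $i$ large enough; $x_i\ge i^{\beta+o(1)}$ means that for every $\varepsilon>0$, $x_i\ge i^{\beta-\varepsilon}$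 for all $i$ large enough; $x_i=i^{\beta+o(1)}$ means both. *)

theory Defs
  imports "HOL-Probability.Probability"
begin

section \<open>The Banach space of absolutely summable real sequences\<close>

text \<open>Coordinates are indexed from \<open>0\<close>: the usual first coordinate is \<open>coord x 0\<close>.\<close>

typedef l1 = "{f :: nat \<Rightarrow> real. summable (\<lambda>k. \<bar>f k\<bar>)}"
  morphisms coord Abs_l1
  by (rule exI[of _ "\<lambda>_. 0"]) simp

setup_lifting type_definition_l1

lemma l1_eqI: "(\<And>k. coord x k = coord y k) \<Longrightarrow> x = y"
  by (simp add: coord_inject[symmetric] fun_eq_iff)

lemma summable_coord: "summable (\<lambda>k. \<bar>coord x k\<bar>)"
  using coord[of x] by simp

instantiation l1 :: real_vector
begin

lift_definition zero_l1 :: l1 is "\<lambda>_. 0" by simp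

lift_definition uminus_l1 :: "l1 \<Rightarrow> l1" is "\<lambda>f k. - f k" by simp

lift_definition plus_l1 :: "l1 \<Rightarrow> l1 \<Rightarrow> l1" is "\<lambda>f g k. f k + g k"
proof -
  fix f g :: "nat \<Rightarrow> real"
  assume "summable (\<lambda>k. \<bar>f k\<bar>)" "summable (\<lambda>k. \<bar>g k\<bar>)"
  then have "summable (\<lambda>k. \<bar>f k\<bar> + \<bar>g k\<bar>)" by (rule summable_add)
  then show "summable (\<lambda>k. \<bar>f k + g k\<bar>)"
    by (rule summable_comparison_test'[where N = 0]) (simp add: abs_triangle_ineq)
qed

definition minus_l1 :: "l1 \<Rightarrow> l1 \<Rightarrow> l1" where "minus_l1 x y = x + (- y)"

lift_definition scaleR_l1 :: "real \<Rightarrow> l1 \<Rightarrow> l1" is "\<lambda>c f k. c * f k"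
  by (simp add: abs_mult)

instance
proof
  fix x y z :: l1 and c d :: real
  show "x + y + z = x + (y + z)" by (rule l1_eqI) (simp add: plus_l1.rep_eq)
  show "x + y = y + x" by (rule l1_eqI) (simp add: plus_l1.rep_eq)
  show "0 + x = x" by (rule l1_eqI) (simp add: plus_l1.rep_eq zero_l1.rep_eq)
  show "- x + x = 0" by (rule l1_eqI) (simp add: plus_l1.rep_eq zero_l1.rep_eq uminus_l1.rep_eq)
  show "x - y = x + - y" by (simp add: minus_l1_def)
  show "c *\<^sub>R (x + y) = c *\<^sub>R x + c *\<^sub>R y"
    by (rule l1_eqI) (simp add: plus_l1.rep_eq scaleR_l1.rep_eq algebra_simps)
  show "(c + d) *\<^sub>R x = c *\<^sub>R x + d *\<^sub>R x"
    by (rule l1_eqI) (simp add: plus_l1.rep_eq scaleR_l1.rep_eq algebra_simps)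
  show "c *\<^sub>R d *\<^sub>R x = (c * d) *\<^sub>R x" by (rule l1_eqI) (simp add: scaleR_l1.rep_eq)
  show "1 *\<^sub>R x = x" by (rule l1_eqI) (simp add: scaleR_l1.rep_eq)
qed

end

instantiation l1 :: real_normed_vector
begin

definition norm_l1 :: "l1 \<Rightarrow> real" where "norm_l1 x = (\<Sum>k. \<bar>coord x k\<bar>)"

definition dist_l1 :: "l1 \<Rightarrow> l1 \<Rightarrow> real" where "dist_l1 x y = norm (x - y)"

definition sgn_l1 :: "l1 \<Rightarrow> l1" where "sgn_l1 x = x /\<^sub>R norm x"

definition uniformity_l1 :: "(l1 \<times> l1) filter" where
  "uniformity_l1 = (INF e\<in>{0 <..}. principal {(x, y). dist x y < e})"

definition open_l1 :: "l1 set \<Rightarrow> bool" where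
  "open_l1 S = (\<forall>x\<in>S. \<forall>\<^sub>F (x', y) in uniformity. x' = x \<longrightarrow> y \<in> S)"

instance
proof
  fix x y :: l1
  show "dist x y = norm (x - y)" by (rule dist_l1_def)
  show "sgn x = x /\<^sub>R norm x" by (rule sgn_l1_def)
  show "(uniformity :: (l1 \<times> l1) filter) = (INF e\<in>{0 <..}. principal {(x, y). dist x y < e})"
    by (rule uniformity_l1_def)
  fix S :: "l1 set"
  show "open S = (\<forall>x\<in>S. \<forall>\<^sub>F (x', y) in uniformity. x' = x \<longrightarrow> y \<in> S)" by (rule open_l1_def)
next
  fix x y :: l1 and c :: real
  show "norm x = 0 \<longleftrightarrow> x = 0"
  proof
    assume "norm x = 0"
    then have "\<forall>k. \<bar>coord x k\<bar> = 0"
      using suminf_eq_zero_iff[OF summable_coord[of x]] by (simp add: norm_l1_def)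
    then show "x = 0" by (intro l1_eqI) (simp add: zero_l1.rep_eq)
  qed (simp add: norm_l1_def zero_l1.rep_eq)
  have "(\<Sum>k. \<bar>coord (x + y) k\<bar>) \<le> (\<Sum>k. \<bar>coord x k\<bar> + \<bar>coord y k\<bar>)"
    by (intro suminf_le summable_coord summable_add) (simp add: plus_l1.rep_eq abs_triangle_ineq)
  then show "norm (x + y) \<le> norm x + norm y"
    unfolding norm_l1_def by (simp only: suminf_add[OF summable_coord summable_coord])
  show "norm (c *\<^sub>R x) = \<bar>c\<bar> * norm x"
    unfolding norm_l1_def scaleR_l1.rep_eq abs_mult by (rule suminf_mult[OF summable_coord])
qed

end

lemma coord_diff: "coord (x - y) k = coord x k - coord y k"
  unfolding minus_l1_def plus_l1.rep_eq uminus_l1.rep_eq by (rule diff_conv_add_uminus[symmetric])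

lemma sum_coord_le_norm: "(\<Sum>k<K. \<bar>coord x k\<bar>) \<le> norm x"
  unfolding norm_l1_def by (rule sum_le_suminf) (auto simp: summable_coord)

lemma coord_le_norm: "\<bar>coord x k\<bar> \<le> norm x"
proof -
  have "\<bar>coord x k\<bar> \<le> (\<Sum>j<Suc k. \<bar>coord x j\<bar>)"
    by (rule member_le_sum) auto
  then show ?thesis using sum_coord_le_norm[where K = "Suc k"] by (rule order_trans)
qed

instance l1 :: banach
proof
  fix X :: "nat \<Rightarrow> l1"
  assume X: "Cauchy X"
  have "Cauchy (\<lambda>n. coord (X n) k)" for k
  proof (rule metric_CauchyI)
    fix e :: real assume "0 < e"
    then obtain N where N: "\<And>m n. m \<ge> N \<Longrightarrow> n \<ge> N \<Longrightarrow> dist (X m) (X n) < e"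
      using metric_CauchyD[OF X] by blast
    have "dist (coord (X m) k) (coord (X n) k) < e" if "m \<ge> N" "n \<ge> N" for m n
      using N[OF that] coord_le_norm[of "X m - X n" k]
      by (simp add: dist_norm coord_diff)
    then show "\<exists>N. \<forall>m\<ge>N. \<forall>n\<ge>N. dist (coord (X m) k) (coord (X n) k) < e" by blast
  qed
  then have "\<forall>k. \<exists>l. (\<lambda>n. coord (X n) k) \<longlonglongrightarrow> l"
    by (simp add: Cauchy_convergent_iff convergent_def)
  then obtain f where f: "\<And>k. (\<lambda>n. coord (X n) k) \<longlonglongrightarrow> f k" by metis
  have part: "\<exists>N. \<forall>n\<ge>N. \<forall>K. (\<Sum>k<K. \<bar>coord (X n) k - f k\<bar>) \<le> e" if "0 < e" for e
  proof -
    obtain N where N: "\<And>m n. m \<ge> N \<Longrightarrow> n \<ge> N \<Longrightarrow> dist (X m) (X n) < e"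
      using metric_CauchyD[OF X \<open>0 < e\<close>] by blast
    have "(\<Sum>k<K. \<bar>coord (X n) k - f k\<bar>) \<le> e" if n: "n \<ge> N" for n K
    proof (rule LIMSEQ_le_const2)
      show "(\<lambda>m. \<Sum>k<K. \<bar>coord (X n) k - coord (X m) k\<bar>) \<longlonglongrightarrow> (\<Sum>k<K. \<bar>coord (X n) k - f k\<bar>)"
        by (intro tendsto_intros f)
      have "(\<Sum>k<K. \<bar>coord (X n) k - coord (X m) k\<bar>) \<le> e" if "m \<ge> N" for m
        using sum_coord_le_norm[where x = "X n - X m" and K = K] N[OF n that]
        by (simp add: dist_norm coord_diff)
      then show "\<exists>N. \<forall>m\<ge>N. (\<Sum>k<K. \<bar>coord (X n) k - coord (X m) k\<bar>) \<le> e" by blast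
    qed
    then show ?thesis by blast
  qed
  have summ: "summable (\<lambda>k. \<bar>coord (X n) k - f k\<bar>)"
    if "\<And>K. (\<Sum>k<K. \<bar>coord (X n) k - f k\<bar>) \<le> e" for n e
  proof (rule bounded_imp_summable)
    show "(\<Sum>k\<le>K. \<bar>coord (X n) k - f k\<bar>) \<le> e" for K
      using that[of "Suc K"] by (simp only: lessThan_Suc_atMost)
  qed simp
  obtain n0 where n0: "\<And>K. (\<Sum>k<K. \<bar>coord (X n0) k - f k\<bar>) \<le> 1"
    using part[of 1] by auto
  have "summable (\<lambda>k. \<bar>coord (X n0) k - f k\<bar> + \<bar>coord (X n0) k\<bar>)"
    by (rule summable_add[OF summ[OF n0] summable_coord])
  then have "summable (\<lambda>k. \<bar>f k\<bar>)"
    by (rule summable_comparison_test'[where N = 0]) auto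
  then have cf: "coord (Abs_l1 f) = f" by (simp add: Abs_l1_inverse)
  have "X \<longlonglongrightarrow> Abs_l1 f"
  proof (rule metric_LIMSEQ_I)
    fix e :: real assume "0 < e"
    then obtain N where N: "\<And>n K. n \<ge> N \<Longrightarrow> (\<Sum>k<K. \<bar>coord (X n) k - f k\<bar>) \<le> e / 2"
      using part[of "e / 2"] by auto
    have "dist (X n) (Abs_l1 f) < e" if "n \<ge> N" for n
    proof -
      have "(\<Sum>k. \<bar>coord (X n) k - f k\<bar>) \<le> e / 2"
        by (rule suminf_le_const[OF summ[OF N[OF that]] N[OF that]])
      then show ?thesis using \<open>0 < e\<close> by (simp add: dist_norm norm_l1_def coord_diff cf)
    qed
    then show "\<exists>N. \<forall>n\<ge>N. dist (X n) (Abs_l1 f) < e" by blast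
  qed
  then show "convergent X" by (rule convergentI)
qed

lift_definition unit_l1 :: "nat \<Rightarrow> l1" is "\<lambda>j k. if k = j then 1 else 0"
proof -
  fix j :: nat
  show "summable (\<lambda>k. \<bar>if k = j then 1 else 0 :: real\<bar>)"
    by (rule summable_finite[of "{j}"]) auto
qed


section \<open>Length metric, real trees, Hausdorff dimension\<close>

definition curve_length :: "(real \<Rightarrow> 'a::metric_space) \<Rightarrow> ennreal" where
  "curve_length g =
     (SUP (n, t) \<in> {(n :: nat, t :: nat \<Rightarrow> real). mono t \<and> range t \<subseteq> {0..1}}.
        \<Sum>i<n. ennreal (dist (g (t i)) (g (t (Suc i)))))"

text \<open>If \<open>x\<close> and \<open>y\<close> are joined by no rectifiable curve inside \<open>S\<close>, the value is the dummy \<open>0\<close>;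
  for \<open>x \<noteq> y\<close> this is excluded as soon as \<open>Metric_space S (length_metric S)\<close> holds, which is
  part of \<open>real_tree\<close> below.\<close>

definition length_metric :: "'a::metric_space set \<Rightarrow> 'a \<Rightarrow> 'a \<Rightarrow> real" where
  "length_metric S x y =
     enn2real (INF g \<in> {g. path g \<and> path_image g \<subseteq> S \<and> pathstart g = x \<and> pathfinish g = y}.
       curve_length g)"

definition geodesic_in :: "'a set \<Rightarrow> ('a \<Rightarrow> 'a \<Rightarrow> real) \<Rightarrow> 'a \<Rightarrow> 'a \<Rightarrow> (real \<Rightarrow> 'a) \<Rightarrow> bool" where
  "geodesic_in S d x y \<phi> \<longleftrightarrow>
     \<phi> \<in> {0..d x y} \<rightarrow> S \<and> \<phi> 0 = x \<and> \<phi> (d x y) = y \<and>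
     (\<forall>s\<in>{0..d x y}. \<forall>t\<in>{0..d x y}. d (\<phi> s) (\<phi> t) = \<bar>s - t\<bar>)"

definition real_tree :: "'a set \<Rightarrow> ('a \<Rightarrow> 'a \<Rightarrow> real) \<Rightarrow> bool" where
  "real_tree S d \<longleftrightarrow> Metric_space S d \<and>
     (\<forall>x\<in>S. \<forall>y\<in>S. \<exists>\<phi>. geodesic_in S d x y \<phi> \<and>
        (\<forall>\<psi>. geodesic_in S d x y \<psi> \<longrightarrow> (\<forall>t\<in>{0..d x y}. \<psi> t = \<phi> t)) \<and>
        (\<forall>c. continuous_map (top_of_set {0..1}) (Metric_space.mtopology S d) c \<and>
             inj_on c {0..1} \<and> c 0 = x \<and> c 1 = y \<longrightarrow>
             c ` {0..1 :: real} = \<phi> ` {0..d x y}))"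

definition set_diameter :: "('a \<Rightarrow> 'a \<Rightarrow> real) \<Rightarrow> 'a set \<Rightarrow> ennreal" where
  "set_diameter d C = (SUP x\<in>C. SUP y\<in>C. ennreal (d x y))"

definition hausdorff_premeasure ::
  "'a set \<Rightarrow> ('a \<Rightarrow> 'a \<Rightarrow> real) \<Rightarrow> real \<Rightarrow> real \<Rightarrow> ennreal" where
  "hausdorff_premeasure S d s \<delta> =
     (INF C \<in> {C :: nat \<Rightarrow> 'a set. (\<forall>i. C i \<subseteq> S \<and> set_diameter d (C i) \<le> ennreal \<delta>) \<and>
                                   S \<subseteq> (\<Union>i. C i)}.
        \<Sum>i. ennreal (enn2real (set_diameter d (C i)) powr s))"

definition hausdorff_measure :: "'a set \<Rightarrow> ('a \<Rightarrow> 'a \<Rightarrow> real) \<Rightarrow> real \<Rightarrow> ennreal" where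
  "hausdorff_measure S d s = (SUP \<delta>\<in>{0<..}. hausdorff_premeasure S d s \<delta>)"

text \<open>Only exponents \<open>s > 0\<close> are used, because \<open>0 powr 0 = 0\<close> would give a wrong value to the
  \<open>0\<close>-dimensional measure. The infimum of the empty set is \<open>\<infinity>\<close>.\<close>

definition hausdorff_dim :: "'a set \<Rightarrow> ('a \<Rightarrow> 'a \<Rightarrow> real) \<Rightarrow> ereal" where
  "hausdorff_dim S d = (INF s \<in> {s. 0 < s \<and> hausdorff_measure S d s = 0}. ereal s)"


section \<open>Trees built by aggregation\<close>

text \<open>The sequences \<open>a\<close> (branch lengths) and \<open>u\<close> (gluing points) are indexed from \<open>1\<close>; their
  values at \<open>0\<close> are irrelevant. Branch \<open>n + 1\<close> is glued at \<open>u n\<close>, branch \<open>1\<close> starts at the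
  origin, and branch \<open>k\<close> grows in the \<open>k\<close>-th coordinate direction \<open>unit_l1 (k - 1)\<close>.\<close>

definition branch_point :: "(nat \<Rightarrow> l1) \<Rightarrow> nat \<Rightarrow> real \<Rightarrow> l1" where
  "branch_point u k x = (if k = 1 then 0 else u (k - 1)) + x *\<^sub>R unit_l1 (k - 1)"

definition agg_tree :: "(nat \<Rightarrow> real) \<Rightarrow> (nat \<Rightarrow> l1) \<Rightarrow> nat \<Rightarrow> l1 set" where
  "agg_tree a u n = (\<Union>k\<in>{1..n}. branch_point u k ` {0..a k})"

definition agg_tree_limit :: "(nat \<Rightarrow> real) \<Rightarrow> (nat \<Rightarrow> l1) \<Rightarrow> l1 set" where
  "agg_tree_limit a u = closure (\<Union>n\<in>{1..}. agg_tree a u n)"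

text \<open>Distinct branches share at most one point, so that the total length of a Borel set is the
  sum of its one-dimensional Lebesgue measures along the branches.\<close>

definition tree_length :: "(nat \<Rightarrow> real) \<Rightarrow> (nat \<Rightarrow> l1) \<Rightarrow> nat \<Rightarrow> l1 set \<Rightarrow> real" where
  "tree_length a u n B = (\<Sum>k = 1..n. measure lborel {x \<in> {0..a k}. branch_point u k x \<in> B})"

definition past :: "'w measure \<Rightarrow> (nat \<Rightarrow> 'w \<Rightarrow> l1) \<Rightarrow> nat \<Rightarrow> 'w measure" where
  "past M U n = sigma (space M) (\<Union>k\<in>{1..<n}. {U k -` B \<inter> space M | B. B \<in> sets borel})"

text \<open>\<open>U n\<close> is a point of the \<open>n\<close>-th tree whose conditional law given the first \<open>n\<close> trees,
  i.e.\ given \<open>U 1, \<dots>, U (n - 1)\<close>, is the normalized length measure of the \<open>n\<close>-th tree.\<close>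

definition uniform_gluing :: "'w measure \<Rightarrow> (nat \<Rightarrow> real) \<Rightarrow> (nat \<Rightarrow> 'w \<Rightarrow> l1) \<Rightarrow> bool" where
  "uniform_gluing M a U \<longleftrightarrow> prob_space M \<and>
     (\<forall>n\<ge>1. U n \<in> borel_measurable M \<and>
        (AE \<omega> in M. U n \<omega> \<in> agg_tree a (\<lambda>k. U k \<omega>) n) \<and>
        (\<forall>B\<in>sets borel. AE \<omega> in M.
           real_cond_exp M (past M U n) (indicator (U n -` B \<inter> space M)) \<omega> =
           tree_length a (\<lambda>k. U k \<omega>) n B / tree_length a (\<lambda>k. U k \<omega>) n UNIV))"


section \<open>Polynomial growth exponents\<close>

text \<open>\<open>x i \<le> i^(\<beta> + o(1))\<close> and \<open>x i \<ge> i^(\<beta> + o(1))\<close>\<close>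

definition exponent_le :: "(nat \<Rightarrow> real) \<Rightarrow> real \<Rightarrow> bool" where
  "exponent_le x \<beta> \<longleftrightarrow> (\<forall>\<epsilon>>0. \<forall>\<^sub>F i in sequentially. x i \<le> real i powr (\<beta> + \<epsilon>))"

definition exponent_ge :: "(nat \<Rightarrow> real) \<Rightarrow> real \<Rightarrow> bool" where
  "exponent_ge x \<beta> \<longleftrightarrow> (\<forall>\<epsilon>>0. \<forall>\<^sub>F i in sequentially. x i \<ge> real i powr (\<beta> - \<epsilon>))"

definition exponent_eq :: "(nat \<Rightarrow> real) \<Rightarrow> real \<Rightarrow> bool" where
  "exponent_eq x \<beta> \<longleftrightarrow> exponent_le x \<beta> \<and> exponent_ge x \<beta>"

end

theory Submission
  imports Defs
begin

text \<open>
  Write \<open>T\<^sub>n\<close> for the \<open>n\<close>-th tree, \<open>T\<close> for the limit, \<open>A\<^sub>n\<close> for the total length of \<open>T\<^sub>n\<close>.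

  \<^emph>\<open>Real tree.\<close> For any choice of gluing points, the norm distance is already the tree metric.
  A point with a positive \<open>i\<close>-th coordinate lies on or above branch \<open>i + 1\<close>, so all its earlier
  coordinates are those of the root of that branch; hence two points of the tree have disjoint
  supports beyond the first coordinate at which they differ (\<open>branching\<close>). It follows that their
  Gromov product at the root \<open>0\<close> is the length of their common ancestral line, which is
  ultrametric. This is the four-point condition; together with geodesics it makes a space a real
  tree (\<open>real_tree_if_hyperbolic\<close>). All these properties survive closure
  (\<open>ancestral_closure\<close>, \<open>ancestral_real_tree\<close>).

  \<^emph>\<open>Upper bound and compactness.\<close> The index of the branch that carries \<open>U k\<close> is independent of the
  past and equals \<open>j\<close> with probability \<open>a j / A\<^sub>k\<close> (\<open>prob_slice\<close>). So, for \<open>n \<le> k < 2 n\<close>, each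
  step down the ancestral line of \<open>U k\<close> leaves the branches added after time \<open>n\<close> with probability at
  least \<open>A\<^sub>n / A\<^sub>2\<^sub>n\<close>, which is \<open>n\<close> to the power \<open>o(1)\<close>: the line meets more than \<open>n\<^sup>\<epsilon>\<close> such branches
  with very small probability (\<open>prob_turns_ge\<close>), and these have length at most \<open>n\<close> to the power
  \<open>-\<alpha> + \<epsilon>\<close>. By Borel--Cantelli and summation over dyadic \<open>n\<close>, for every \<open>\<gamma> < \<alpha>\<close> the tree \<open>T\<close> stays
  within a constant times \<open>n\<close> to the power \<open>-\<gamma>\<close> of \<open>T\<^sub>n\<close> (\<open>AE_approximable\<close>). Cutting \<open>T\<^sub>n\<close> into
  pieces of that size gives covers by \<open>O(n)\<close> sets (\<open>small_covers\<close>), hence compactness and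
  dimension at most \<open>1 / \<gamma>\<close>.

  \<^emph>\<open>Lower bound.\<close> Let \<open>s < s' < 1 / \<alpha>\<close>. If the points \<open>U k\<close> with \<open>n \<le> k < 2 n\<close> have a discrete \<open>s\<close>-energy
  that is bounded along a subsequence, then by Cauchy--Schwarz no cover of the compact set \<open>T\<close> has a
  small sum of \<open>s\<close>-th powers of diameters (\<open>hausdorff_measure_pos_if_energy_bounded\<close>). By Fatou it is
  enough to bound the expected energy, that is, to show that two gluing points with indices beyond
  \<open>N = r\<close> to the power \<open>-s'\<close> are within distance \<open>r\<close> with probability \<open>O(1 / N)\<close>
  (\<open>prob_close_dyadic\<close>). Let \<open>S\<^sub>m\<close> be \<open>A\<^sub>m\<^sup>2\<close> times the probability that two independent uniform points
  of \<open>T\<^sub>m\<close> are within \<open>r\<close>. Distinguishing which of the two points lie on the last branch gives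
  \<open>S\<^sub>m\<^sub>+\<^sub>1 \<le> S\<^sub>m (1 + 2 min (a (m + 1)) r / A\<^sub>m) + 3 r a (m + 1)\<close> (\<open>close_weight_Suc\<close>). Up to time \<open>N\<close> the
  minimum is bounded by \<open>r\<close>, and the sum of \<open>r / A\<^sub>m\<close> stays bounded, so \<open>S\<^sub>N = O(r A\<^sub>N)\<close>; afterwards it
  is bounded by \<open>a (m + 1)\<close>, and \<open>S\<^sub>m / A\<^sub>m\<^sup>2\<close> grows by at most \<open>3 r / A\<^sub>N\<close> in total. Hence the probability
  is \<open>O(r / A\<^sub>N)\<close> (\<open>prob_close\<close>), which is \<open>O(1 / N)\<close> because \<open>N\<close> to the power \<open>1 / s'\<close> exceeds \<open>N\<close> to
  the power \<open>\<alpha> + o(1)\<close>.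
\<close>

section \<open>Hyperbolic geodesic spaces are real trees\<close>

definition gromov :: "'a::metric_space \<Rightarrow> 'a \<Rightarrow> 'a \<Rightarrow> real" where
  "gromov p x y = (dist x p + dist y p - dist x y) / 2"

lemma gromov_commute: "gromov p x y = gromov p y x"
  by (simp add: gromov_def dist_commute)

lemma gromov_self: "gromov p x x = dist x p"
  by (simp add: gromov_def)

lemma gromov_nonneg: "0 \<le> gromov p x y"
  using dist_triangle3[of x y p] by (simp add: gromov_def dist_commute)

lemma gromov_le_dist: "gromov p x y \<le> dist x p"
  using dist_triangle2[of y p x] by (simp add: gromov_def dist_commute)

lemma open_gromov_pos: "open {w. 0 < gromov p x w}"
  unfolding gromov_def by (intro open_Collect_less continuous_intros) simp

lemma geodesic_inD:
  assumes "geodesic_in S d x y \<phi>"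
  shows "\<phi> 0 = x" "\<phi> (d x y) = y" "t \<in> {0..d x y} \<Longrightarrow> \<phi> t \<in> S"
    "\<lbrakk>s \<in> {0..d x y}; t \<in> {0..d x y}\<rbrakk> \<Longrightarrow> d (\<phi> s) (\<phi> t) = \<bar>s - t\<bar>"
  using assms by (auto simp: geodesic_in_def Pi_iff)

lemma geodesic_in_continuous:
  assumes "geodesic_in S dist x y \<phi>"
  shows "continuous_on {0..dist x y} \<phi>"
proof (rule continuous_on_iff[THEN iffD2], intro ballI allI impI)
  fix s e :: real assume "s \<in> {0..dist x y}" "0 < e"
  then show "\<exists>d>0. \<forall>s'\<in>{0..dist x y}. dist s' s < d \<longrightarrow> dist (\<phi> s') (\<phi> s) < e"
    using assms by (intro exI[of _ e]) (auto simp: geodesic_in_def dist_real_def)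
qed

lemma geodesic_in_inj:
  assumes "geodesic_in S dist x y \<phi>"
  shows "inj_on \<phi> {0..dist x y}"
proof (rule inj_onI)
  fix s t assume st: "s \<in> {0..dist x y}" "t \<in> {0..dist x y}" "\<phi> s = \<phi> t"
  have "dist (\<phi> s) (\<phi> t) = \<bar>s - t\<bar>"
    using assms st(1,2) unfolding geodesic_in_def by blast
  then show "s = t" using st(3) by simp
qed

text \<open>Two points with a positive Gromov product at \<open>p\<close> are on the same side of \<open>p\<close>. By the ultrametric
  inequality this is an equivalence relation away from \<open>p\<close>; its classes are open, and the two ends
  of a geodesic through \<open>p\<close> are in different classes. So a connected set can only pass from one end
  to the other through \<open>p\<close>.\<close>

lemma connected_through_geodesic:
  fixes S :: "'a::metric_space set"
  assumes hyp: "\<And>x y z p. \<lbrakk>x \<in> S; y \<in> S; z \<in> S; p \<in> S\<rbrakk> \<Longrightarrow>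
      min (gromov p x y) (gromov p y z) \<le> gromov p x z"
    and geo: "geodesic_in S dist x y \<phi>"
    and C: "connected C" "C \<subseteq> S" "x \<in> C" "y \<in> C"
    and t: "t \<in> {0..dist x y}"
  shows "\<phi> t \<in> C"
proof (rule ccontr)
  define p where "p = \<phi> t"
  assume "\<phi> t \<notin> C"
  then have p: "p \<notin> C" by (simp add: p_def)
  have pS: "p \<in> S" using geo t unfolding geodesic_in_def p_def by (simp add: Pi_iff)
  have d: "dist x p = t" "dist p y = dist x y - t"
    using geodesic_inD(1,2)[OF geo] geodesic_inD(4)[OF geo, of 0 t]
      geodesic_inD(4)[OF geo, of t "dist x y"] t by (simp_all add: p_def)
  \<comment> \<open>the points of \<open>C\<close> that are not on the side of \<open>x\<close>, as a union of open sides\<close>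
  define V where "V = (\<Union>w\<in>{w\<in>C. gromov p x w \<le> 0}. {w'. 0 < gromov p w w'})"
  have "open V" unfolding V_def by (intro open_UN ballI open_gromov_pos)
  have pos: "0 < gromov p w w" if "w \<in> C" for w
    using that p by (auto simp: gromov_self)
  have "C \<subseteq> {w. 0 < gromov p x w} \<union> V"
    using pos unfolding V_def by (auto simp: not_less)
  moreover have "{w. 0 < gromov p x w} \<inter> V \<inter> C = {}"
  proof (rule ccontr)
    assume "{w. 0 < gromov p x w} \<inter> V \<inter> C \<noteq> {}"
    then obtain w w' where w: "w \<in> C" "gromov p x w \<le> 0" "w' \<in> C" "0 < gromov p x w'"
      "0 < gromov p w w'" unfolding V_def by blast
    have "min (gromov p x w') (gromov p w' w) \<le> gromov p x w"
      using w C pS by (intro hyp) auto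
    then show False using w by (simp add: gromov_commute[of p w' w] min_def split: if_splits)
  qed
  ultimately have "{w. 0 < gromov p x w} \<inter> C = {} \<or> V \<inter> C = {}"
    using connectedD[OF C(1) open_gromov_pos \<open>open V\<close>] by blast
  moreover have "x \<in> {w. 0 < gromov p x w} \<inter> C" using pos C by auto
  moreover have "y \<in> V \<inter> C"
  proof -
    have "gromov p x y = 0" using d by (simp add: gromov_def dist_commute)
    then show ?thesis unfolding V_def using pos C by force
  qed
  ultimately show False by blast
qed

lemma arc_eq_geodesic:
  fixes S :: "'a::metric_space set" and c :: "real \<Rightarrow> 'a"
  assumes hyp: "\<And>x y z p. \<lbrakk>x \<in> S; y \<in> S; z \<in> S; p \<in> S\<rbrakk> \<Longrightarrow>
      min (gromov p x y) (gromov p y z) \<le> gromov p x z"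
    and geo: "geodesic_in S dist x y \<phi>"
    and c: "continuous_on {0..1} c" "c ` {0..1} \<subseteq> S" "inj_on c {0..1}" "c 0 = x" "c 1 = y"
  shows "c ` {0..1} = \<phi> ` {0..dist x y}"
proof
  have "x \<in> c ` {0..1}" "y \<in> c ` {0..1}" using c(4,5) by force+
  moreover have "connected (c ` {0..1})"
    by (intro connected_continuous_image c connected_Icc)
  ultimately show sub: "\<phi> ` {0..dist x y} \<subseteq> c ` {0..1}"
    using connected_through_geodesic[OF hyp geo] c(2) by blast
  \<comment> \<open>conversely, the time at which \<open>c\<close> visits \<open>\<phi> s\<close> depends continuously on \<open>s\<close> and runs
    from \<open>0\<close> to \<open>1\<close>, so \<open>c\<close> has no time left for points off the geodesic\<close>
  define h where "h = the_inv_into {0..1} c \<circ> \<phi>"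
  have "continuous_on (c ` {0..1}) (the_inv_into {0..1} c)"
    using c by (intro continuous_on_inv_into) auto
  then have "continuous_on {0..dist x y} h"
    unfolding h_def using geodesic_in_continuous[OF geo] sub
    by (intro continuous_on_compose) (auto intro: continuous_on_subset)
  moreover have "h 0 = 0" "h (dist x y) = 1"
    using geo c(3-5) the_inv_into_f_f[OF c(3), of 0] the_inv_into_f_f[OF c(3), of 1]
    unfolding h_def geodesic_in_def by auto
  ultimately have *: "\<exists>s\<in>{0..dist x y}. h s = \<tau>" if "\<tau> \<in> {0..1}" for \<tau>
    using IVT'[of h 0 \<tau> "dist x y"] that by auto
  show "c ` {0..1} \<subseteq> \<phi> ` {0..dist x y}"
  proof (rule image_subsetI)
    fix \<tau> :: real assume "\<tau> \<in> {0..1}"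
    then obtain s where s: "s \<in> {0..dist x y}" "h s = \<tau>" using * by blast
    moreover have "\<phi> s \<in> c ` {0..1}" using sub s(1) by blast
    ultimately have "c \<tau> = \<phi> s" using f_the_inv_into_f[OF c(3), of "\<phi> s"] by (simp add: h_def)
    then show "c \<tau> \<in> \<phi> ` {0..dist x y}" using s by simp
  qed
qed

lemma mtopology_eq_subspace:
  fixes S :: "'a::metric_space set"
  assumes "Metric_space S d" and d: "\<And>x y. \<lbrakk>x \<in> S; y \<in> S\<rbrakk> \<Longrightarrow> d x y = dist x y"
  shows "Metric_space.mtopology S d = top_of_set S"
proof -
  interpret Metric_space S d by fact
  have *: "mball x r \<subseteq> U \<longleftrightarrow> (\<forall>x'\<in>S. dist x' x < r \<longrightarrow> x' \<in> U)"
    if "x \<in> S" for x r U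
    using that by (simp add: mball_def d subset_iff dist_commute[of x] cong: conj_cong) blast
  show ?thesis
  proof (rule topology_eq[THEN iffD2], intro allI)
    fix U
    have "openin mtopology U \<longleftrightarrow> U \<subseteq> S \<and> (\<forall>x\<in>U. \<exists>r>0. mball x r \<subseteq> U)"
      by (simp add: openin_mtopology Ball_def)
    also have "\<dots> \<longleftrightarrow> U \<subseteq> S \<and> (\<forall>x\<in>U. \<exists>r>0. \<forall>x'\<in>S. dist x' x < r \<longrightarrow> x' \<in> U)"
      by (intro conj_cong refl ball_cong ex_cong1) (simp add: * subsetD)
    also have "\<dots> \<longleftrightarrow> openin (top_of_set S) U"
      by (simp add: openin_euclidean_subtopology_iff)
    finally show "openin mtopology U = openin (top_of_set S) U" .
  qed
qed

text \<open>Uniqueness of geodesics is the special case of \<open>arc_eq_geodesic\<close> in which the arc is itself a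
  rescaled geodesic. The metric \<open>d\<close> is only compared with \<open>dist\<close> on \<open>S\<close>, because the length metric
  takes the dummy value \<open>0\<close> outside \<open>S\<close>.\<close>

theorem real_tree_if_hyperbolic:
  fixes S :: "'a::metric_space set"
  assumes hyp: "\<And>x y z p. \<lbrakk>x \<in> S; y \<in> S; z \<in> S; p \<in> S\<rbrakk> \<Longrightarrow>
      min (gromov p x y) (gromov p y z) \<le> gromov p x z"
    and geo: "\<And>x y. \<lbrakk>x \<in> S; y \<in> S\<rbrakk> \<Longrightarrow> \<exists>\<phi>. geodesic_in S dist x y \<phi>"
    and "Metric_space S d" and d: "\<And>x y. \<lbrakk>x \<in> S; y \<in> S\<rbrakk> \<Longrightarrow> d x y = dist x y"
  shows "real_tree S d"
proof -
  have geo_d: "geodesic_in S d x y \<psi> \<longleftrightarrow> geodesic_in S dist x y \<psi>"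
    if "x \<in> S" "y \<in> S" for x y \<psi>
    using that d unfolding geodesic_in_def by (auto simp: Pi_iff)
  have top: "Metric_space.mtopology S d = top_of_set S"
    by (rule mtopology_eq_subspace) fact+
  have uniq: "\<psi> t = \<phi> t"
    if "x \<in> S" "y \<in> S" and \<phi>: "geodesic_in S dist x y \<phi>" and \<psi>: "geodesic_in S dist x y \<psi>"
      and t: "t \<in> {0..dist x y}" for x y \<phi> \<psi> t
  proof (cases "x = y")
    case True
    then show ?thesis using t \<phi> \<psi> by (simp add: geodesic_in_def)
  next
    case False
    define L where "L = dist x y"
    have L: "0 < L" using False by (simp add: L_def)
    define c where "c = (\<lambda>\<tau>. \<psi> (L * \<tau>))"
    have im: "(\<lambda>\<tau>. L * \<tau>) ` {0..1} = {0..L}"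
      using L by (simp add: image_mult_atLeastAtMost)
    have cim: "c ` {0..1} = \<psi> ` {0..L}" unfolding c_def im[symmetric] by (simp add: image_image)
    have "continuous_on {0..1} (\<psi> \<circ> (\<lambda>\<tau>. L * \<tau>))"
      using geodesic_in_continuous[OF \<psi>]
      by (intro continuous_on_compose continuous_intros) (simp add: im[unfolded L_def] L_def)
    then have "continuous_on {0..1} c" by (simp add: c_def comp_def)
    moreover have "inj_on c {0..1}"
    proof -
      have "inj_on (\<psi> \<circ> (\<lambda>\<tau>. L * \<tau>)) {0..1}"
        using L geodesic_in_inj[OF \<psi>] by (intro comp_inj_on) (auto simp: inj_on_def im L_def)
      then show ?thesis by (simp add: c_def comp_def)
    qed
    moreover have "c ` {0..1} \<subseteq> S"
      using \<psi> unfolding cim by (auto simp: geodesic_in_def L_def)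
    moreover have "c 0 = x" "c 1 = y"
      using \<psi> by (auto simp: geodesic_in_def c_def L_def)
    ultimately have "\<psi> ` {0..L} = \<phi> ` {0..L}"
      using arc_eq_geodesic[OF hyp \<phi>] cim by (simp add: L_def)
    moreover have "\<psi> t \<in> \<psi> ` {0..L}" using t by (simp add: L_def)
    ultimately obtain t' where t': "t' \<in> {0..L}" "\<psi> t = \<phi> t'" by auto
    have "dist (\<psi> 0) (\<psi> t) = t" "dist (\<phi> 0) (\<phi> t') = t'"
      using geodesic_inD(4)[OF \<psi>, of 0 t] geodesic_inD(4)[OF \<phi>, of 0 t'] t t'(1) L
      by (simp_all add: L_def)
    then have "t = t'" using t'(2) geodesic_inD(1)[OF \<phi>] geodesic_inD(1)[OF \<psi>] by simp
    then show ?thesis using t'(2) by simp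
  qed
  show ?thesis
    unfolding real_tree_def
  proof (intro conjI ballI)
    fix x y assume xy: "x \<in> S" "y \<in> S"
    obtain \<phi> where \<phi>: "geodesic_in S dist x y \<phi>" using geo[OF xy] by blast
    show "\<exists>\<phi>. geodesic_in S d x y \<phi> \<and>
        (\<forall>\<psi>. geodesic_in S d x y \<psi> \<longrightarrow> (\<forall>t\<in>{0..d x y}. \<psi> t = \<phi> t)) \<and>
        (\<forall>c. continuous_map (top_of_set {0..1}) (Metric_space.mtopology S d) c \<and>
             inj_on c {0..1} \<and> c 0 = x \<and> c 1 = y \<longrightarrow>
             c ` {0..1 :: real} = \<phi> ` {0..d x y})"
    proof (intro exI[of _ \<phi>] conjI allI impI ballI)
      show "geodesic_in S d x y \<phi>" using \<phi> xy by (simp add: geo_d)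
    next
      fix \<psi> t assume "geodesic_in S d x y \<psi>" "t \<in> {0..d x y}"
      then show "\<psi> t = \<phi> t" using uniq[OF xy \<phi>] xy by (simp add: geo_d d)
    next
      fix c :: "real \<Rightarrow> 'a"
      assume "continuous_map (top_of_set {0..1}) (Metric_space.mtopology S d) c \<and>
             inj_on c {0..1} \<and> c 0 = x \<and> c 1 = y"
      then show "c ` {0..1 :: real} = \<phi> ` {0..d x y}"
        using arc_eq_geodesic[OF hyp \<phi>, of c] xy
        by (simp add: top d continuous_map_in_subtopology image_subset_iff Pi_iff)
    qed
  qed fact
qed

section \<open>The length metric of a geodesic subset\<close>

lemma dist_le_curve_length: "ennreal (dist (g 0) (g 1)) \<le> curve_length g"
proof -
  define t where "t = (\<lambda>i::nat. if i = 0 then 0 else 1 :: real)"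
  have "(1::nat, t) \<in> {(n, t). mono t \<and> range t \<subseteq> {0..1}}"
    by (auto simp: t_def mono_def)
  from SUP_upper[OF this, of "\<lambda>(n, t). \<Sum>i<n. ennreal (dist (g (t i)) (g (t (Suc i))))"]
  show ?thesis unfolding curve_length_def by (simp add: t_def)
qed

lemma curve_length_lipschitz:
  assumes lip: "\<And>s t. \<lbrakk>s \<in> {0..1}; t \<in> {0..1}\<rbrakk> \<Longrightarrow> dist (g s) (g t) \<le> L * \<bar>s - t\<bar>"
    and "0 \<le> L"
  shows "curve_length g \<le> ennreal L"
  unfolding curve_length_def
proof (rule SUP_least, clarify)
  fix n and t :: "nat \<Rightarrow> real" assume t: "mono t" "range t \<subseteq> {0..1}"
  have t01: "t i \<in> {0..1}" for i using t(2) by blast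
  have "(\<Sum>i<n. dist (g (t i)) (g (t (Suc i)))) \<le> (\<Sum>i<n. L * (t (Suc i) - t i))"
  proof (rule sum_mono)
    fix i
    have "t i \<le> t (Suc i)" using t(1) by (simp add: mono_def)
    then show "dist (g (t i)) (g (t (Suc i))) \<le> L * (t (Suc i) - t i)"
      using lip[OF t01 t01, of i "Suc i"] by simp
  qed
  also have "\<dots> = L * (t n - t 0)"
    by (simp add: sum_distrib_left[symmetric] sum_lessThan_telescope)
  also have "\<dots> \<le> L * 1"
    using t01[of n] t01[of 0] \<open>0 \<le> L\<close> by (intro mult_left_mono) auto
  finally show "(\<Sum>i<n. ennreal (dist (g (t i)) (g (t (Suc i))))) \<le> ennreal L"
    by (simp add: sum_ennreal ennreal_leI)
qed

lemma length_metric_eq_dist: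
  assumes "geodesic_in S dist x y \<phi>"
  shows "length_metric S x y = dist x y"
proof -
  define L where "L = dist x y"
  let ?G = "{g. path g \<and> path_image g \<subseteq> S \<and> pathstart g = x \<and> pathfinish g = y}"
  define g where "g = (\<lambda>\<tau>. \<phi> (L * \<tau>))"
  have L: "0 \<le> L" by (simp add: L_def)
  have mem: "L * \<tau> \<in> {0..L}" if "\<tau> \<in> {0..1}" for \<tau>
    using that L by (auto intro: mult_left_le)
  have lip: "dist (g s) (g t) = L * \<bar>s - t\<bar>" if "s \<in> {0..1}" "t \<in> {0..1}" for s t
    using assms mem[OF that(1)] mem[OF that(2)] L
    by (simp add: geodesic_in_def g_def L_def right_diff_distrib[symmetric] abs_mult)
  have "continuous_on {0..1} (\<phi> \<circ> (\<lambda>\<tau>. L * \<tau>))"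
    using geodesic_in_continuous[OF assms] mem
    by (intro continuous_on_compose continuous_intros) (auto simp: L_def intro: continuous_on_subset)
  then have "g \<in> ?G"
    using assms mem by (auto simp: path_def path_image_def pathstart_def pathfinish_def g_def comp_def
        geodesic_in_def L_def)
  moreover have "curve_length g \<le> ennreal L"
    by (rule curve_length_lipschitz) (simp_all add: lip L)
  ultimately have "(INF g\<in>?G. curve_length g) \<le> ennreal L"
    by (meson INF_lower order_trans)
  moreover have "ennreal L \<le> (INF g\<in>?G. curve_length g)"
    by (rule INF_greatest)
      (use dist_le_curve_length in \<open>auto simp: L_def pathstart_def pathfinish_def\<close>)
  ultimately have "(INF g\<in>?G. curve_length g) = ennreal L" by (rule antisym)
  then show ?thesis
    unfolding length_metric_def by (simp add: L_def)
qed

lemma length_metric_outside: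
  assumes "x \<notin> S \<or> y \<notin> S"
  shows "length_metric S x y = 0"
proof -
  have "{g. path g \<and> path_image g \<subseteq> S \<and> pathstart g = x \<and> pathfinish g = y} = {}"
    using assms pathstart_in_path_image pathfinish_in_path_image by blast
  then show ?thesis unfolding length_metric_def by (simp only:) simp
qed

lemma Metric_space_length_metric:
  fixes S :: "'a::metric_space set"
  assumes geo: "\<And>x y. \<lbrakk>x \<in> S; y \<in> S\<rbrakk> \<Longrightarrow> \<exists>\<phi>. geodesic_in S dist x y \<phi>"
  shows "Metric_space S (length_metric S)"
proof -
  have eq: "length_metric S x y = dist x y" if "x \<in> S" "y \<in> S" for x y
    using geo[OF that] length_metric_eq_dist by blast
  show ?thesis
  proof
    fix x y
    show "0 \<le> length_metric S x y" by (simp add: length_metric_def)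
    show "length_metric S x y = length_metric S y x"
      by (cases "x \<in> S \<and> y \<in> S") (auto simp: eq length_metric_outside dist_commute)
  qed (auto simp: eq dist_triangle)
qed

section \<open>Coordinates and the norm of absolutely summable sequences\<close>

lemma coord_zero [simp]: "coord 0 k = 0"
  by (simp add: zero_l1.rep_eq)

lemma coord_add [simp]: "coord (x + y) k = coord x k + coord y k"
  by (simp add: plus_l1.rep_eq)

lemma coord_scaleR [simp]: "coord (c *\<^sub>R x) k = c * coord x k"
  by (simp add: scaleR_l1.rep_eq)

lemma coord_unit [simp]: "coord (unit_l1 j) k = (if k = j then 1 else 0)"
  by (simp add: unit_l1.rep_eq)

declare coord_diff [simp]

lemma norm_scaleR_unit [simp]: "norm (t *\<^sub>R unit_l1 j) = \<bar>t\<bar>"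
proof -
  have "(\<Sum>k. \<bar>coord (t *\<^sub>R unit_l1 j) k\<bar>) = (\<Sum>k\<in>{j}. \<bar>coord (t *\<^sub>R unit_l1 j) k\<bar>)"
    by (rule suminf_finite) auto
  then show ?thesis by (simp add: norm_l1_def)
qed

text \<open>The norm is additive along a path that turns into a new coordinate direction at each gluing
  point; this is why norm distances in the tree are lengths.\<close>

lemma norm_add_disjoint_support:
  assumes "\<And>k. coord x k = 0 \<or> coord y k = 0"
  shows "norm (x + y) = norm x + norm y"
proof -
  have "norm (x + y) = (\<Sum>k. \<bar>coord x k\<bar> + \<bar>coord y k\<bar>)"
    unfolding norm_l1_def
  proof (rule suminf_cong)
    fix k show "\<bar>coord (x + y) k\<bar> = \<bar>coord x k\<bar> + \<bar>coord y k\<bar>"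
      using assms[of k] by auto
  qed
  then show ?thesis
    by (simp add: norm_l1_def suminf_add[OF summable_coord summable_coord])
qed

lemma bounded_linear_coord: "bounded_linear (\<lambda>x. coord x k)"
  by (rule bounded_linear_intro[where K = 1]) (simp_all add: coord_le_norm)

lemmas tendsto_coord [tendsto_intros] = bounded_linear.tendsto[OF bounded_linear_coord]
lemmas continuous_on_coord [continuous_intros] = bounded_linear.continuous_on[OF bounded_linear_coord]

definition nonneg :: "l1 \<Rightarrow> bool" where "nonneg x \<longleftrightarrow> (\<forall>k. 0 \<le> coord x k)"

abbreviation psum :: "l1 \<Rightarrow> nat \<Rightarrow> real" where "psum x k \<equiv> (\<Sum>i<k. coord x i)"

lemma psum_tendsto_norm:
  assumes "nonneg x"
  shows "psum x \<longlonglongrightarrow> norm x"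
  using summable_LIMSEQ[OF summable_coord[of x]] assms by (simp add: norm_l1_def nonneg_def)

lemma psum_mono:
  assumes "nonneg x" "i \<le> j"
  shows "psum x i \<le> psum x j"
  using assms by (intro sum_mono2) (auto simp: nonneg_def)

lemma psum_le_norm:
  assumes "nonneg x"
  shows "psum x k \<le> norm x"
  using sum_coord_le_norm[where x = x and K = k] assms by (simp add: nonneg_def)

section \<open>Ancestors\<close>

text \<open>The ancestral line of \<open>x\<close> fills the coordinates of \<open>x\<close> one after the other; \<open>ancestor t x\<close> is
  the point at height \<open>t\<close> on it, and \<open>x\<close> itself when \<open>t\<close> exceeds the norm of \<open>x\<close>. The cut-off at \<open>0\<close> keeps it
  summable for arbitrary \<open>x\<close>.\<close>

lift_definition ancestor :: "real \<Rightarrow> l1 \<Rightarrow> l1" is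
  "\<lambda>t f k. max 0 (min (f k) (t - (\<Sum>i<k. f i)))"
  by (erule summable_comparison_test'[where N = 0]) auto

lemma coord_ancestor: "coord (ancestor t x) k = max 0 (min (coord x k) (t - psum x k))"
  by (simp add: ancestor.rep_eq)

text \<open>Written as an increment, the coordinates of an ancestor telescope.\<close>

lemma coord_ancestor_increment:
  assumes "nonneg x" "0 \<le> t"
  shows "coord (ancestor t x) k = min t (psum x (Suc k)) - min t (psum x k)"
proof -
  have "0 \<le> coord x k" using assms(1) by (simp add: nonneg_def)
  then show ?thesis by (simp add: coord_ancestor max_def min_def)
qed

lemma nonneg_ancestor [simp]: "nonneg (ancestor t x)"
  by (simp add: nonneg_def coord_ancestor)

lemma norm_ancestor:
  assumes "nonneg x" "0 \<le> t"
  shows "norm (ancestor t x) = min t (norm x)"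
proof -
  have "(\<lambda>k. min t (psum x k)) \<longlonglongrightarrow> min t (norm x)"
    by (intro tendsto_min tendsto_const psum_tendsto_norm assms)
  from telescope_sums[OF this] have "(\<lambda>k. coord (ancestor t x) k) sums min t (norm x)"
    using assms(2) by (simp add: coord_ancestor_increment[OF assms])
  then show ?thesis
    using nonneg_ancestor[of t x] by (simp add: norm_l1_def nonneg_def sums_iff)
qed

lemma dist_nonneg_le:
  assumes "nonneg x" "\<And>k. coord x k \<le> coord y k"
  shows "dist x y = norm y - norm x"
proof -
  have "(\<Sum>k. \<bar>coord y k\<bar> - \<bar>coord x k\<bar>) = norm y - norm x"
    unfolding norm_l1_def by (rule suminf_diff[OF summable_coord summable_coord, symmetric])
  moreover have "norm (x - y) = (\<Sum>k. \<bar>coord y k\<bar> - \<bar>coord x k\<bar>)"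
    unfolding norm_l1_def
  proof (intro suminf_cong)
    fix k show "\<bar>coord (x - y) k\<bar> = \<bar>coord y k\<bar> - \<bar>coord x k\<bar>"
      using assms(1) assms(2)[of k] unfolding nonneg_def by (smt (verit) coord_diff)
  qed
  ultimately show ?thesis by (simp add: dist_norm)
qed

lemma dist_ancestor:
  assumes "nonneg x" "0 \<le> s" "0 \<le> t"
  shows "dist (ancestor s x) (ancestor t x) = \<bar>min s (norm x) - min t (norm x)\<bar>"
proof -
  have *: "dist (ancestor s x) (ancestor t x) = min t (norm x) - min s (norm x)"
    if "s \<le> t" "0 \<le> s" for s t
  proof -
    have "coord (ancestor s x) k \<le> coord (ancestor t x) k" for k
      using that by (auto simp: coord_ancestor)
    then show ?thesis using that assms(1) by (simp add: dist_nonneg_le norm_ancestor)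
  qed
  show ?thesis
    using *[of s t] *[of t s] assms by (cases "s \<le> t") (auto simp: dist_commute min_def)
qed

lemma ancestor_norm:
  assumes "nonneg x" "norm x \<le> t"
  shows "ancestor t x = x"
proof (rule l1_eqI)
  fix k
  have "psum x (Suc k) \<le> t" using psum_le_norm[OF assms(1), of "Suc k"] assms(2) by linarith
  then show "coord (ancestor t x) k = coord x k"
    using assms(1) by (auto simp: coord_ancestor nonneg_def)
qed

lemma dist_self_ancestor:
  assumes "nonneg x" "0 \<le> t" "t \<le> norm x"
  shows "dist (ancestor t x) x = norm x - t"
  using dist_ancestor[OF assms(1,2), of "norm x"] ancestor_norm[OF assms(1) order_refl] assms
  by simp

section \<open>Pairs of points branching apart\<close>

text \<open>Once two points have separated, no later branch carries both of their ancestral lines.\<close>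

definition branching :: "l1 \<Rightarrow> l1 \<Rightarrow> bool" where
  "branching x y \<longleftrightarrow>
     (\<forall>i j. j < i \<longrightarrow> coord x j \<noteq> coord y j \<longrightarrow> coord x i = 0 \<or> coord y i = 0)"

lemma branching_commute: "branching x y \<longleftrightarrow> branching y x"
  unfolding branching_def by metis

lemma gromov_0: "gromov 0 x y = (norm x + norm y - dist x y) / 2"
  by (simp add: gromov_def)

lemma gromov_0_le_norm: "gromov 0 x y \<le> norm x" "gromov 0 x y \<le> norm y"
  using gromov_le_dist[of 0 x y] gromov_le_dist[of 0 y x] by (simp_all add: gromov_commute)

text \<open>For branching points the Gromov product at \<open>0\<close> is the sum of the coordinates before the first
  difference \<open>j\<close> plus the smaller of the two \<open>j\<close>-th coordinates: exactly the height up to which the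
  two ancestral lines coincide.\<close>

lemma ancestor_eq_below_gromov:
  assumes x: "nonneg x" and y: "nonneg y" and b: "branching x y"
    and t: "t \<le> gromov 0 x y"
  shows "ancestor t x = ancestor t y"
proof (cases "x = y")
  case False
  then obtain j0 where "coord x j0 \<noteq> coord y j0" using l1_eqI by blast
  define j where "j = (LEAST j. coord x j \<noteq> coord y j)"
  have j: "coord x j \<noteq> coord y j" unfolding j_def by (rule LeastI) fact
  have below: "coord x i = coord y i" if "i < j" for i
    using not_less_Least[of i "\<lambda>j. coord x j \<noteq> coord y j"] that by (simp add: j_def)
  have ps: "psum x i = psum y i" if "i \<le> j" for i using below that by (intro sum.cong) auto
  let ?g = "\<lambda>k. \<bar>coord x k\<bar> + \<bar>coord y k\<bar> - \<bar>coord (x - y) k\<bar>"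
  have "(\<Sum>k. ?g k) = norm x + norm y - dist x y"
    unfolding norm_l1_def dist_norm
    by (simp only: suminf_add[OF summable_coord summable_coord]
        suminf_diff[OF summable_add[OF summable_coord summable_coord] summable_coord])
  moreover have "(\<Sum>k. ?g k) = (\<Sum>k\<in>{..j}. ?g k)"
  proof (rule suminf_finite)
    fix k assume "k \<notin> {..j}"
    then have "coord x k = 0 \<or> coord y k = 0" using b j by (auto simp: branching_def not_le)
    then show "?g k = 0" by auto
  qed simp
  moreover have "(\<Sum>k\<in>{..j}. ?g k) = (\<Sum>k\<in>{..j}. 2 * min (coord x k) (coord y k))"
    using x y by (intro sum.cong) (auto simp: nonneg_def min_def abs_if not_less antisym)
  moreover have "\<dots> = 2 * (psum x j + min (coord x j) (coord y j))"
    using below by (simp add: lessThan_Suc_atMost[symmetric] sum_distrib_left distrib_left)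
  ultimately have *: "norm x + norm y - dist x y = 2 * (psum x j + min (coord x j) (coord y j))"
    by linarith
  have t': "t - psum x j \<le> min (coord x j) (coord y j)"
    using t unfolding gromov_0 * by (simp add: min_def split: if_splits)
  show ?thesis
  proof (rule l1_eqI)
    fix k
    consider "k < j" | "k = j" | "j < k" by linarith
    then show "coord (ancestor t x) k = coord (ancestor t y) k"
    proof cases
      case 1
      then show ?thesis using below ps by (simp add: coord_ancestor)
    next
      case 2
      then show ?thesis using t' ps[of j] by (auto simp: coord_ancestor)
    next
      case 3
      have "t \<le> psum x (Suc j)" "t \<le> psum y (Suc j)" using t' ps[of j] by auto
      then have "t \<le> psum x k" "t \<le> psum y k"
        using psum_mono[OF x, of "Suc j" k] psum_mono[OF y, of "Suc j" k] 3 by linarith+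
      then show ?thesis by (auto simp: coord_ancestor)
    qed
  qed
qed simp

lemma le_gromov_if_ancestor_eq:
  assumes "nonneg x" "nonneg y" "0 \<le> t" "t \<le> norm x" "t \<le> norm y"
    and "ancestor t x = ancestor t y"
  shows "t \<le> gromov 0 x y"
proof -
  have "dist x y \<le> dist (ancestor t x) x + dist (ancestor t y) y"
    using assms(6) by (metis dist_commute dist_triangle)
  also have "\<dots> = (norm x - t) + (norm y - t)"
    by (simp only: dist_self_ancestor[OF assms(1,3,4)] dist_self_ancestor[OF assms(2,3,5)])
  finally show ?thesis by (simp add: gromov_0)
qed

text \<open>Having the same ancestor at height \<open>t\<close> is a transitive relation.\<close>

lemma gromov_0_ultrametric:
  assumes "nonneg x" "nonneg y" "nonneg z" "branching x y" "branching y z"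
  shows "min (gromov 0 x y) (gromov 0 y z) \<le> gromov 0 x z"
proof (rule le_gromov_if_ancestor_eq)
  let ?t = "min (gromov 0 x y) (gromov 0 y z)"
  show "0 \<le> ?t" by (simp add: gromov_nonneg)
  show "?t \<le> norm x" "?t \<le> norm z"
    using gromov_0_le_norm[of x y] gromov_0_le_norm[of y z] by linarith+
  have "ancestor ?t x = ancestor ?t y" "ancestor ?t y = ancestor ?t z"
    using assms by (intro ancestor_eq_below_gromov; simp)+
  then show "ancestor ?t x = ancestor ?t z" by simp
qed fact+

section \<open>Ancestral sets are real trees\<close>

definition ancestral :: "l1 set \<Rightarrow> bool" where
  "ancestral S \<longleftrightarrow> (\<forall>x\<in>S. nonneg x \<and> (\<forall>t\<ge>0. ancestor t x \<in> S)) \<and> (\<forall>x\<in>S. \<forall>y\<in>S. branching x y)"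

lemma ancestralD:
  assumes "ancestral S"
  shows "x \<in> S \<Longrightarrow> nonneg x" "\<lbrakk>x \<in> S; 0 \<le> t\<rbrakk> \<Longrightarrow> ancestor t x \<in> S"
    "\<lbrakk>x \<in> S; y \<in> S\<rbrakk> \<Longrightarrow> branching x y"
  using assms by (auto simp: ancestral_def)

text \<open>Changing the base point from \<open>0\<close> to \<open>p\<close> is pure arithmetic: by the ultrametric inequalities at \<open>0\<close>
  the two smallest among the three sums \<open>G x y + G z p\<close>, \<open>G y z + G x p\<close>, \<open>G x z + G y p\<close> agree.\<close>

lemma ancestral_hyperbolic:
  assumes S: "ancestral S" and xyzp: "x \<in> S" "y \<in> S" "z \<in> S" "p \<in> S"
  shows "min (gromov p x y) (gromov p y z) \<le> gromov p x z"
proof -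
  define G where "G = gromov (0::l1)"
  have u: "min (G a b) (G b c) \<le> G a c" if "a \<in> S" "b \<in> S" "c \<in> S" for a b c
    unfolding G_def using that ancestralD[OF S] by (intro gromov_0_ultrametric) auto
  have c: "G a b = G b a" for a b by (simp add: G_def gromov_commute)
  have g: "gromov p a b = norm p - G a p - G b p + G a b" for a b
    by (simp add: G_def gromov_def field_simps)
  have "min (G x y + G z p) (G y z + G x p) \<le> G x z + G y p"
    using u[OF xyzp(1,2,3)] u[OF xyzp(1,4,3)] u[OF xyzp(2,1,4)] u[OF xyzp(2,3,4)]
      u[OF xyzp(1,2,4)] u[OF xyzp(1,3,4)] u[OF xyzp(3,1,4)] u[OF xyzp(3,2,4)]
      u[OF xyzp(1,3,2)] u[OF xyzp(1,4,2)] u[OF xyzp(2,1,3)] u[OF xyzp(2,4,3)]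
      c[of z p] c[of y x] c[of z y] c[of p x] c[of p y] c[of z x] c[of p z]
    by (smt (verit))
  then show ?thesis by (simp add: g min_def split: if_splits)
qed

lemma ancestral_geodesic:
  assumes S: "ancestral S" and xy: "x \<in> S" "y \<in> S"
  shows "\<exists>\<phi>. geodesic_in S dist x y \<phi>"
proof -
  define m where "m = gromov 0 x y"
  define L where "L = dist x y"
  have nn: "nonneg x" "nonneg y" using ancestralD(1)[OF S] xy by auto
  have m: "0 \<le> m" "m \<le> norm x" "m \<le> norm y"
    by (simp_all add: m_def gromov_nonneg gromov_0_le_norm)
  have L: "L = (norm x - m) + (norm y - m)" by (simp add: m_def gromov_0 L_def)
  \<comment> \<open>descend from \<open>x\<close> to the last common ancestor, at height \<open>m\<close>, then climb to \<open>y\<close>\<close>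
  define \<phi> where "\<phi> = (\<lambda>t. if t \<le> norm x - m then ancestor (norm x - t) x
      else ancestor (t - norm x + 2 * m) y)"
  have meet: "ancestor m x = ancestor m y"
    using ancestralD(3)[OF S xy] by (intro ancestor_eq_below_gromov nn) (simp_all add: m_def)
  have lip: "dist (\<phi> s) (\<phi> t) \<le> t - s" if "0 \<le> s" "s \<le> t" "t \<le> L" for s t
  proof -
    consider "t \<le> norm x - m" | "s \<le> norm x - m" "norm x - m < t" | "norm x - m < s"
      using \<open>s \<le> t\<close> by linarith
    then show ?thesis
    proof cases
      case 1
      then show ?thesis using that m L by (simp add: \<phi>_def dist_ancestor[OF nn(1)])
    next
      case 2
      have "dist (\<phi> s) (\<phi> t) \<le> dist (ancestor (norm x - s) x) (ancestor m x) +
          dist (ancestor m y) (ancestor (t - norm x + 2 * m) y)"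
        using 2 meet by (simp add: \<phi>_def dist_triangle)
      also have "\<dots> \<le> (norm x - s - m) + (t - norm x + 2 * m - m)"
        using that m L 2 by (simp add: dist_ancestor nn)
      finally show ?thesis by simp
    next
      case 3
      then show ?thesis using that m L by (simp add: \<phi>_def dist_ancestor[OF nn(2)])
    qed
  qed
  have ends: "\<phi> 0 = x" "\<phi> L = y"
  proof -
    show "\<phi> 0 = x" using m by (simp add: \<phi>_def ancestor_norm nn)
    show "\<phi> L = y"
    proof (cases "norm y = m")
      case True
      then show ?thesis using meet L by (simp add: \<phi>_def ancestor_norm nn)
    next
      case False
      then show ?thesis using m L by (simp add: \<phi>_def ancestor_norm nn)
    qed
  qed
  \<comment> \<open>a 1-Lipschitz curve on \<open>[0, dist x y]\<close> that joins \<open>x\<close> to \<open>y\<close> cannot lose any distance\<close>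
  have iso: "dist (\<phi> s) (\<phi> t) = t - s" if "0 \<le> s" "s \<le> t" "t \<le> L" for s t
  proof -
    have "L \<le> dist x (\<phi> s) + dist (\<phi> s) (\<phi> t) + dist (\<phi> t) y"
      unfolding L_def by (smt (verit) dist_triangle)
    also have "dist x (\<phi> s) \<le> s" using lip[of 0 s] that ends by simp
    also have "dist (\<phi> t) y \<le> L - t" using lip[of t L] that ends by simp
    finally show ?thesis using lip[OF that] by linarith
  qed
  have "geodesic_in S dist x y \<phi>"
    unfolding geodesic_in_def L_def[symmetric]
  proof (intro conjI ballI)
    show "\<phi> \<in> {0..L} \<rightarrow> S"
      using ancestralD(2)[OF S] xy m by (auto simp: \<phi>_def)
    fix s t assume "s \<in> {0..L}" "t \<in> {0..L}"
    then show "dist (\<phi> s) (\<phi> t) = \<bar>s - t\<bar>"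
      using iso[of s t] iso[of t s] by (cases "s \<le> t") (auto simp: dist_commute)
  qed (fact ends)+
  then show ?thesis by blast
qed

text \<open>This continuity of \<open>ancestor t\<close> on a tree is what lets ancestral sets be closed up. If the lines
  separate below height \<open>t\<close>, go through the last common ancestor.\<close>

lemma dist_ancestor_le:
  assumes "nonneg x" "nonneg y" "branching x y" "0 \<le> t"
  shows "dist (ancestor t x) (ancestor t y) \<le> dist x y"
proof (cases "t \<le> gromov 0 x y")
  case True
  then show ?thesis using assms ancestor_eq_below_gromov[of x y t] by simp
next
  case False
  define m where "m = gromov 0 x y"
  have m: "0 \<le> m" "m \<le> norm x" "m \<le> norm y" "m \<le> t"
    using False by (simp_all add: m_def gromov_nonneg gromov_0_le_norm)
  have "ancestor m x = ancestor m y"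
    using assms by (intro ancestor_eq_below_gromov) (simp_all add: m_def)
  then have "dist (ancestor t x) (ancestor t y) \<le>
      dist (ancestor t x) (ancestor m x) + dist (ancestor m y) (ancestor t y)"
    by (simp add: dist_triangle)
  also have "\<dots> \<le> (norm x - m) + (norm y - m)"
    using assms m by (simp add: dist_ancestor)
  also have "\<dots> = dist x y" by (simp add: m_def gromov_0)
  finally show ?thesis .
qed

lemma ancestral_closure:
  assumes S: "ancestral S"
  shows "ancestral (closure S)"
proof -
  have nn: "nonneg x" if x: "x \<in> closure S" for x
  proof -
    obtain X where X: "\<And>n. X n \<in> S" "X \<longlonglongrightarrow> x" using x unfolding closure_sequential by blast
    show ?thesis unfolding nonneg_def
    proof
      fix k show "0 \<le> coord x k"
        using LIMSEQ_le_const[OF tendsto_coord[OF X(2)], of 0 k] ancestralD(1)[OF S X(1)]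
        by (auto simp: nonneg_def)
    qed
  qed
  have br: "branching x y" if xy: "x \<in> closure S" "y \<in> closure S" for x y
  proof -
    obtain X where X: "\<And>n. X n \<in> S" "X \<longlonglongrightarrow> x" using xy(1) unfolding closure_sequential by blast
    obtain Y where Y: "\<And>n. Y n \<in> S" "Y \<longlonglongrightarrow> y" using xy(2) unfolding closure_sequential by blast
    show ?thesis unfolding branching_def
    proof (intro allI impI)
      fix i j :: nat assume ij: "j < i" "coord x j \<noteq> coord y j"
      have "(\<lambda>n. coord (X n) j - coord (Y n) j) \<longlonglongrightarrow> coord x j - coord y j"
        by (intro tendsto_diff tendsto_coord X Y)
      then have "\<forall>\<^sub>F n in sequentially. coord (X n) j - coord (Y n) j \<noteq> 0"
        using ij by (intro tendsto_imp_eventually_ne) auto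
      then have "\<forall>\<^sub>F n in sequentially. coord (X n) i * coord (Y n) i = 0"
      proof eventually_elim
        case (elim n)
        then show ?case using ancestralD(3)[OF S X(1) Y(1), of n n] ij(1) by (auto simp: branching_def)
      qed
      moreover have "(\<lambda>n. coord (X n) i * coord (Y n) i) \<longlonglongrightarrow> coord x i * coord y i"
        by (intro tendsto_mult tendsto_coord X Y)
      ultimately have "coord x i * coord y i = 0"
        by (intro LIMSEQ_unique[OF _ tendsto_eventually])
      then show "coord x i = 0 \<or> coord y i = 0" by simp
    qed
  qed
  have "ancestor t x \<in> closure S" if xt: "x \<in> closure S" "0 \<le> t" for x t
  proof -
    obtain X where X: "\<And>n. X n \<in> S" "X \<longlonglongrightarrow> x" using xt(1) unfolding closure_sequential by blast
    have Xc: "X n \<in> closure S" for n using X(1) closure_subset by blast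
    have "(\<lambda>n. dist (ancestor t (X n)) (ancestor t x)) \<longlonglongrightarrow> 0"
    proof (rule tendsto_sandwich[OF _ _ tendsto_const])
      show "(\<lambda>n. dist (X n) x) \<longlonglongrightarrow> 0" using X(2) by (rule tendsto_dist_iff[THEN iffD1])
    qed (use nn[OF Xc] nn[OF xt(1)] br[OF Xc xt(1)] xt(2) in \<open>auto simp: dist_ancestor_le\<close>)
    then have "(\<lambda>n. ancestor t (X n)) \<longlonglongrightarrow> ancestor t x" by (rule tendsto_dist_iff[THEN iffD2])
    then show ?thesis using ancestralD(2)[OF S X(1) xt(2)] unfolding closure_sequential
      by (intro exI[of _ "\<lambda>n. ancestor t (X n)"]) auto
  qed
  then show ?thesis using nn br by (auto simp: ancestral_def)
qed

theorem ancestral_real_tree: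
  assumes "ancestral S"
  shows "real_tree S (length_metric S)"
    and "\<And>x y. \<lbrakk>x \<in> S; y \<in> S\<rbrakk> \<Longrightarrow> length_metric S x y = dist x y"
proof -
  note geo = ancestral_geodesic[OF assms]
  show eq: "length_metric S x y = dist x y" if "x \<in> S" "y \<in> S" for x y
    using geo[OF that] length_metric_eq_dist by blast
  show "real_tree S (length_metric S)"
    using ancestral_hyperbolic[OF assms] geo Metric_space_length_metric[OF geo] eq
    by (rule real_tree_if_hyperbolic)
qed

section \<open>The aggregation tree is ancestral\<close>

lemma agg_tree_Suc: "agg_tree a u (Suc n) = agg_tree a u n \<union> branch_point u (Suc n) ` {0..a (Suc n)}"
  by (auto simp: agg_tree_def atLeastAtMostSuc_conv)

lemma branch_point_Suc: "n \<ge> 1 \<Longrightarrow> branch_point u (Suc n) x = u n + x *\<^sub>R unit_l1 n"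
  by (simp add: branch_point_def)

lemma agg_tree_1: "agg_tree a u (Suc 0) = (\<lambda>x. x *\<^sub>R unit_l1 0) ` {0..a (Suc 0)}"
  by (auto simp: agg_tree_def branch_point_def)

lemma agg_tree_mono: "m \<le> n \<Longrightarrow> agg_tree a u m \<subseteq> agg_tree a u n"
  unfolding agg_tree_def by fastforce

text \<open>A single realization of the gluing points. What is derived here holds surely.\<close>

locale gluing_points =
  fixes a :: "nat \<Rightarrow> real" and u :: "nat \<Rightarrow> l1"
  assumes a_pos: "\<And>i. i \<ge> 1 \<Longrightarrow> a i > 0"
    and u_in: "\<And>n. n \<ge> 1 \<Longrightarrow> u n \<in> agg_tree a u n"
begin

text \<open>Induction along the ancestral line of a point, branch by branch.\<close>

lemma agg_tree_induct [consumes 2, case_names root branch]: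
  assumes "x \<in> agg_tree a u n" "n \<ge> 1"
    and "\<And>s. \<lbrakk>0 \<le> s; s \<le> a 1\<rbrakk> \<Longrightarrow> P (s *\<^sub>R unit_l1 0)"
    and "\<And>m s. \<lbrakk>1 \<le> m; m < n; u m \<in> agg_tree a u m; P (u m); 0 \<le> s; s \<le> a (Suc m)\<rbrakk> \<Longrightarrow>
           P (u m + s *\<^sub>R unit_l1 m)"
  shows "P x"
proof -
  have "\<forall>x\<in>agg_tree a u k. P x" if "1 \<le> k" "k \<le> n" for k
    using that
  proof (induction k rule: nat_induct_at_least)
    case base
    then show ?case using assms(3) by (auto simp: agg_tree_1)
  next
    case (Suc k)
    then show ?case using assms(4)[of k] u_in[of k] by (auto simp: agg_tree_Suc branch_point_Suc)
  qed
  then show ?thesis using assms(1,2) by blast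
qed

lemma coord_agg_tree_0:
  assumes "x \<in> agg_tree a u n" "n \<ge> 1" "n \<le> i"
  shows "coord x i = 0"
  using assms(2,1,3)
proof (induction n arbitrary: x i rule: nat_induct_at_least)
  fix n x i assume "1 \<le> n" "\<And>x i. \<lbrakk>x \<in> agg_tree a u n; n \<le> i\<rbrakk> \<Longrightarrow> coord x i = 0"
    "x \<in> agg_tree a u (Suc n)" "Suc n \<le> i"
  then show "coord x i = 0" using u_in[of n] by (auto simp: agg_tree_Suc branch_point_Suc)
qed (use assms(2) in \<open>auto simp: agg_tree_1\<close>)

lemma nonneg_agg_tree:
  assumes "x \<in> agg_tree a u n" "n \<ge> 1"
  shows "nonneg x"
  using assms by (induction rule: agg_tree_induct) (auto simp: nonneg_def)

lemma branching_agg_tree: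
  assumes "n \<ge> 1" "x \<in> agg_tree a u n" "y \<in> agg_tree a u n"
  shows "branching x y"
  using assms
proof (induction n arbitrary: x y rule: nat_induct_at_least)
  case base
  then show ?case by (auto simp: agg_tree_1 branching_def)
next
  case (Suc n)
  have new: "branching x (u n + s *\<^sub>R unit_l1 n)" if "x \<in> agg_tree a u n" for x s
    using Suc.IH[OF that u_in[OF Suc.hyps]] coord_agg_tree_0[OF that Suc.hyps]
      coord_agg_tree_0[OF u_in[OF Suc.hyps] Suc.hyps]
    by (auto simp: branching_def)
  have "branching (u n + s *\<^sub>R unit_l1 n) (u n + s' *\<^sub>R unit_l1 n)" for s s'
    using coord_agg_tree_0[OF u_in[OF Suc.hyps] Suc.hyps] by (auto simp: branching_def)
  moreover have "branching (u n + s *\<^sub>R unit_l1 n) x" if "x \<in> agg_tree a u n" for x s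
    using new[OF that] by (simp add: branching_commute)
  ultimately show ?case
    using Suc.prems Suc.IH Suc.hyps new by (auto simp: agg_tree_Suc branch_point_Suc)
qed

lemma ancestor_agg_tree:
  assumes "n \<ge> 1" "x \<in> agg_tree a u n" "0 \<le> t"
  shows "ancestor t x \<in> agg_tree a u n"
  using assms(1,2)
proof (induction n arbitrary: x rule: nat_induct_at_least)
  case base
  then obtain s where s: "0 \<le> s" "s \<le> a 1" "x = s *\<^sub>R unit_l1 0" by (auto simp: agg_tree_1)
  have "psum x k = (if k = 0 then 0 else s)" for k
    by (induction k) (auto simp: s(3))
  then have "ancestor t x = min s t *\<^sub>R unit_l1 0"
    using s assms(3) by (intro l1_eqI) (auto simp: coord_ancestor)
  then show ?case using s assms(3) by (auto simp: agg_tree_1)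
next
  case (Suc n)
  show ?case
  proof (cases "x \<in> agg_tree a u n")
    case True
    then show ?thesis using Suc by (simp add: agg_tree_Suc)
  next
    case False
    then obtain s where s: "0 \<le> s" "s \<le> a (Suc n)" "x = u n + s *\<^sub>R unit_l1 n"
      using Suc by (auto simp: agg_tree_Suc branch_point_Suc)
    have un: "nonneg (u n)" "\<And>i. n \<le> i \<Longrightarrow> coord (u n) i = 0"
      using u_in[OF Suc.hyps] nonneg_agg_tree coord_agg_tree_0 Suc.hyps by blast+
    have ps: "psum x k = psum (u n) k" if "k \<le> n" for k
      using that by (intro sum.cong) (auto simp: s(3))
    have nu: "norm (u n) = psum (u n) n"
      unfolding norm_l1_def using un(1)
      by (subst suminf_finite[of "{..<n}"]) (auto simp: un(2) nonneg_def)
    \<comment> \<open>below the gluing point the ancestors of \<open>x\<close> are those of \<open>u n\<close>, above it they lie on the new branch\<close>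
    show ?thesis
    proof (cases "t \<le> norm (u n)")
      case True
      have "ancestor t x = ancestor t (u n)"
      proof (rule l1_eqI)
        fix k
        show "coord (ancestor t x) k = coord (ancestor t (u n)) k"
        proof (cases "k < n")
          case True
          then show ?thesis using ps[of k] s by (simp add: coord_ancestor)
        next
          case False
          have "nonneg x" using s un(1) by (auto simp: nonneg_def)
          then have "psum x n \<le> psum x k" using False by (intro psum_mono) auto
          then have "t \<le> psum x k" using ps[of n] nu True by simp
          then show ?thesis using False un(2)[of k] by (auto simp: coord_ancestor)
        qed
      qed
      then show ?thesis using Suc u_in by (simp add: agg_tree_Suc)
    next
      case False
      have "ancestor t x = u n + min s (t - norm (u n)) *\<^sub>R unit_l1 n"
      proof (rule l1_eqI)
        fix k
        consider "k < n" | "k = n" | "n < k" by linarith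
        then show "coord (ancestor t x) k = coord (u n + min s (t - norm (u n)) *\<^sub>R unit_l1 n) k"
        proof cases
          case 1
          have "psum (u n) (Suc k) \<le> norm (u n)" by (rule psum_le_norm) fact
          then show ?thesis
            using 1 ps[of k] s False un(1) by (auto simp: coord_ancestor nonneg_def)
        next
          case 2
          then show ?thesis using ps[of n] s False un(2)[of n] nu by (auto simp: coord_ancestor)
        next
          case 3
          then show ?thesis using s un(2)[of k] by (auto simp: coord_ancestor)
        qed
      qed
      then show ?thesis
        using s False Suc.hyps by (auto simp: agg_tree_Suc branch_point_Suc)
    qed
  qed
qed

lemma ancestral_agg_trees: "ancestral (\<Union>n\<in>{1..}. agg_tree a u n)"
proof -
  have br: "branching x y" if "x \<in> agg_tree a u m" "y \<in> agg_tree a u n" "m \<ge> 1" "n \<ge> 1" for x y m n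
    using that agg_tree_mono[of m "max m n" a u] agg_tree_mono[of n "max m n" a u]
    by (intro branching_agg_tree[of "max m n"]) auto
  show ?thesis
    unfolding ancestral_def
  proof (intro conjI ballI allI impI)
    fix x assume "x \<in> (\<Union>n\<in>{1..}. agg_tree a u n)"
    then obtain m where m: "x \<in> agg_tree a u m" "m \<ge> 1" by auto
    then show "nonneg x" by (rule nonneg_agg_tree)
    show "ancestor t x \<in> (\<Union>n\<in>{1..}. agg_tree a u n)" if "0 \<le> t" for t
      using ancestor_agg_tree[OF m(2,1) that] m(2) by auto
    fix y assume "y \<in> (\<Union>n\<in>{1..}. agg_tree a u n)"
    then show "branching x y" using br[OF m(1) _ m(2)] by auto
  qed
qed

lemma ancestral_agg_tree_limit: "ancestral (agg_tree_limit a u)"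
  unfolding agg_tree_limit_def by (intro ancestral_closure ancestral_agg_trees)

end

section \<open>Points supported on the first coordinates\<close>

text \<open>As events about a gluing point have to be preimages of fixed Borel sets, lying in the random tree
  \<open>T\<^sub>m\<close> or on its branch \<open>j + 1\<close> is expressed through coordinates: within the tree these are the sets
  \<open>low m\<close> (\<open>agg_tree_Int_low\<close>) and \<open>slice j {0<..}\<close> (\<open>on_branch\<close>).\<close>

definition low :: "nat \<Rightarrow> l1 set" where "low m = {x. \<forall>i\<ge>m. coord x i = 0}"

lemma lowD: "\<lbrakk>x \<in> low m; m \<le> i\<rbrakk> \<Longrightarrow> coord x i = 0"
  by (simp add: low_def)

lemma low_mono: "m \<le> n \<Longrightarrow> low m \<subseteq> low n"
  by (auto simp: low_def)

definition slice :: "nat \<Rightarrow> real set \<Rightarrow> l1 set" where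
  "slice j I = {x \<in> low (Suc j). coord x j \<in> I}"

lemma measurable_coord [measurable]: "(\<lambda>x. coord x i) \<in> borel_measurable borel"
  by (intro borel_measurable_continuous_onI continuous_intros)

lemma low_sets [measurable]: "low m \<in> sets borel"
proof -
  have "low m = {x \<in> space borel. \<forall>i. m \<le> i \<longrightarrow> coord x i = 0}" by (simp add: low_def)
  also have "\<dots> \<in> sets borel" by measurable
  finally show ?thesis .
qed

lemma slice_sets [measurable (raw)]: "I \<in> sets borel \<Longrightarrow> slice j I \<in> sets borel"
proof -
  assume [measurable]: "I \<in> sets borel"
  have "slice j I = {x \<in> space borel. x \<in> low (Suc j) \<and> coord x j \<in> I}" by (simp add: slice_def)
  also have "\<dots> \<in> sets borel" by measurable
  finally show ?thesis .
qed

lemma borel_measurable_dist_l1 [measurable (raw)]: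
  fixes f g :: "'c \<Rightarrow> l1"
  assumes [measurable]: "f \<in> borel_measurable N" "g \<in> borel_measurable N"
  shows "(\<lambda>w. dist (f w) (g w)) \<in> borel_measurable N"
proof -
  have "(\<lambda>w. \<Sum>i. \<bar>coord (f w) i - coord (g w) i\<bar>) \<in> borel_measurable N" by measurable
  then show ?thesis by (simp add: dist_norm norm_l1_def)
qed

lemma norm_unit [simp]: "norm (unit_l1 j) = 1"
  using norm_scaleR_unit[of 1 j] by (simp del: norm_scaleR_unit)

lemma dist_above_low:
  assumes "x \<in> low j" "y \<in> low j" "0 \<le> c"
  shows "dist (x + c *\<^sub>R unit_l1 j) y = c + dist x y"
proof -
  have "dist (x + c *\<^sub>R unit_l1 j) y = norm ((x - y) + c *\<^sub>R unit_l1 j)"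
    by (simp add: dist_norm algebra_simps)
  also have "\<dots> = norm (x - y) + norm (c *\<^sub>R unit_l1 j)"
    using assms by (intro norm_add_disjoint_support) (auto simp: low_def)
  finally show ?thesis using assms by (simp add: dist_norm)
qed

lemma dist_add_unit: "dist (x + c *\<^sub>R unit_l1 j) (x + c' *\<^sub>R unit_l1 j) = \<bar>c - c'\<bar>"
proof -
  have "(x + c *\<^sub>R unit_l1 j) - (x + c' *\<^sub>R unit_l1 j) = (c - c') *\<^sub>R unit_l1 j"
    by (simp add: algebra_simps)
  then show ?thesis by (simp only: dist_norm norm_scaleR_unit)
qed

lemma measure_sub_singleton: "S \<subseteq> {0::real} \<Longrightarrow> measure lborel S = 0"
  using subset_singletonD by fastforce

context gluing_points
begin

lemma agg_tree_low: "\<lbrakk>x \<in> agg_tree a u n; n \<ge> 1\<rbrakk> \<Longrightarrow> x \<in> low n"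
  using coord_agg_tree_0 by (auto simp: low_def)

lemma agg_tree_Int_low:
  assumes "x \<in> agg_tree a u n" "n \<ge> 1" "x \<in> low m" "m \<ge> 1"
  shows "x \<in> agg_tree a u m"
  using assms(1-3)
proof (induction rule: agg_tree_induct)
  case (root s)
  then have "s *\<^sub>R unit_l1 0 \<in> agg_tree a u (Suc 0)" by (auto simp: agg_tree_1)
  then show ?case using agg_tree_mono[of "Suc 0" m a u] \<open>m \<ge> 1\<close> by auto
next
  case (branch k s)
  show ?case
  proof (cases "Suc k \<le> m")
    case True
    have "u k + s *\<^sub>R unit_l1 k \<in> agg_tree a u (Suc k)"
      using branch by (auto simp: agg_tree_Suc branch_point_Suc)
    then show ?thesis using agg_tree_mono[OF True] by blast
  next
    case False
    have "coord (u k) k = 0" using agg_tree_low[OF branch(3,1)] by (simp add: low_def)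
    moreover have "coord (u k + s *\<^sub>R unit_l1 k) k = 0" using branch False by (intro lowD[of _ m]) auto
    ultimately have "s = 0" by simp
    then show ?thesis using branch by simp
  qed
qed

lemma on_branch:
  assumes "x \<in> agg_tree a u n" "n \<ge> 1" "x \<in> low (Suc j)" "coord x j > 0" "j \<ge> 1"
  shows "x = u j + coord x j *\<^sub>R unit_l1 j" "coord x j \<le> a (Suc j)"
proof -
  have "x \<in> agg_tree a u (Suc j)" using agg_tree_Int_low assms by simp
  moreover have "x \<notin> agg_tree a u j" using agg_tree_low[of x j] assms(4,5) by (auto simp: low_def)
  ultimately obtain s where "s \<in> {0..a (Suc j)}" "x = u j + s *\<^sub>R unit_l1 j"
    using assms(5) by (auto simp: agg_tree_Suc branch_point_Suc)
  moreover have "coord (u j) j = 0" using agg_tree_low[OF u_in] assms(5) by (simp add: low_def)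
  ultimately show "x = u j + coord x j *\<^sub>R unit_l1 j" "coord x j \<le> a (Suc j)" by auto
qed

lemma on_first_branch:
  assumes "x \<in> agg_tree a u n" "n \<ge> 1" "x \<in> low (Suc 0)"
  shows "x = coord x 0 *\<^sub>R unit_l1 0" "0 \<le> coord x 0" "coord x 0 \<le> a 1"
  using agg_tree_Int_low[OF assms] by (auto simp: agg_tree_1)

lemma last_branch:
  assumes "x \<in> agg_tree a u n" "n \<ge> 1" "x \<notin> low l"
  obtains j where "l \<le> j" "j < n" "x \<in> low (Suc j)" "coord x j > 0"
proof -
  let ?P = "\<lambda>j. coord x j \<noteq> 0"
  obtain j0 where j0: "l \<le> j0" "?P j0" using assms(3) by (auto simp: low_def)
  have bound: "\<forall>j. ?P j \<longrightarrow> j \<le> n"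
    using agg_tree_low[OF assms(1,2)] by (metis lowD nat_le_linear)
  define j where "j = (GREATEST j. ?P j)"
  have "?P j" unfolding j_def using j0(2) bound by (intro GreatestI_nat[of ?P]) auto
  moreover have "i \<le> j" if "?P i" for i
    unfolding j_def using that bound by (intro Greatest_le_nat[of ?P]) auto
  ultimately have "l \<le> j" "j < n" "x \<in> low (Suc j)" "coord x j > 0"
    using j0 agg_tree_low[OF assms(1,2)] nonneg_agg_tree[OF assms(1,2)]
    by (force simp: low_def nonneg_def less_le not_le[symmetric])+
  then show ?thesis using that by blast
qed

lemma coord_branch_point:
  assumes "k \<ge> 1"
  shows "coord (branch_point u k x) (k - 1) = x"
    and "k \<le> i \<Longrightarrow> coord (branch_point u k x) i = 0"
  using assms agg_tree_low[OF u_in, of "k - 1"]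
  by (auto simp: branch_point_def low_def)

lemma tree_length_UNIV: "tree_length a u n UNIV = (\<Sum>k=1..n. a k)"
proof -
  have "measure lborel {x \<in> {0..a k}. branch_point u k x \<in> UNIV} = a k" if "k \<in> {1..n}" for k
  proof -
    have "{x \<in> {0..a k}. branch_point u k x \<in> UNIV} = {0..a k}" by auto
    then show ?thesis using a_pos[of k] that by (simp only: measure_lborel_Icc atLeastAtMost_iff) simp
  qed
  then show ?thesis unfolding tree_length_def by (intro sum.cong) auto
qed

text \<open>A later branch meets \<open>low m\<close> at most in its root, which has length zero.\<close>

lemma tree_length_Int_low:
  assumes "1 \<le> m" "m \<le> n"
  shows "tree_length a u n (B \<inter> low m) = tree_length a u m B"
proof -
  have "measure lborel {x \<in> {0..a k}. branch_point u k x \<in> B \<inter> low m} =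
      (if k \<le> m then measure lborel {x \<in> {0..a k}. branch_point u k x \<in> B} else 0)"
    if "k \<in> {1..n}" for k
  proof (cases "k \<le> m")
    case True
    then have "branch_point u k x \<in> low m" for x
      using that coord_branch_point(2)[of k _ x] by (auto simp: low_def)
    then show ?thesis using True by simp
  next
    case False
    have "x = 0" if "branch_point u k x \<in> low m" for x
      using lowD[OF that, of "k - 1"] coord_branch_point(1)[of k x] False \<open>k \<in> {1..n}\<close> by simp
    then show ?thesis using False by (auto intro!: measure_sub_singleton)
  qed
  then have "tree_length a u n (B \<inter> low m) =
      (\<Sum>k=1..n. if k \<le> m then measure lborel {x \<in> {0..a k}. branch_point u k x \<in> B} else 0)"
    unfolding tree_length_def by (intro sum.cong) auto
  also have "\<dots> = tree_length a u m B"
    unfolding tree_length_def using assms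
    by (intro sum.mono_neutral_cong_right) auto
  finally show ?thesis .
qed

text \<open>The \<open>j\<close>-th coordinate vanishes on the branches before branch \<open>j + 1\<close>, so these stay out of the
  slice if \<open>0 \<notin> I\<close> (and there are none if \<open>j = 0\<close>); later branches meet it at most in their roots.\<close>

lemma tree_length_slice:
  assumes "j < n" "0 \<notin> I \<or> j = 0"
  shows "tree_length a u n (slice j I) = measure lborel ({0..a (Suc j)} \<inter> I)"
proof -
  have "measure lborel {x \<in> {0..a k}. branch_point u k x \<in> slice j I} =
      (if k = Suc j then measure lborel ({0..a (Suc j)} \<inter> I) else 0)"
    if k: "k \<in> {1..n}" for k
  proof -
    consider "k < Suc j" | "k = Suc j" | "Suc j < k" by linarith
    then show ?thesis
    proof cases
      case 1
      then have "coord (branch_point u k x) j = 0" for x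
        using k coord_branch_point(2)[of k j x] by simp
      then show ?thesis using 1 k assms(2) by (auto simp: slice_def)
    next
      case 2
      have "branch_point u k x \<in> slice j I \<longleftrightarrow> x \<in> I" for x
        using coord_branch_point(1)[of k x] coord_branch_point(2)[of k _ x] k 2
        by (auto simp: slice_def low_def)
      then have "{x \<in> {0..a k}. branch_point u k x \<in> slice j I} = {0..a (Suc j)} \<inter> I"
        using 2 by auto
      then show ?thesis using 2 by simp
    next
      case 3
      have "x = 0" if "branch_point u k x \<in> slice j I" for x
        using that coord_branch_point(1)[of k x] 3 k lowD[of "branch_point u k x" "Suc j" "k - 1"]
        by (simp add: slice_def)
      then show ?thesis using 3 by (auto intro!: measure_sub_singleton)
    qed
  qed
  then have "tree_length a u n (slice j I) =
      (\<Sum>k=1..n. if k = Suc j then measure lborel ({0..a (Suc j)} \<inter> I) else 0)"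
    unfolding tree_length_def by (intro sum.cong) auto
  then show ?thesis using assms(1) by simp
qed

end

section \<open>Conditional law of a gluing point\<close>

locale uniform_aggregation = prob_space M for M :: "'w measure" +
  fixes a :: "nat \<Rightarrow> real" and U :: "nat \<Rightarrow> 'w \<Rightarrow> l1"
  assumes a_pos: "\<And>i. i \<ge> 1 \<Longrightarrow> a i > 0"
    and gluing: "uniform_gluing M a U"
begin

definition A :: "nat \<Rightarrow> real" where "A n = (\<Sum>k=1..n. a k)"

lemma A_Suc: "A (Suc n) = A n + a (Suc n)"
  by (simp add: A_def)

lemma A_mono: "m \<le> n \<Longrightarrow> A m \<le> A n"
  unfolding A_def using a_pos by (intro sum_mono2) (auto intro: less_imp_le)

lemma A_pos: "n \<ge> 1 \<Longrightarrow> 0 < A n"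
  unfolding A_def using a_pos by (intro sum_pos) auto

lemma measurable_U [measurable (raw)]: "n \<ge> 1 \<Longrightarrow> U n \<in> borel_measurable M"
  using gluing by (simp add: uniform_gluing_def)

lemma AE_gluing_points: "AE w in M. gluing_points a (\<lambda>k. U k w)"
proof -
  have "AE w in M. \<forall>n. n \<ge> 1 \<longrightarrow> U n w \<in> agg_tree a (\<lambda>k. U k w) n"
    using gluing by (auto simp: AE_all_countable uniform_gluing_def)
  then show ?thesis by eventually_elim (unfold_locales, use a_pos in auto)
qed

lemma prob_mono_gluing:
  assumes "\<And>w. \<lbrakk>w \<in> E; gluing_points a (\<lambda>k. U k w)\<rbrakk> \<Longrightarrow> w \<in> F" and "F \<in> sets M"
  shows "prob E \<le> prob F"
proof (rule finite_measure_mono_AE[OF _ assms(2)])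
  show "AE w in M. w \<in> E \<longrightarrow> w \<in> F"
    using AE_gluing_points by eventually_elim (blast intro: assms(1))
qed

abbreviation hist :: "nat \<Rightarrow> 'w measure" where "hist n \<equiv> past M U n"

lemma space_hist [simp]: "space (hist n) = space M"
  unfolding past_def by (intro space_measure_of) auto

lemma sets_hist: "sets (hist n) = sigma_sets (space M)
    (\<Union>k\<in>{1..<n}. {U k -` B \<inter> space M | B. B \<in> sets borel})"
  unfolding past_def by (intro sets_measure_of) auto

lemma measurable_U_hist: "\<lbrakk>1 \<le> k; k < n\<rbrakk> \<Longrightarrow> U k \<in> borel_measurable (hist n)"
  by (intro measurableI) (auto simp: sets_hist intro!: sigma_sets.Basic bexI[of _ k] exI)

lemma subalgebra_hist: "subalgebra M (hist n)"
proof -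
  have "U k -` B \<inter> space M \<in> sets M" if "k \<ge> 1" "B \<in> sets borel" for k B
    using that by measurable
  then have "sets (hist n) \<subseteq> sets M"
    unfolding sets_hist by (intro sets.sigma_sets_subset) auto
  then show ?thesis by (simp add: subalgebra_def)
qed

lemma hist_mono: "m \<le> n \<Longrightarrow> sets (hist m) \<subseteq> sets (hist n)"
  unfolding sets_hist by (intro sigma_sets_mono' UN_mono) auto

lemma borel_measurable_hist_mono:
  "\<lbrakk>f \<in> borel_measurable (hist m); m \<le> n\<rbrakk> \<Longrightarrow> f \<in> borel_measurable (hist n)"
  using hist_mono[of m n] by (auto simp: measurable_def)

lemma hist_sets_M: "E \<in> sets (hist n) \<Longrightarrow> E \<in> sets M"
  using subalgebra_hist by (auto simp: subalgebra_def)

lemma borel_measurable_hist_M: "f \<in> borel_measurable (hist n) \<Longrightarrow> f \<in> borel_measurable M"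
  by (rule measurable_from_subalg[OF subalgebra_hist])

text \<open>The random length \<open>tree_length\<close> of \<open>B\<close> in the \<open>n\<close>-th tree (\<open>AE_mass\<close>), in a version that is
  measurable with respect to the past, as conditioning requires.\<close>

definition mass :: "nat \<Rightarrow> l1 set \<Rightarrow> 'w \<Rightarrow> real" where
  "mass n B w = A n * real_cond_exp M (hist n) (indicator (U n -` B \<inter> space M)) w"

lemma measurable_mass: "mass n B \<in> borel_measurable (hist n)"
  unfolding mass_def by measurable

lemma AE_mass:
  assumes "n \<ge> 1" "B \<in> sets borel"
  shows "AE w in M. mass n B w = tree_length a (\<lambda>k. U k w) n B"
proof -
  have "AE w in M. real_cond_exp M (hist n) (indicator (U n -` B \<inter> space M)) w =
      tree_length a (\<lambda>k. U k w) n B / tree_length a (\<lambda>k. U k w) n UNIV"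
    using gluing assms by (simp add: uniform_gluing_def)
  with AE_gluing_points show ?thesis
  proof eventually_elim
    case (elim w)
    then show ?case
      using A_pos[OF assms(1)] by (simp add: mass_def gluing_points.tree_length_UNIV A_def)
  qed
qed

lemma integral_mass:
  assumes n: "n \<ge> 1" and B [measurable]: "B \<in> sets borel"
    and f: "f \<in> borel_measurable (hist n)"
    and int: "integrable M f"
  shows "(\<integral>w. f w * mass n B w \<partial>M) = A n * (\<integral>w. f w * indicator (U n -` B \<inter> space M) w \<partial>M)"
proof -
  interpret sub: finite_measure_subalgebra M "hist n"
    by unfold_locales (rule subalgebra_hist)
  have [measurable]: "U n -` B \<inter> space M \<in> sets M" using n by measurable
  have "(\<integral>w. f w * real_cond_exp M (hist n) (indicator (U n -` B \<inter> space M)) w \<partial>M) =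
      (\<integral>w. f w * indicator (U n -` B \<inter> space M) w \<partial>M)"
    using f int by (intro sub.real_cond_exp_intg(2)) (auto intro: integrable_real_mult_indicator)
  then show ?thesis by (simp only: mass_def mult.left_commute[of _ "A n"] integral_mult_right_zero)
qed

text \<open>The conditional law of the pair (branch, position on the branch) of \<open>U n\<close> is deterministic, so this
  pair is independent of the past. Both bounds on the dimension rest on this fact.\<close>

lemma prob_slice:
  assumes "j < n" "0 \<notin> I \<or> j = 0" and [measurable]: "I \<in> sets borel" and E: "E \<in> sets (hist n)"
  shows "prob (E \<inter> {w \<in> space M. U n w \<in> slice j I}) =
    measure lborel ({0..a (Suc j)} \<inter> I) / A n * prob E"
proof -
  have n: "n \<ge> 1" using assms(1) by simp
  have [measurable]: "E \<in> sets M" using hist_sets_M E .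
  have Un [measurable]: "U n \<in> borel_measurable M" using n by measurable
  let ?F = "U n -` slice j I \<inter> space M"
  let ?c = "measure lborel ({0..a (Suc j)} \<inter> I)"
  have [measurable]: "?F \<in> sets M" by measurable
  have "A n * prob (E \<inter> ?F) = A n * (\<integral>w. indicator E w * indicator ?F w \<partial>M)"
    by (simp add: indicator_inter_arith[symmetric] Int_absorb1 sets.sets_into_space)
  also have "\<dots> = (\<integral>w. indicator E w * mass n (slice j I) w \<partial>M)"
    using n E \<open>E \<in> sets M\<close>
    by (intro integral_mass[symmetric]) (auto intro!: integrable_real_indicator simp: less_top[symmetric])
  also have "\<dots> = (\<integral>w. indicator E w * ?c \<partial>M)"
  proof (rule integral_cong_AE)
    show "AE w in M. indicator E w * mass n (slice j I) w = indicator E w * ?c"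
      using AE_mass[OF n slice_sets[OF assms(3)], of j] AE_gluing_points
    proof eventually_elim
      case (elim w)
      then show ?case using gluing_points.tree_length_slice[OF elim(2) assms(1,2)] by simp
    qed
  qed (use borel_measurable_hist_M[OF measurable_mass[of n]] in measurable)
  also have "\<dots> = ?c * prob E" by (simp add: Int_absorb1 sets.sets_into_space)
  finally have "prob (E \<inter> ?F) = ?c / A n * prob E" using A_pos[OF n] by (simp add: field_simps)
  moreover have "?F = {w \<in> space M. U n w \<in> slice j I}" by auto
  ultimately show ?thesis by simp
qed

end

section \<open>Exchangeability of pairs of gluing points\<close>

lemma near_sets [measurable]: "{(x, y). dist x y \<le> r} \<in> sets (borel \<Otimes>\<^sub>M (borel :: l1 measure))"
proof -
  have "{p \<in> space (borel \<Otimes>\<^sub>M (borel :: l1 measure)). dist (fst p) (snd p) \<le> r}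
      \<in> sets (borel \<Otimes>\<^sub>M (borel :: l1 measure))" by measurable
  moreover have "{p \<in> space (borel \<Otimes>\<^sub>M (borel :: l1 measure)). dist (fst p) (snd p) \<le> r} =
      {(x, y). dist x y \<le> r}" by (auto simp: space_pair_measure)
  ultimately show ?thesis by simp
qed

lemma measure_lborel_le_Icc:
  assumes "I \<subseteq> {x..y}" "I \<in> sets borel" "x \<le> y"
  shows "measure lborel I \<le> y - x"
proof -
  have "measure lborel I \<le> measure lborel {x..y}"
    using assms by (intro measure_mono_fmeasurable) (auto simp: fmeasurable_def)
  then show ?thesis using assms by simp
qed

text \<open>A Dynkin argument for joint laws restricted to events \<open>E\<close>, \<open>E'\<close>. The factors \<open>c\<close>, \<open>c'\<close> allow the
  two sides to be normalized differently.\<close>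

lemma (in prob_space) pair_law_eqI:
  fixes X Y X' Y' :: "'a \<Rightarrow> l1"
  assumes [measurable]: "X \<in> borel_measurable M" "Y \<in> borel_measurable M"
      "X' \<in> borel_measurable M" "Y' \<in> borel_measurable M" "E \<in> sets M" "E' \<in> sets M"
    and rect: "\<And>B1 B2. \<lbrakk>B1 \<in> sets borel; B2 \<in> sets borel\<rbrakk> \<Longrightarrow>
      c * prob (E \<inter> {w \<in> space M. (X w, Y w) \<in> B1 \<times> B2}) =
      c' * prob (E' \<inter> {w \<in> space M. (X' w, Y' w) \<in> B1 \<times> B2})"
    and G: "G \<in> sets (borel \<Otimes>\<^sub>M borel)"
  shows "c * prob (E \<inter> {w \<in> space M. (X w, Y w) \<in> G}) =
    c' * prob (E' \<inter> {w \<in> space M. (X' w, Y' w) \<in> G})"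
proof -
  let ?R = "{A \<times> B | A B. A \<in> sets (borel :: l1 measure) \<and> B \<in> sets (borel :: l1 measure)}"
  have sets_R: "sigma_sets UNIV ?R = sets (borel \<Otimes>\<^sub>M borel)"
    by (simp add: sets_pair_measure)
  have "Int_stable ?R" by (rule Int_stable_pair_measure_generator)
  moreover have "?R \<subseteq> Pow UNIV" by simp
  moreover have "G \<in> sigma_sets UNIV ?R" using G sets_R by simp
  ultimately show ?thesis
  proof (induction rule: sigma_sets_induct_disjoint[of ?R UNIV])
    case (basic G)
    then show ?case using rect by auto
  next
    case (compl G)
    then have [measurable]: "G \<in> sets (borel \<Otimes>\<^sub>M borel)" using sets_R by simp
    have *: "prob (D \<inter> {w \<in> space M. (V w, W w) \<notin> G}) =
        prob D - prob (D \<inter> {w \<in> space M. (V w, W w) \<in> G})"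
      if [measurable]: "D \<in> sets M" "V \<in> borel_measurable M" "W \<in> borel_measurable M" for D V W
    proof -
      have "D \<inter> {w \<in> space M. (V w, W w) \<notin> G} = D - (D \<inter> {w \<in> space M. (V w, W w) \<in> G})"
        using sets.sets_into_space[OF that(1)] by auto
      then show ?thesis by (simp add: finite_measure_Diff)
    qed
    have "c * prob E = c' * prob E'"
      using rect[of UNIV UNIV] sets.sets_into_space[of E M] sets.sets_into_space[of E' M]
      by (simp add: Int_absorb1)
    then show ?case using compl by (simp add: * right_diff_distrib)
  next
    case (union G)
    have [measurable]: "G i \<in> sets (borel \<Otimes>\<^sub>M borel)" for i using union(2) sets_R by auto
    have *: "(\<lambda>i. prob (D \<inter> {w \<in> space M. (V w, W w) \<in> G i})) sums
        prob (D \<inter> {w \<in> space M. (V w, W w) \<in> (\<Union>i. G i)})"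
      if [measurable]: "D \<in> sets M" "V \<in> borel_measurable M" "W \<in> borel_measurable M" for D V W
    proof -
      have "(\<lambda>i. prob (D \<inter> {w \<in> space M. (V w, W w) \<in> G i})) sums
          prob (\<Union>i. D \<inter> {w \<in> space M. (V w, W w) \<in> G i})"
        using union(1) by (intro finite_measure_UNION) (auto simp: disjoint_family_on_def)
      moreover have "(\<Union>i. D \<inter> {w \<in> space M. (V w, W w) \<in> G i}) =
          D \<inter> {w \<in> space M. (V w, W w) \<in> (\<Union>i. G i)}" by auto
      ultimately show ?thesis by simp
    qed
    have "(\<lambda>i. c * prob (E \<inter> {w \<in> space M. (X w, Y w) \<in> G i})) sums
        (c * prob (E \<inter> {w \<in> space M. (X w, Y w) \<in> (\<Union>i. G i)}))"
      by (intro sums_mult *) auto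
    moreover have "(\<lambda>i. c' * prob (E' \<inter> {w \<in> space M. (X' w, Y' w) \<in> G i})) sums
        (c' * prob (E' \<inter> {w \<in> space M. (X' w, Y' w) \<in> (\<Union>i. G i)}))"
      by (intro sums_mult *) auto
    ultimately show ?case using union(3) by (simp only: sums_unique2)
  qed simp
qed

context uniform_aggregation
begin

lemma integrable_mass:
  assumes "n \<ge> 1" and [measurable]: "B \<in> sets borel"
  shows "integrable M (mass n B)"
proof -
  interpret sub: finite_measure_subalgebra M "hist n"
    by unfold_locales (rule subalgebra_hist)
  have "U n -` B \<inter> space M \<in> sets M" using assms(1) by measurable
  then show ?thesis
    unfolding mass_def
    by (intro integrable_mult_right sub.real_cond_exp_int(1) integrable_real_indicator)
      (auto simp: less_top[symmetric])
qed

lemma AE_mass_Int_low: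
  assumes "1 \<le> m" "m \<le> n" "B \<in> sets borel"
  shows "AE w in M. mass n (B \<inter> low m) w = mass m B w"
proof -
  have "B \<inter> low m \<in> sets borel" using assms(3) by measurable
  with AE_mass[of n "B \<inter> low m"] assms
  have "AE w in M. mass n (B \<inter> low m) w = tree_length a (\<lambda>k. U k w) n (B \<inter> low m)" by simp
  then show ?thesis
    using AE_mass[OF assms(1,3)] AE_gluing_points
  proof eventually_elim
    case (elim w)
    then show ?case using gluing_points.tree_length_Int_low[OF elim(3) assms(1,2)] by simp
  qed
qed

text \<open>Given that it falls in \<open>T\<^sub>m\<close>, each later gluing point is a uniform point of \<open>T\<^sub>m\<close>, and two of them are
  conditionally independent. On rectangles the right-hand side is symmetric and involves neither \<open>k\<close> nor \<open>l\<close>, which is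
  the source of \<open>exchange\<close>.\<close>

lemma prob_rectangle:
  assumes m: "1 \<le> m" "m \<le> l" "l < k" and B [measurable]: "B1 \<in> sets borel" "B2 \<in> sets borel"
  shows "A k * A l * prob {w \<in> space M. U k w \<in> B1 \<inter> low m \<and> U l w \<in> B2 \<inter> low m} =
    (\<integral>w. mass m B1 w * mass m B2 w \<partial>M)"
proof -
  have [measurable]: "U k \<in> borel_measurable M" "U l \<in> borel_measurable M" using m by simp_all
  let ?F = "U l -` (B2 \<inter> low m) \<inter> space M" and ?H = "U k -` (B1 \<inter> low m) \<inter> space M"
  have F: "?F \<in> sets (hist k)"
    using measurable_sets[OF measurable_U_hist[of l k], of "B2 \<inter> low m"] m by simp
  have [measurable]: "?F \<in> sets M" "?H \<in> sets M" by measurable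
  have [measurable]: "mass i B \<in> borel_measurable M" for i B
    by (rule borel_measurable_hist_M[OF measurable_mass])
  have B1m: "B1 \<inter> low m \<in> sets borel" and B2m: "B2 \<inter> low m \<in> sets borel" by measurable
  have "{w \<in> space M. U k w \<in> B1 \<inter> low m \<and> U l w \<in> B2 \<inter> low m} = ?F \<inter> ?H" by auto
  then have "A k * prob {w \<in> space M. U k w \<in> B1 \<inter> low m \<and> U l w \<in> B2 \<inter> low m} =
      A k * (\<integral>w. indicator ?F w * indicator ?H w \<partial>M)"
    by (simp add: indicator_inter_arith[symmetric] Int_absorb1 sets.sets_into_space)
  also have "\<dots> = (\<integral>w. indicator ?F w * mass k (B1 \<inter> low m) w \<partial>M)"
    using m F B1m
    by (intro integral_mass[symmetric]) (auto intro!: integrable_real_indicator simp: less_top[symmetric])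
  also have "\<dots> = (\<integral>w. mass m B1 w * indicator ?F w \<partial>M)"
  proof (rule integral_cong_AE)
    show "AE w in M. indicator ?F w * mass k (B1 \<inter> low m) w = mass m B1 w * indicator ?F w"
      using AE_mass_Int_low[of m k B1] m B by auto
  qed measurable
  finally have "A k * A l * prob {w \<in> space M. U k w \<in> B1 \<inter> low m \<and> U l w \<in> B2 \<inter> low m} =
      A l * (\<integral>w. mass m B1 w * indicator ?F w \<partial>M)" by simp
  also have "\<dots> = (\<integral>w. mass m B1 w * mass l (B2 \<inter> low m) w \<partial>M)"
    using m B2m borel_measurable_hist_mono[OF measurable_mass[of m B1], of l] integrable_mass[of m B1] B
    by (intro integral_mass[symmetric]) auto
  also have "\<dots> = (\<integral>w. mass m B1 w * mass m B2 w \<partial>M)"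
  proof (rule integral_cong_AE)
    show "AE w in M. mass m B1 w * mass l (B2 \<inter> low m) w = mass m B1 w * mass m B2 w"
      using AE_mass_Int_low[of m l B2] m B by auto
  qed measurable
  finally show ?thesis .
qed

lemma exchange:
  assumes m: "1 \<le> m" and kl: "m \<le> l" "l < k" "m \<le> l'" "l' < k'"
    and G: "G \<in> sets (borel \<Otimes>\<^sub>M borel)"
  shows "A k * A l * prob {w \<in> space M. U k w \<in> low m \<and> U l w \<in> low m \<and> (U k w, U l w) \<in> G} =
      A k' * A l' * prob {w \<in> space M. U k' w \<in> low m \<and> U l' w \<in> low m \<and> (U k' w, U l' w) \<in> G}"
      (is "?c * prob ?P = ?c' * prob ?P'")
    and "A k * A l * prob {w \<in> space M. U k w \<in> low m \<and> U l w \<in> low m \<and> (U k w, U l w) \<in> G} =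
      A k' * A l' * prob {w \<in> space M. U k' w \<in> low m \<and> U l' w \<in> low m \<and> (U l' w, U k' w) \<in> G}"
      (is "_ = _ * prob ?Q'")
proof -
  have [measurable]: "U k \<in> borel_measurable M" "U l \<in> borel_measurable M"
    "U k' \<in> borel_measurable M" "U l' \<in> borel_measurable M" using m kl by simp_all
  let ?E = "{w \<in> space M. U k w \<in> low m \<and> U l w \<in> low m}"
  let ?E' = "{w \<in> space M. U k' w \<in> low m \<and> U l' w \<in> low m}"
  have E: "?E \<in> sets M" "?E' \<in> sets M" by measurable
  have 1: "?c * prob (?E \<inter> {w \<in> space M. (U k w, U l w) \<in> B1 \<times> B2}) =
      (\<integral>w. mass m B1 w * mass m B2 w \<partial>M)"
    if "B1 \<in> sets borel" "B2 \<in> sets borel" for B1 B2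
  proof -
    have "?E \<inter> {w \<in> space M. (U k w, U l w) \<in> B1 \<times> B2} =
        {w \<in> space M. U k w \<in> B1 \<inter> low m \<and> U l w \<in> B2 \<inter> low m}" by auto
    then show ?thesis using prob_rectangle[OF m kl(1,2) that] by simp
  qed
  have 2: "?c' * prob (?E' \<inter> {w \<in> space M. (U k' w, U l' w) \<in> B1 \<times> B2}) =
      (\<integral>w. mass m B1 w * mass m B2 w \<partial>M)"
    if "B1 \<in> sets borel" "B2 \<in> sets borel" for B1 B2
  proof -
    have "?E' \<inter> {w \<in> space M. (U k' w, U l' w) \<in> B1 \<times> B2} =
        {w \<in> space M. U k' w \<in> B1 \<inter> low m \<and> U l' w \<in> B2 \<inter> low m}" by auto
    then show ?thesis using prob_rectangle[OF m kl(3,4) that] by simp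
  qed
  have 3: "?c' * prob (?E' \<inter> {w \<in> space M. (U l' w, U k' w) \<in> B1 \<times> B2}) =
      (\<integral>w. mass m B1 w * mass m B2 w \<partial>M)"
    if "B1 \<in> sets borel" "B2 \<in> sets borel" for B1 B2
  proof -
    have "?E' \<inter> {w \<in> space M. (U l' w, U k' w) \<in> B1 \<times> B2} =
        {w \<in> space M. U k' w \<in> B2 \<inter> low m \<and> U l' w \<in> B1 \<inter> low m}" by auto
    then show ?thesis using prob_rectangle[OF m kl(3,4) that(2,1)] by (simp add: mult.commute)
  qed
  have "?c * prob (?E \<inter> {w \<in> space M. (U k w, U l w) \<in> G}) =
      ?c' * prob (?E' \<inter> {w \<in> space M. (U k' w, U l' w) \<in> G})"
    by (rule pair_law_eqI[OF _ _ _ _ E _ G]) (measurable, simp only: 1 2)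
  moreover have "?c * prob (?E \<inter> {w \<in> space M. (U k w, U l w) \<in> G}) =
      ?c' * prob (?E' \<inter> {w \<in> space M. (U l' w, U k' w) \<in> G})"
    by (rule pair_law_eqI[OF _ _ _ _ E _ G]) (measurable, simp only: 1 3)
  moreover have "?E \<inter> {w \<in> space M. (U k w, U l w) \<in> G} = ?P"
    "?E' \<inter> {w \<in> space M. (U k' w, U l' w) \<in> G} = ?P'"
    "?E' \<inter> {w \<in> space M. (U l' w, U k' w) \<in> G} = ?Q'" by auto
  ultimately show "?c * prob ?P = ?c' * prob ?P'" "?c * prob ?P = ?c' * prob ?Q'" by simp_all
qed

section \<open>Distance between two gluing points\<close>

text \<open>This is \<open>A\<^sub>m\<^sup>2\<close> times the probability that two conditionally independent uniform points of \<open>T\<^sub>m\<close> are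
  within \<open>r\<close>. The pair is realized by \<open>U (m + 1)\<close> and \<open>U m\<close>, the former conditioned to fall in \<open>T\<^sub>m\<close>;
  the factor \<open>A (m + 1) / A m\<close> compensates for the conditioning.\<close>

definition close_weight :: "real \<Rightarrow> nat \<Rightarrow> real" where
  "close_weight r m = A (Suc m) * A m *
     prob {w \<in> space M. U (Suc m) w \<in> low m \<and> U m w \<in> low m \<and> dist (U (Suc m) w) (U m w) \<le> r}"

lemma close_weight_eq:
  assumes "1 \<le> m" "m \<le> l" "l < k"
  shows "close_weight r m = A k * A l *
    prob {w \<in> space M. U k w \<in> low m \<and> U l w \<in> low m \<and> dist (U k w) (U l w) \<le> r}"
  using exchange(1)[OF assms(1) order_refl lessI assms(2,3) near_sets[of r]]
  by (simp only: close_weight_def mem_Collect_eq case_prod_conv)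

lemma AE_U_low: "n \<ge> 1 \<Longrightarrow> AE w in M. U n w \<in> low n"
  using AE_gluing_points
  by eventually_elim (rule gluing_points.agg_tree_low[OF _ gluing_points.u_in])

text \<open>A point on branch \<open>m + 1\<close> at height \<open>c\<close> above the gluing point \<open>U m\<close> is at distance
  \<open>c + dist (U m) y\<close> from every \<open>y\<close> in \<open>T\<^sub>m\<close>. So both summands must be at most \<open>r\<close>, and these two
  conditions are independent.\<close>

lemma prob_grafted_close:
  assumes "1 \<le> m" "m < k" "1 \<le> l" "l < k" "0 \<le> r"
  shows "prob {w \<in> space M. U k w \<in> slice m {0<..} \<and> U l w \<in> low m \<and> dist (U k w) (U l w) \<le> r} \<le>
    min (a (Suc m)) r / A k * prob {w \<in> space M. U l w \<in> low m \<and> dist (U m w) (U l w) \<le> r}"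
proof -
  have [measurable]: "U k \<in> borel_measurable M" "U l \<in> borel_measurable M" "U m \<in> borel_measurable M"
    using assms by simp_all
  have [measurable]: "U l \<in> borel_measurable (hist k)" "U m \<in> borel_measurable (hist k)"
    using assms by (auto intro: measurable_U_hist)
  have [measurable]: "slice m {0<..r} \<in> sets borel" by (intro slice_sets) simp
  let ?E = "{w \<in> space M. U l w \<in> low m \<and> dist (U m w) (U l w) \<le> r}"
  have "{w \<in> space (hist k). U l w \<in> low m \<and> dist (U m w) (U l w) \<le> r} \<in> sets (hist k)"
    by measurable
  then have E: "?E \<in> sets (hist k)" by simp
  have "prob {w \<in> space M. U k w \<in> slice m {0<..} \<and> U l w \<in> low m \<and> dist (U k w) (U l w) \<le> r} \<le>
      prob (?E \<inter> {w \<in> space M. U k w \<in> slice m {0<..r}})"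
  proof (rule prob_mono_gluing, safe)
    fix w assume hw: "U k w \<in> slice m {0<..}" "U l w \<in> low m" "dist (U k w) (U l w) \<le> r"
      and "gluing_points a (\<lambda>k. U k w)"
    then interpret gluing_points a "\<lambda>k. U k w" by simp
    define c where "c = coord (U k w) m"
    have c: "0 < c" using hw(1) by (simp add: slice_def c_def)
    have "U k w = U m w + c *\<^sub>R unit_l1 m"
      using on_branch(1)[OF u_in, of k m] assms hw(1) by (simp add: slice_def c_def)
    then have "dist (U k w) (U l w) = c + dist (U m w) (U l w)"
      using dist_above_low[of "U m w" m "U l w" c] agg_tree_low[OF u_in] assms(1) hw(2) c by simp
    then show "dist (U m w) (U l w) \<le> r" "U k w \<in> slice m {0<..r}"
      using hw c zero_le_dist[of "U m w" "U l w"] unfolding slice_def c_def by (simp_all; linarith)+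
  qed (intro sets.Int hist_sets_M[OF E], measurable)
  also have "\<dots> = measure lborel ({0..a (Suc m)} \<inter> {0<..r}) / A k * prob ?E"
    using assms E by (intro prob_slice) auto
  also have "{0..a (Suc m)} \<inter> {0<..r} = {0<..min (a (Suc m)) r}" by auto
  finally show ?thesis using assms(5) a_pos[of "Suc m"] by simp
qed

text \<open>On a common branch the distance is the difference of two positions. Their joint law is only known on
  rectangles \<open>E \<inter> {U k \<in> B}\<close> with \<open>E\<close> in the past, so the position of \<open>U l\<close> is localized on a
  grid of mesh \<open>r\<close>, which leaves an interval of length \<open>3 r\<close> for that of \<open>U k\<close>.\<close>

lemma prob_same_branch_close:
  assumes "j < l" "l < k" "0 < r" and I: "I = {0..} \<and> j = 0 \<or> I = {0<..}"
  shows "prob {w \<in> space M. U k w \<in> slice j I \<and> U l w \<in> slice j I \<and> dist (U k w) (U l w) \<le> r} \<le>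
    3 * r * a (Suc j) / (A k * A l)"
proof -
  have [measurable]: "U k \<in> borel_measurable M" "U l \<in> borel_measurable M"
    using assms by simp_all
  have [measurable]: "U l \<in> borel_measurable (hist k)"
    using assms by (auto intro: measurable_U_hist)
  have I_sets [measurable]: "I \<in> sets borel" using I by auto
  have I0: "0 \<notin> I \<or> j = 0" using I by auto
  have aj: "0 < a (Suc j)" using a_pos by simp
  define N where "N = Suc (nat \<lfloor>a (Suc j) / r\<rfloor>)"
  define J where "J = (\<lambda>g::nat. I \<inter> {real g * r..<(real g + 1) * r})"
  define J' where "J' = (\<lambda>g::nat. I \<inter> {(real g - 1) * r..(real g + 2) * r})"
  have [measurable]: "J g \<in> sets borel" "J' g \<in> sets borel" for g
    unfolding J_def J'_def by measurable
  have [measurable]: "slice j I \<in> sets borel" "slice j (J' g) \<in> sets borel" for g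
    by (intro slice_sets; measurable)+
  let ?E = "\<lambda>g. {w \<in> space M. U l w \<in> slice j (J g)}"
  have E: "?E g \<in> sets (hist k)" for g
  proof -
    have "U l -` slice j (J g) \<inter> space (hist k) \<in> sets (hist k)"
      by (intro measurable_sets[of _ _ borel] slice_sets) measurable
    then show ?thesis by (simp add: vimage_def Int_def conj_commute)
  qed
  have EM [measurable]: "?E g \<in> sets M" for g using hist_sets_M[OF E] .
  let ?D = "{w \<in> space M. U k w \<in> slice j I \<and> U l w \<in> slice j I \<and> dist (U k w) (U l w) \<le> r}"
  have "prob ?D \<le> prob (\<Union>g<N. ?E g \<inter> {w \<in> space M. U k w \<in> slice j (J' g)})"
  proof (rule prob_mono_gluing)
    fix w assume hw: "w \<in> ?D" and "gluing_points a (\<lambda>k. U k w)"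
    then interpret gluing_points a "\<lambda>k. U k w" by simp
    define x0 where "x0 = (if j = 0 then 0 else U j w)"
    have *: "U i w = x0 + coord (U i w) j *\<^sub>R unit_l1 j \<and> 0 \<le> coord (U i w) j \<and> coord (U i w) j \<le> a (Suc j)"
      if "i \<ge> 1" "U i w \<in> slice j I" for i
    proof (cases "j = 0")
      case True
      then show ?thesis
        using on_first_branch[OF u_in] that by (auto simp: slice_def x0_def)
    next
      case False
      then have "I = {0<..}" using I by auto
      then show ?thesis
        using on_branch[OF u_in, of i j] False that by (auto simp: slice_def x0_def)
    qed
    define c c' where "c = coord (U k w) j" and "c' = coord (U l w) j"
    have x0: "U k w = x0 + c *\<^sub>R unit_l1 j" "U l w = x0 + c' *\<^sub>R unit_l1 j"
      and c': "0 \<le> c'" "c' \<le> a (Suc j)"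
      using *[of k] *[of l] hw assms unfolding c_def c'_def by simp_all
    have cc: "\<bar>c - c'\<bar> \<le> r" using hw dist_add_unit[of x0 c j c'] x0 by simp
    define g where "g = nat \<lfloor>c' / r\<rfloor>"
    have "real g = of_int \<lfloor>c' / r\<rfloor>" using c' assms(3) by (simp add: g_def)
    then have "real g \<le> c' / r" "c' / r < real g + 1" by linarith+
    then have g: "real g * r \<le> c'" "c' < (real g + 1) * r"
      using assms(3) by (simp_all add: pos_le_divide_eq pos_divide_less_eq)
    have "g < N" unfolding g_def N_def
      using c' assms(3) by (auto intro!: nat_mono floor_mono divide_right_mono simp: less_Suc_eq_le)
    moreover have "U l w \<in> slice j (J g)"
      using hw g by (auto simp: slice_def J_def c'_def)
    moreover have "U k w \<in> slice j (J' g)"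
    proof -
      have "c \<in> {(real g - 1) * r..(real g + 2) * r}" using g cc by (auto simp: algebra_simps)
      then show ?thesis using hw by (auto simp: slice_def J'_def c_def)
    qed
    ultimately show "w \<in> (\<Union>g<N. ?E g \<inter> {w \<in> space M. U k w \<in> slice j (J' g)})" using hw by auto
  qed (intro sets.finite_UN sets.Int EM, simp, measurable)
  also have "\<dots> \<le> (\<Sum>g<N. prob (?E g \<inter> {w \<in> space M. U k w \<in> slice j (J' g)}))"
    by (intro finite_measure_subadditive_finite image_subsetI sets.Int EM) measurable
  also have "\<dots> \<le> (\<Sum>g<N. 3 * r / A k * prob (?E g))"
  proof (rule sum_mono)
    fix g
    have "prob (?E g \<inter> {w \<in> space M. U k w \<in> slice j (J' g)}) =
        measure lborel ({0..a (Suc j)} \<inter> J' g) / A k * prob (?E g)"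
      using assms E I0 by (intro prob_slice) (auto simp: J'_def)
    also have "measure lborel ({0..a (Suc j)} \<inter> J' g) \<le> (real g + 2) * r - (real g - 1) * r"
      using assms(3) by (intro measure_lborel_le_Icc) (auto simp: J'_def)
    also have "\<dots> = 3 * r" by (simp add: algebra_simps)
    finally show "prob (?E g \<inter> {w \<in> space M. U k w \<in> slice j (J' g)}) \<le> 3 * r / A k * prob (?E g)"
      using A_pos[of k] assms by (simp add: divide_right_mono mult_right_mono)
  qed
  also have "\<dots> = 3 * r / A k * (\<Sum>g<N. prob (?E g))" by (simp add: sum_distrib_left)
  also have "(\<Sum>g<N. prob (?E g)) = prob (\<Union>g<N. ?E g)"
  proof (rule finite_measure_finite_Union[symmetric])
    have "g = g'" if "x \<in> J g" "x \<in> J g'" for x g g'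
    proof -
      have "real g * r < (real g' + 1) * r" "real g' * r < (real g + 1) * r"
        using that by (auto simp: J_def intro: le_less_trans)
      then show ?thesis using assms(3) by simp
    qed
    then show "disjoint_family_on ?E {..<N}"
      by (auto simp: disjoint_family_on_def slice_def)
  qed (simp_all only: finite_lessThan image_subset_iff EM, simp)
  also have "\<dots> \<le> prob (space M \<inter> {w \<in> space M. U l w \<in> slice j I})"
  proof (rule finite_measure_mono)
    show "(\<Union>g<N. ?E g) \<subseteq> space M \<inter> {w \<in> space M. U l w \<in> slice j I}"
      by (auto simp: slice_def J_def)
  qed measurable
  also have "\<dots> = measure lborel ({0..a (Suc j)} \<inter> I) / A l * prob (space M)"
    using assms I0 sets.top[of "hist l"] by (intro prob_slice) auto
  also have "\<dots> = measure lborel ({0..a (Suc j)} \<inter> I) / A l" by (simp add: prob_space)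
  finally have "(\<And>x y::real. x \<le> y \<Longrightarrow> 3 * r / A k * x \<le> 3 * r / A k * y) \<Longrightarrow>
      prob ?D \<le>
      3 * r / A k * (measure lborel ({0..a (Suc j)} \<inter> I) / A l)" .
  moreover have mono: "3 * r / A k * x \<le> 3 * r / A k * y" if "x \<le> y" for x y
    using A_pos[of k] assms that by (intro mult_left_mono) auto
  ultimately have "prob ?D \<le> 3 * r / A k * (measure lborel ({0..a (Suc j)} \<inter> I) / A l)"
    by blast
  also have "\<dots> \<le> 3 * r / A k * (a (Suc j) / A l)"
  proof (rule mono)
    have "{0..a (Suc j)} \<inter> I \<in> sets borel" by measurable
    then have "measure lborel ({0..a (Suc j)} \<inter> I) \<le> a (Suc j) - 0"
      using aj by (intro measure_lborel_le_Icc) simp_all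
    then show "measure lborel ({0..a (Suc j)} \<inter> I) / A l \<le> a (Suc j) / A l"
      using A_pos[of l] assms(1) by (intro divide_right_mono) simp_all
  qed
  finally show ?thesis by (simp add: mult_ac)
qed

lemma close_weight_nonneg: "m \<ge> 1 \<Longrightarrow> 0 \<le> close_weight r m"
  using A_pos[of m] A_pos[of "Suc m"] by (simp add: close_weight_def)

lemma events_close [measurable]:
  "\<lbrakk>k \<ge> 1; l \<ge> 1\<rbrakk> \<Longrightarrow> {w \<in> space M. dist (U k w) (U l w) \<le> r} \<in> sets M"
  by measurable

lemma events_slice: "\<lbrakk>k \<ge> 1; I \<in> sets borel\<rbrakk> \<Longrightarrow> {w \<in> space M. U k w \<in> slice j I} \<in> sets M"
proof -
  assume "k \<ge> 1" "I \<in> sets borel"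
  then have "U k -` slice j I \<inter> space M \<in> sets M"
    by (intro measurable_sets[of _ _ borel] slice_sets measurable_U)
  then show ?thesis by (simp add: vimage_def Int_def conj_commute)
qed

lemma close_weight_1:
  assumes "0 < r"
  shows "close_weight r 1 \<le> 3 * r * a 1"
proof -
  have [measurable]: "U 2 \<in> borel_measurable M" "U 3 \<in> borel_measurable M" by simp_all
  have [measurable]: "slice 0 {0..} \<in> sets borel" by (intro slice_sets) simp
  let ?P = "{w \<in> space M. U 3 w \<in> slice 0 {0..} \<and> U 2 w \<in> slice 0 {0..} \<and> dist (U 3 w) (U 2 w) \<le> r}"
  let ?D = "{w \<in> space M. U 3 w \<in> low 1 \<and> U 2 w \<in> low 1 \<and> dist (U 3 w) (U 2 w) \<le> r}"
  have "close_weight r 1 = A 3 * A 2 * prob ?D"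
    by (rule close_weight_eq) simp_all
  also have "prob ?D \<le> prob ?P"
  proof (rule prob_mono_gluing)
    fix w assume "w \<in> ?D" and "gluing_points a (\<lambda>k. U k w)"
    then interpret gluing_points a "\<lambda>k. U k w" by simp
    show "w \<in> ?P" using \<open>w \<in> ?D\<close>
        on_first_branch(2)[OF u_in[of 3]] on_first_branch(2)[OF u_in[of 2]] by (simp add: slice_def)
  qed measurable
  also have "prob ?P \<le> 3 * r * a (Suc 0) / (A 3 * A 2)"
    using assms by (intro prob_same_branch_close) auto
  finally have "(\<And>x y::real. x \<le> y \<Longrightarrow> A 3 * A 2 * x \<le> A 3 * A 2 * y) \<Longrightarrow>
      close_weight r 1 \<le> A 3 * A 2 * (3 * r * a (Suc 0) / (A 3 * A 2))" by blast
  then show ?thesis using A_pos[of 3] A_pos[of 2] by (simp add: mult_left_mono)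
qed

text \<open>Take two uniform points of \<open>T\<^sub>m\<^sub>+\<^sub>1\<close>. Either none, or one, or both of them lie on the last branch. If
  exactly one does, replacing it by the root of the branch, which is uniform in \<open>T\<^sub>m\<close>, reduces to a pair in \<open>T\<^sub>m\<close>
  and costs a factor \<open>min (a (m + 1)) r / A\<^sub>m\<close>.\<close>

lemma close_weight_Suc:
  assumes "0 < r" and m: "1 \<le> m"
  shows "close_weight r (Suc m) \<le>
    close_weight r m * (1 + 2 * min (a (Suc m)) r / A m) + 3 * r * a (Suc m)"
proof -
  define l k where "l = Suc m" and "k = Suc (Suc m)"
  have lk: "1 \<le> l" "l < k" "m < l" "m < k" "m \<le> l" "Suc m \<le> l" by (simp_all add: l_def k_def)
  have [measurable]: "U k \<in> borel_measurable M" "U l \<in> borel_measurable M" "U m \<in> borel_measurable M"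
    using lk m by simp_all
  have [measurable]: "slice m {0<..} \<in> sets borel" by (intro slice_sets) simp
  have Ak: "0 < A k" and Al: "0 < A l" and Am: "0 < A m" using A_pos lk m by simp_all
  let ?near = "\<lambda>w. dist (U k w) (U l w) \<le> r"
  let ?E = "{w \<in> space M. U k w \<in> low (Suc m) \<and> U l w \<in> low (Suc m) \<and> ?near w}"
  let ?E1 = "{w \<in> space M. U k w \<in> low m \<and> U l w \<in> low m \<and> ?near w}"
  let ?E2 = "{w \<in> space M. U k w \<in> slice m {0<..} \<and> U l w \<in> low m \<and> ?near w}"
  let ?E3 = "{w \<in> space M. U k w \<in> low m \<and> U l w \<in> slice m {0<..} \<and> ?near w}"
  let ?E4 = "{w \<in> space M. U k w \<in> slice m {0<..} \<and> U l w \<in> slice m {0<..} \<and> ?near w}"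
  have ev [measurable]: "?E1 \<in> sets M" "?E2 \<in> sets M" "?E3 \<in> sets M" "?E4 \<in> sets M" by measurable
  have "prob ?E \<le> prob (?E1 \<union> ?E2 \<union> (?E3 \<union> ?E4))"
  proof (rule prob_mono_gluing)
    fix w assume hw: "w \<in> ?E" and "gluing_points a (\<lambda>k. U k w)"
    then interpret gluing_points a "\<lambda>k. U k w" by simp
    have *: "U i w \<in> low m \<or> U i w \<in> slice m {0<..}" if "U i w \<in> low (Suc m)" "i \<ge> 1" for i
      using that nonneg_agg_tree[OF u_in[OF that(2)] that(2)]
      by (auto simp: low_def slice_def nonneg_def order.strict_iff_order)
        (metis Suc_leI le_neq_implies_less)+
    show "w \<in> ?E1 \<union> ?E2 \<union> (?E3 \<union> ?E4)" using *[of k] *[of l] lk hw by auto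
  qed measurable
  also have "\<dots> \<le> prob ?E1 + prob ?E2 + (prob ?E3 + prob ?E4)"
    by (intro order.trans[OF measure_Un_le] add_mono order.refl ev sets.Un)
  finally have E: "prob ?E \<le> prob ?E1 + prob ?E2 + (prob ?E3 + prob ?E4)" .
  have S: "close_weight r (Suc m) = A k * A l * prob ?E"
    using lk by (intro close_weight_eq) auto
  have S1: "A k * A l * prob ?E1 = close_weight r m"
    using lk m by (intro close_weight_eq[symmetric]) auto
  have S2: "A k * A l * prob ?E2 \<le> min (a (Suc m)) r / A m * close_weight r m"
  proof -
    have "prob ?E2 \<le> min (a (Suc m)) r / A k * prob {w \<in> space M. U l w \<in> low m \<and> dist (U m w) (U l w) \<le> r}"
      using assms lk by (intro prob_grafted_close) auto
    also have "prob {w \<in> space M. U l w \<in> low m \<and> dist (U m w) (U l w) \<le> r} =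
        prob {w \<in> space M. U l w \<in> low m \<and> U m w \<in> low m \<and> dist (U l w) (U m w) \<le> r}"
    proof (rule finite_measure_eq_AE)
      show "AE w in M. (w \<in> {w \<in> space M. U l w \<in> low m \<and> dist (U m w) (U l w) \<le> r}) =
          (w \<in> {w \<in> space M. U l w \<in> low m \<and> U m w \<in> low m \<and> dist (U l w) (U m w) \<le> r})"
        using AE_U_low[OF m] by eventually_elim (auto simp: dist_commute)
    qed measurable
    also have "\<dots> = close_weight r m / (A l * A m)"
      using close_weight_eq[of m m l r] lk m Al Am by (simp add: field_simps)
    finally have "A k * A l * prob ?E2 \<le>
        A k * A l * (min (a (Suc m)) r / A k * (close_weight r m / (A l * A m)))"
      using Ak Al by (intro mult_left_mono) auto
    then show ?thesis using Ak Al by simp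
  qed
  \<comment> \<open>here the earlier of the two points is on the branch, so that peeling it off is not covered
    by independence of the past; exchanging the points reduces to the previous case\<close>
  have S3: "A k * A l * prob ?E3 = A k * A l * prob ?E2"
  proof -
    let ?G = "(low m \<times> slice m {0<..}) \<inter> {(x, y). dist x y \<le> r}"
    have "?G \<in> sets (borel \<Otimes>\<^sub>M borel)" by (intro sets.Int near_sets pair_measureI) auto
    from exchange(2)[OF _ lk(6,2) lk(6,2) this]
    have "A k * A l * prob {w \<in> space M. U k w \<in> low (Suc m) \<and> U l w \<in> low (Suc m) \<and> (U k w, U l w) \<in> ?G} =
        A k * A l * prob {w \<in> space M. U k w \<in> low (Suc m) \<and> U l w \<in> low (Suc m) \<and> (U l w, U k w) \<in> ?G}"
      by simp
    moreover have "{w \<in> space M. U k w \<in> low (Suc m) \<and> U l w \<in> low (Suc m) \<and> (U k w, U l w) \<in> ?G} = ?E3"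
      using low_mono[of m "Suc m"] by (auto simp: slice_def)
    moreover have "{w \<in> space M. U k w \<in> low (Suc m) \<and> U l w \<in> low (Suc m) \<and> (U l w, U k w) \<in> ?G} = ?E2"
      using low_mono[of m "Suc m"] by (auto simp: slice_def dist_commute)
    ultimately show ?thesis by (simp only:)
  qed
  have S4: "A k * A l * prob ?E4 \<le> 3 * r * a (Suc m)"
  proof -
    have "prob ?E4 \<le> 3 * r * a (Suc m) / (A k * A l)"
      using assms lk by (intro prob_same_branch_close) auto
    then show ?thesis using Ak Al by (simp add: field_simps)
  qed
  have "close_weight r (Suc m) \<le> A k * A l * (prob ?E1 + prob ?E2 + (prob ?E3 + prob ?E4))"
    unfolding S using E Ak Al by (intro mult_left_mono) auto
  also have "\<dots> \<le> close_weight r m + min (a (Suc m)) r / A m * close_weight r m +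
      (min (a (Suc m)) r / A m * close_weight r m + 3 * r * a (Suc m))"
    unfolding distrib_left
    by (intro add_mono eq_refl[OF S1] S2 order.trans[OF eq_refl[OF S3] S2] S4)
  also have "\<dots> = close_weight r m * (1 + 2 * min (a (Suc m)) r / A m) + 3 * r * a (Suc m)"
    by (simp add: algebra_simps)
  finally show ?thesis .
qed

text \<open>Early phase: \<open>min (a (m + 1)) r\<close> is bounded by \<open>r\<close>.\<close>

lemma close_weight_le_exp:
  assumes "0 < r" "1 \<le> n"
  shows "close_weight r n \<le> exp (2 * r * (\<Sum>m=1..<n. 1 / A m)) * (3 * r * A n)"
  using assms(2)
proof (induction n rule: nat_induct_at_least)
  case base
  then show ?case using close_weight_1[OF assms(1)] by (simp add: A_def)
next
  case (Suc n)
  have An: "0 < A n" "0 < a (Suc n)" using A_pos a_pos Suc.hyps by simp_all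
  define s where "s = 2 * r * (\<Sum>m=1..<n. 1 / A m)"
  have s': "2 * r * (\<Sum>m=1..<Suc n. 1 / A m) = s + 2 * r / A n"
    using Suc.hyps by (simp add: s_def distrib_left)
  have "close_weight r (Suc n) \<le>
      close_weight r n * (1 + 2 * min (a (Suc n)) r / A n) + 3 * r * a (Suc n)"
    using close_weight_Suc assms(1) Suc.hyps by blast
  also have "\<dots> \<le> exp s * (3 * r * A n) * exp (2 * r / A n) + exp (s + 2 * r / A n) * (3 * r * a (Suc n))"
  proof (rule add_mono[OF mult_mono])
    show "close_weight r n \<le> exp s * (3 * r * A n)" using Suc.IH by (simp add: s_def)
    have "1 + 2 * min (a (Suc n)) r / A n \<le> 1 + 2 * r / A n"
      using An by (intro add_left_mono divide_right_mono) auto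
    then show "1 + 2 * min (a (Suc n)) r / A n \<le> exp (2 * r / A n)"
      using exp_ge_add_one_self order_trans by blast
    have "0 \<le> s" unfolding s_def using assms(1) A_pos
      by (intro mult_nonneg_nonneg sum_nonneg) (auto intro: less_imp_le)
    then have "1 \<le> exp (s + 2 * r / A n)" using An assms(1) by simp
    then show "3 * r * a (Suc n) \<le> exp (s + 2 * r / A n) * (3 * r * a (Suc n))"
      using An assms(1) mult_right_mono[of 1 "exp (s + 2 * r / A n)" "3 * r * a (Suc n)"] by simp
  qed (use An assms(1) in auto)
  also have "\<dots> = exp (s + 2 * r / A n) * (3 * r * A (Suc n))"
    by (simp add: A_Suc exp_add algebra_simps)
  finally show ?case by (simp only: s')
qed

text \<open>Late phase: \<open>min (a (m + 1)) r\<close> is bounded by \<open>a (m + 1)\<close>. The growth factor is then at most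
  the square of \<open>A (m + 1) / A m\<close>, and the increments of the ratio telescope.\<close>

lemma close_weight_ratio:
  assumes "0 < r" "1 \<le> N" "N \<le> l"
  shows "close_weight r l / (A l)\<^sup>2 \<le> close_weight r N / (A N)\<^sup>2 + 3 * r * (1 / A N - 1 / A l)"
  using assms(3)
proof (induction l rule: dec_induct)
  case (step l)
  have l: "1 \<le> l" using step assms by simp
  have Al: "0 < A l" "0 < a (Suc l)" "0 < A (Suc l)" using A_pos a_pos l by simp_all
  have "close_weight r (Suc l) \<le> close_weight r l * (1 + 2 * a (Suc l) / A l) + 3 * r * a (Suc l)"
  proof -
    have "close_weight r l * (1 + 2 * min (a (Suc l)) r / A l) \<le> close_weight r l * (1 + 2 * a (Suc l) / A l)"
      using close_weight_nonneg[OF l] Al by (intro mult_left_mono add_left_mono divide_right_mono) auto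
    then show ?thesis using close_weight_Suc[OF assms(1) l] by linarith
  qed
  also have "\<dots> \<le> close_weight r l * (A (Suc l))\<^sup>2 / (A l)\<^sup>2 + 3 * r * a (Suc l)"
  proof -
    have "1 + 2 * a (Suc l) / A l \<le> (A (Suc l))\<^sup>2 / (A l)\<^sup>2"
      using Al by (simp add: A_Suc field_simps power2_eq_square)
    then have "close_weight r l * (1 + 2 * a (Suc l) / A l) \<le> close_weight r l * ((A (Suc l))\<^sup>2 / (A l)\<^sup>2)"
      using close_weight_nonneg[OF l] by (intro mult_left_mono)
    then show ?thesis by simp
  qed
  finally have "close_weight r (Suc l) / (A (Suc l))\<^sup>2 \<le>
      close_weight r l / (A l)\<^sup>2 + 3 * r * (a (Suc l) / (A (Suc l))\<^sup>2)"
    using Al by (simp add: field_simps)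
  also have "a (Suc l) / (A (Suc l))\<^sup>2 \<le> 1 / A l - 1 / A (Suc l)"
  proof -
    have "1 / A l - 1 / A (Suc l) = a (Suc l) / (A l * A (Suc l))"
      using Al by (simp add: A_Suc field_simps)
    moreover have "a (Suc l) / (A (Suc l))\<^sup>2 \<le> a (Suc l) / (A l * A (Suc l))"
      using Al A_mono[of l "Suc l"] unfolding power2_eq_square
      by (intro divide_left_mono mult_right_mono mult_pos_pos) auto
    ultimately show ?thesis by simp
  qed
  finally have "close_weight r (Suc l) / (A (Suc l))\<^sup>2 \<le>
      close_weight r l / (A l)\<^sup>2 + 3 * r * (1 / A l - 1 / A (Suc l))"
    using assms(1) by simp
  then show ?case using step.IH by (simp add: right_diff_distrib)
qed simp

text \<open>Follow the ancestral line of \<open>U k\<close> down to \<open>T\<^sub>l\<close>: it enters \<open>T\<^sub>l\<close> at a uniform point, apart from the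
  case that it enters exactly at \<open>U l\<close>, through branch \<open>l + 1\<close>. That case accounts for the extra
  term \<open>r / A l\<close>.\<close>

lemma prob_close_le:
  assumes "0 < r" "1 \<le> l" "l < k"
  shows "prob {w \<in> space M. dist (U k w) (U l w) \<le> r} \<le> close_weight r l / (A l)\<^sup>2 + r / A l"
  using assms(3)
proof (induction k rule: less_induct)
  case (less k)
  define C where "C = close_weight r l / (A l)\<^sup>2 + r / A l"
  have k: "1 \<le> k" using less.prems by simp
  have pos: "0 < A l" "0 < A k" using A_pos assms k by simp_all
  have C: "0 \<le> C" using close_weight_nonneg[OF assms(2)] pos assms by (simp add: C_def)
  have [measurable]: "U k \<in> borel_measurable M" "U l \<in> borel_measurable M" using k assms by simp_all
  have [measurable]: "slice m {0<..} \<in> sets borel" for m by (intro slice_sets) simp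
  let ?near = "\<lambda>w. dist (U k w) (U l w) \<le> r"
  let ?L = "{w \<in> space M. U k w \<in> low l \<and> U l w \<in> low l \<and> ?near w}"
  let ?E = "\<lambda>j. {w \<in> space M. U k w \<in> slice j {0<..} \<and> U l w \<in> low j \<and> ?near w}"
  have ev [measurable]: "?L \<in> sets M" "\<And>j. ?E j \<in> sets M" by measurable
  have "prob {w \<in> space M. ?near w} \<le> prob (?L \<union> (\<Union>j\<in>{l..<k}. ?E j))"
  proof (rule prob_mono_gluing)
    fix w assume hw: "w \<in> {w \<in> space M. ?near w}" and "gluing_points a (\<lambda>k. U k w)"
    then interpret gluing_points a "\<lambda>k. U k w" by simp
    have Ul: "U l w \<in> low l" using agg_tree_low[OF u_in] assms by simp
    show "w \<in> ?L \<union> (\<Union>j\<in>{l..<k}. ?E j)"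
    proof (cases "U k w \<in> low l")
      case True
      then show ?thesis using Ul hw by auto
    next
      case False
      obtain j where j: "l \<le> j" "j < k" "U k w \<in> low (Suc j)" "coord (U k w) j > 0"
        using last_branch[OF u_in[OF k] k False] by blast
      then have "U l w \<in> low j" "U k w \<in> slice j {0<..}"
        using Ul low_mono[OF j(1)] by (auto simp: slice_def)
      then show ?thesis using j hw by auto
    qed
  qed measurable
  also have "\<dots> \<le> prob ?L + (\<Sum>j\<in>{l..<k}. prob (?E j))"
    by (intro order.trans[OF measure_Un_le] add_mono order.refl
        finite_measure_subadditive_finite ev sets.finite_UN) auto
  also have "prob ?L = close_weight r l / (A k * A l)"
    using close_weight_eq[of l l k r] assms less.prems pos by (simp add: field_simps)
  also have "(\<Sum>j\<in>{l..<k}. prob (?E j)) \<le> r / A k + (\<Sum>j\<in>{Suc l..<k}. a (Suc j) / A k * C)"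
  proof -
    have E: "prob (?E j) \<le> min (a (Suc j)) r / A k * prob {w \<in> space M. dist (U j w) (U l w) \<le> r}"
      if "j \<in> {l..<k}" for j
    proof -
      have "prob (?E j) \<le> min (a (Suc j)) r / A k *
          prob {w \<in> space M. U l w \<in> low j \<and> dist (U j w) (U l w) \<le> r}"
        using that assms less.prems by (intro prob_grafted_close) auto
      also have "\<dots> \<le> min (a (Suc j)) r / A k * prob {w \<in> space M. dist (U j w) (U l w) \<le> r}"
        using that assms pos a_pos[of "Suc j"]
        by (intro mult_left_mono finite_measure_mono events_close divide_nonneg_pos) auto
      finally show ?thesis .
    qed
    \<comment> \<open>for \<open>j = l\<close> the remaining distance is \<open>0\<close>, and only the height above \<open>U l\<close> counts\<close>
    have "prob (?E l) \<le> r / A k"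
    proof -
      have "prob (?E l) \<le> min (a (Suc l)) r / A k * 1"
        using E[of l] less.prems pos a_pos[of "Suc l"] assms
        by (intro order.trans[OF E[of l]] mult_left_mono prob_le_1 divide_nonneg_pos) auto
      also have "\<dots> \<le> r / A k" using pos by (simp add: divide_right_mono)
      finally show ?thesis .
    qed
    moreover have "(\<Sum>j\<in>{Suc l..<k}. prob (?E j)) \<le> (\<Sum>j\<in>{Suc l..<k}. a (Suc j) / A k * C)"
    proof (rule sum_mono)
      fix j assume j: "j \<in> {Suc l..<k}"
      have "prob (?E j) \<le> min (a (Suc j)) r / A k * C"
        using j less.IH[of j] pos a_pos[of "Suc j"] assms
        by (intro order.trans[OF E[of j]] mult_left_mono divide_nonneg_pos) (auto simp: C_def)
      also have "\<dots> \<le> a (Suc j) / A k * C"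
        using pos C by (intro mult_right_mono divide_right_mono) auto
      finally show "prob (?E j) \<le> a (Suc j) / A k * C" .
    qed
    moreover have "{l..<k} = insert l {Suc l..<k}" using less.prems by auto
    ultimately show ?thesis by simp
  qed
  also have "(\<Sum>j\<in>{Suc l..<k}. a (Suc j) / A k * C) = (A k - A (Suc l)) / A k * C"
  proof -
    have "(\<Sum>j\<in>{Suc l..<k}. a (Suc j)) = (\<Sum>j\<in>{Suc l..<k}. A (Suc j) - A j)" by (simp add: A_Suc)
    also have "\<dots> = A k - A (Suc l)" using less.prems by (intro sum_Suc_diff') auto
    finally show ?thesis by (simp add: sum_divide_distrib[symmetric] sum_distrib_right[symmetric])
  qed
  finally have "prob {w \<in> space M. ?near w} \<le>
      close_weight r l / (A k * A l) + (r / A k + (A k - A (Suc l)) / A k * C)" by simp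
  also have "\<dots> = (A l * C + (A k - A (Suc l)) * C) / A k"
    using pos by (simp add: C_def field_simps power2_eq_square)
  also have "\<dots> \<le> (A k * C) / A k"
  proof (rule divide_right_mono)
    have "A l * C \<le> A (Suc l) * C" using A_mono[of l "Suc l"] C by (intro mult_right_mono) auto
    then show "A l * C + (A k - A (Suc l)) * C \<le> A k * C" by (simp add: algebra_simps)
  qed (use pos in simp)
  finally show ?case using pos by (simp add: C_def)
qed

theorem prob_close:
  assumes "0 < r" "1 \<le> N" "N \<le> l" "l < k" and K: "2 * r * (\<Sum>m=1..<N. 1 / A m) \<le> K"
  shows "prob {w \<in> space M. dist (U k w) (U l w) \<le> r} \<le> (3 * exp K + 4) * r / A N"
proof -
  have pos: "0 < A N" "0 < A l" using A_pos assms by simp_all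
  have "close_weight r N \<le> exp K * (3 * r * A N)"
    using close_weight_le_exp[OF assms(1,2)] K pos assms(1)
    by (smt (verit) exp_le_cancel_iff mult_pos_pos mult_right_mono)
  then have "close_weight r N / (A N)\<^sup>2 \<le> 3 * exp K * r / A N"
    using pos by (simp add: field_simps power2_eq_square)
  moreover have "3 * r * (1 / A N - 1 / A l) \<le> 3 * r / A N" "r / A l \<le> r / A N"
    using pos assms A_mono[of N l] by (auto simp: field_simps)
  ultimately have "close_weight r l / (A l)\<^sup>2 + r / A l \<le> 3 * exp K * r / A N + 3 * r / A N + r / A N"
    using close_weight_ratio[OF assms(1-3)] by linarith
  also have "\<dots> = (3 * exp K + 4) * r / A N"
    by (simp add: add_divide_distrib[symmetric] algebra_simps)
  finally show ?thesis using prob_close_le[of r l k] assms by linarith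
qed

end

section \<open>The number of recent branches below a gluing point\<close>

text \<open>Each branch on the ancestral line of a tree point that is left at positive height shows up as one
  nonzero coordinate; \<open>turns n\<close> counts those among the branches \<open>n + 1, \<dots>, 2 n\<close>.\<close>

definition turns :: "nat \<Rightarrow> l1 \<Rightarrow> nat" where
  "turns n x = card {i \<in> {n..<2 * n}. coord x i \<noteq> 0}"

lemma measurable_turns [measurable]: "turns n \<in> measurable borel (count_space UNIV)"
proof -
  have "turns n = (\<lambda>x. \<Sum>i\<in>{n..<2*n}. if coord x i \<noteq> 0 then 1 else 0)"
    unfolding turns_def card_eq_sum by (intro ext sum.inter_filter) simp
  also have "\<dots> \<in> measurable borel (count_space UNIV)" by measurable
  finally show ?thesis .
qed

lemma turns_branch:
  assumes "x \<in> low j" "n \<le> j" "j < 2 * n" "c \<noteq> 0"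
  shows "turns n (x + c *\<^sub>R unit_l1 j) = Suc (turns n x)"
proof -
  have "{i \<in> {n..<2 * n}. coord (x + c *\<^sub>R unit_l1 j) i \<noteq> 0} = insert j {i \<in> {n..<2 * n}. coord x i \<noteq> 0}"
    using assms by (auto simp: low_def)
  then show ?thesis using assms by (simp add: turns_def low_def)
qed

context uniform_aggregation
begin

text \<open>A geometric tail: at each step down the ancestral line, the line leaves the branches added after time
  \<open>n\<close> with conditional probability at least \<open>A n / A (2 n)\<close>.\<close>

lemma prob_turns_ge:
  assumes "1 \<le> n" "n \<le> k" "k \<le> 2 * n"
  shows "prob {w \<in> space M. m \<le> turns n (U k w)} \<le> (1 - A n / A (2 * n)) ^ m"
  using assms(2,3)
proof (induction m arbitrary: k)
  case (Suc m)
  have k: "1 \<le> k" using Suc.prems assms by simp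
  define q where "q = 1 - A n / A (2 * n)"
  have pos: "0 < A n" "0 < A k" "0 < A (2 * n)" using A_pos assms k by simp_all
  have q: "0 \<le> q" using pos A_mono[of n "2 * n"] by (simp add: q_def)
  have [measurable]: "U k \<in> borel_measurable M" using k by simp
  let ?E = "\<lambda>j. {w \<in> space M. m \<le> turns n (U j w)}"
  have Eh: "?E j \<in> sets (hist k)" if "j \<in> {n..<k}" for j
  proof -
    have [measurable]: "U j \<in> borel_measurable (hist k)"
      using that assms by (intro measurable_U_hist) auto
    have "{w \<in> space (hist k). m \<le> turns n (U j w)} \<in> sets (hist k)" by measurable
    then show ?thesis by simp
  qed
  have ev: "?E j \<inter> {w \<in> space M. U k w \<in> slice j {0<..}} \<in> sets M" if "j \<in> {n..<k}" for j
    using hist_sets_M[OF Eh[OF that]] events_slice[OF k] by auto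
  have "prob {w \<in> space M. Suc m \<le> turns n (U k w)} \<le>
      prob (\<Union>j\<in>{n..<k}. ?E j \<inter> {w \<in> space M. U k w \<in> slice j {0<..}})"
  proof (rule prob_mono_gluing)
    fix w assume hw: "w \<in> {w \<in> space M. Suc m \<le> turns n (U k w)}" and "gluing_points a (\<lambda>k. U k w)"
    then interpret gluing_points a "\<lambda>k. U k w" by simp
    have "U k w \<notin> low n"
    proof
      assume "U k w \<in> low n"
      then have "turns n (U k w) = 0" by (auto simp: turns_def low_def)
      then show False using hw by simp
    qed
    then obtain j where j: "n \<le> j" "j < k" "U k w \<in> low (Suc j)" "coord (U k w) j > 0"
      using last_branch[OF u_in[OF k] k] by blast
    have "U k w = U j w + coord (U k w) j *\<^sub>R unit_l1 j"
      using on_branch(1)[OF u_in[OF k] k j(3,4)] j(1) assms by simp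
    then have "turns n (U k w) = Suc (turns n (U j w))"
      using turns_branch[of "U j w" j n "coord (U k w) j"] agg_tree_low[OF u_in, of j] j assms Suc.prems
      by simp
    then show "w \<in> (\<Union>j\<in>{n..<k}. ?E j \<inter> {w \<in> space M. U k w \<in> slice j {0<..}})"
      using hw j by (auto simp: slice_def)
  qed (intro sets.finite_UN ev, auto)
  also have "\<dots> \<le> (\<Sum>j\<in>{n..<k}. prob (?E j \<inter> {w \<in> space M. U k w \<in> slice j {0<..}}))"
    using ev by (intro finite_measure_subadditive_finite) auto
  also have "\<dots> \<le> (\<Sum>j\<in>{n..<k}. a (Suc j) / A k * q ^ m)"
  proof (rule sum_mono)
    fix j assume j: "j \<in> {n..<k}"
    have "prob (?E j \<inter> {w \<in> space M. U k w \<in> slice j {0<..}}) =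
        measure lborel ({0..a (Suc j)} \<inter> {0<..}) / A k * prob (?E j)"
      using j Eh[OF j] by (intro prob_slice) auto
    also have "{0..a (Suc j)} \<inter> {0<..} = {0<..a (Suc j)}" by auto
    also have "measure lborel {0<..a (Suc j)} / A k * prob (?E j) \<le> a (Suc j) / A k * q ^ m"
      using Suc.IH[of j] j Suc.prems a_pos[of "Suc j"] pos
      by (simp add: q_def mult_left_mono divide_right_mono)
    finally show "prob (?E j \<inter> {w \<in> space M. U k w \<in> slice j {0<..}}) \<le> a (Suc j) / A k * q ^ m" .
  qed
  also have "\<dots> = (A k - A n) / A k * q ^ m"
  proof -
    have "(\<Sum>j\<in>{n..<k}. a (Suc j)) = (\<Sum>j\<in>{n..<k}. A (Suc j) - A j)" by (simp add: A_Suc)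
    also have "\<dots> = A k - A n" using Suc.prems by (intro sum_Suc_diff') auto
    finally show ?thesis by (simp add: sum_divide_distrib[symmetric] sum_distrib_right[symmetric])
  qed
  also have "\<dots> \<le> q * q ^ m"
  proof (rule mult_right_mono)
    have "A n / A (2 * n) \<le> A n / A k"
      using pos A_mono[OF Suc.prems(2)] by (intro divide_left_mono) auto
    then show "(A k - A n) / A k \<le> q" using pos by (simp add: q_def diff_divide_distrib)
  qed (use q in simp)
  finally show ?case by (simp add: q_def)
qed simp

end

section \<open>Hausdorff measure and covers\<close>

lemma set_diameter_cong:
  assumes "\<And>x y. \<lbrakk>x \<in> C; y \<in> C\<rbrakk> \<Longrightarrow> d x y = d' x y"
  shows "set_diameter d C = set_diameter d' C"
  unfolding set_diameter_def using assms by (intro SUP_cong refl) simp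

text \<open>Covers consist of subsets of \<open>S\<close>, so only the values of the metric on \<open>S\<close> matter.\<close>

lemma hausdorff_dim_cong:
  assumes d: "\<And>x y. \<lbrakk>x \<in> S; y \<in> S\<rbrakk> \<Longrightarrow> d x y = d' x y"
  shows "hausdorff_dim S d = hausdorff_dim S d'"
proof -
  have diam: "set_diameter d C = set_diameter d' C" if "C \<subseteq> S" for C
    using that d by (intro set_diameter_cong) blast
  have "hausdorff_premeasure S d s \<delta> = hausdorff_premeasure S d' s \<delta>" for s \<delta>
    unfolding hausdorff_premeasure_def
  proof (rule INF_cong)
    show "{C. (\<forall>i. C i \<subseteq> S \<and> set_diameter d (C i) \<le> ennreal \<delta>) \<and> S \<subseteq> (\<Union>i. C i)} =
        {C. (\<forall>i. C i \<subseteq> S \<and> set_diameter d' (C i) \<le> ennreal \<delta>) \<and> S \<subseteq> (\<Union>i. C i)}"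
      by (intro Collect_cong conj_cong all_cong1 refl) (simp add: diam)
  qed (simp add: diam)
  then show ?thesis by (simp add: hausdorff_dim_def hausdorff_measure_def)
qed

lemma set_diameter_le:
  assumes "\<And>x y. \<lbrakk>x \<in> C; y \<in> C\<rbrakk> \<Longrightarrow> d x y \<le> \<rho>"
  shows "set_diameter d C \<le> ennreal \<rho>"
  unfolding set_diameter_def using assms by (intro SUP_least ennreal_leI)

lemma dist_le_set_diameter:
  assumes "x \<in> C" "y \<in> C" "set_diameter d C \<le> ennreal \<delta>"
  shows "d x y \<le> enn2real (set_diameter d C)"
proof -
  have "ennreal (d x y) \<le> set_diameter d C"
    unfolding set_diameter_def using assms(1,2) by (meson SUP_upper SUP_upper2)
  moreover have "set_diameter d C < \<top>" using assms(3) by (simp add: order.strict_trans1)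
  ultimately show ?thesis by (metis enn2real_mono enn2real_ennreal enn2real_nonneg linorder_le_cases order_trans)
qed

lemma hausdorff_measure_eq_0I:
  assumes "0 < s"
    and cover: "\<And>\<eta>. 0 < \<eta> \<Longrightarrow> \<exists>F \<rho>. finite F \<and> (\<forall>C\<in>F. C \<subseteq> S \<and> (\<forall>x\<in>C. \<forall>y\<in>C. d x y \<le> \<rho>)) \<and>
        S \<subseteq> \<Union>F \<and> 0 \<le> \<rho> \<and> \<rho> \<le> \<eta> \<and> real (card F) * \<rho> powr s \<le> \<eta>"
  shows "hausdorff_measure S d s = 0"
proof -
  have "hausdorff_premeasure S d s \<delta> \<le> 0" if "0 < \<delta>" for \<delta>
  proof (rule ennreal_le_epsilon)
    fix e :: real assume "0 < e"
    obtain F \<rho> where F: "finite F" "\<And>C. C \<in> F \<Longrightarrow> C \<subseteq> S"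
        "\<And>C x y. \<lbrakk>C \<in> F; x \<in> C; y \<in> C\<rbrakk> \<Longrightarrow> d x y \<le> \<rho>" "S \<subseteq> \<Union>F"
        "0 \<le> \<rho>" "\<rho> \<le> min e \<delta>" "real (card F) * \<rho> powr s \<le> min e \<delta>"
      using cover[of "min e \<delta>"] \<open>0 < e\<close> \<open>0 < \<delta>\<close> by (metis min_less_iff_conj)
    obtain h where h: "bij_betw h {0..<card F} F" using ex_bij_betw_nat_finite[OF F(1)] by blast
    define C where "C = (\<lambda>i. if i < card F then h i else {})"
    have hF: "h i \<in> F" if "i < card F" for i using h that by (auto simp: bij_betw_def)
    have diam: "set_diameter d (C i) \<le> ennreal \<rho>" for i
      using F(3) hF by (intro set_diameter_le) (auto simp: C_def split: if_splits)
    have "C \<in> {C. (\<forall>i. C i \<subseteq> S \<and> set_diameter d (C i) \<le> ennreal \<delta>) \<and> S \<subseteq> (\<Union>i. C i)}"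
    proof (intro CollectI conjI allI)
      fix i show "C i \<subseteq> S" using F(2)[OF hF] by (auto simp: C_def)
      have "ennreal \<rho> \<le> ennreal \<delta>" using F(6) by (intro ennreal_leI) simp
      then show "set_diameter d (C i) \<le> ennreal \<delta>" using diam[of i] by (rule order_trans[rotated])
    next
      show "S \<subseteq> (\<Union>i. C i)"
      proof
        fix x assume "x \<in> S"
        then obtain B where "x \<in> B" "B \<in> F" using F(4) by blast
        then obtain i where "i < card F" "x \<in> h i"
            using h unfolding bij_betw_def by (metis atLeastLessThan_iff imageE)
        then show "x \<in> (\<Union>i. C i)" by (intro UN_I[of i]) (auto simp: C_def)
      qed
    qed
    then have "hausdorff_premeasure S d s \<delta> \<le> (\<Sum>i. ennreal (enn2real (set_diameter d (C i)) powr s))"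
      unfolding hausdorff_premeasure_def by (rule INF_lower)
    also have "\<dots> = (\<Sum>i<card F. ennreal (enn2real (set_diameter d (C i)) powr s))"
      by (rule suminf_finite) (auto simp: C_def set_diameter_def bot_ennreal)
    also have "\<dots> \<le> (\<Sum>i<card F. ennreal (\<rho> powr s))"
    proof (intro sum_mono ennreal_leI powr_mono2)
      fix i show "enn2real (set_diameter d (C i)) \<le> \<rho>"
        using diam[of i] F(5) by (simp add: enn2real_leI)
    qed (use \<open>0 < s\<close> in auto)
    also have "\<dots> = ennreal (real (card F) * \<rho> powr s)"
      by (simp add: ennreal_mult' ennreal_of_nat_eq_real_of_nat)
    also have "\<dots> \<le> ennreal e" using F(7) by (intro ennreal_leI) simp
    finally show "hausdorff_premeasure S d s \<delta> \<le> 0 + ennreal e" by simp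
  qed
  then have "hausdorff_measure S d s \<le> 0"
    unfolding hausdorff_measure_def by (intro SUP_least) auto
  then show ?thesis by simp
qed

lemma hausdorff_measure_eq_0D:
  assumes "hausdorff_measure S d s = 0" "0 < \<delta>" "0 < \<eta>"
  obtains C where "\<And>i. C i \<subseteq> S" "\<And>i. set_diameter d (C i) \<le> ennreal \<delta>" "S \<subseteq> (\<Union>i. C i)"
    "(\<Sum>i. ennreal (enn2real (set_diameter d (C i)) powr s)) < ennreal \<eta>"
proof -
  have "hausdorff_premeasure S d s \<delta> \<le> hausdorff_measure S d s"
    unfolding hausdorff_measure_def using assms(2) by (intro SUP_upper) auto
  then have "hausdorff_premeasure S d s \<delta> < ennreal \<eta>" using assms by simp
  then show ?thesis
    unfolding hausdorff_premeasure_def INF_less_iff using that by blast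
qed

section \<open>Energy of finite point sets\<close>

text \<open>A dyadic, truncated form of the Riesz kernel \<open>dist x y\<close> to the power \<open>-s\<close>. It is bounded, so that
  it can be summed over the diagonal, and its expectation is a finite sum of probabilities that two
  points are close.\<close>

definition riesz :: "real \<Rightarrow> nat \<Rightarrow> 'a::metric_space \<Rightarrow> 'a \<Rightarrow> real" where
  "riesz s P x y = (\<Sum>p\<le>P. if dist x y \<le> (1/2) ^ p then (2 powr s) ^ p else 0)"

lemma riesz_nonneg: "0 \<le> riesz s P x y"
  unfolding riesz_def by (intro sum_nonneg) auto

lemma riesz_ge:
  assumes "dist x y \<le> \<rho>" "0 < \<rho>" "\<rho> \<le> 1" "(1/2) ^ P \<le> \<rho>" "0 \<le> s"
  shows "1 / (2 powr s * \<rho> powr s) \<le> riesz s P x y"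
proof -
  define p where "p = nat \<lfloor>- log 2 \<rho>\<rfloor>"
  have l: "0 \<le> - log 2 \<rho>" using assms by simp
  then have p: "real p \<le> - log 2 \<rho>" "- log 2 \<rho> < real p + 1"
    unfolding p_def by linarith+
  have up: "\<rho> \<le> (1/2) ^ p"
  proof -
    have "log 2 \<rho> \<le> - real p" using p by simp
    then have "\<rho> \<le> 2 powr (- real p)" using assms(2) by (simp add: log_le_iff)
    then show ?thesis by (simp add: powr_minus powr_realpow power_divide inverse_eq_divide)
  qed
  have lo: "1 / \<rho> \<le> 2 * 2 ^ p"
  proof -
    have "2 powr (- real p - 1) \<le> \<rho>" using p assms(2) by (simp add: le_log_iff[symmetric])
    then have "1 / \<rho> \<le> 1 / 2 powr (- real p - 1)" using assms(2) by (intro divide_left_mono) auto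
    also have "\<dots> = 2 powr (1 + real p)" by (simp add: powr_minus_divide[symmetric])
    also have "\<dots> = 2 * 2 ^ p" by (simp add: powr_add powr_realpow)
    finally show ?thesis .
  qed
  have "(1/2::real) ^ P \<le> (1/2) ^ p" using assms(4) up by linarith
  then have pP: "p \<le> P" by (simp add: power_decreasing_iff)
  have "(1 / \<rho>) powr s \<le> (2 * 2 ^ p) powr s" using lo assms by (intro powr_mono2) auto
  also have "\<dots> = 2 powr s * (2 powr s) ^ p"
    by (simp add: powr_mult powr_power powr_realpow[symmetric] powr_powr mult.commute)
  finally have "1 / (2 powr s * \<rho> powr s) \<le> (2 powr s) ^ p"
    using assms by (simp add: powr_divide field_simps)
  also have "\<dots> = (if dist x y \<le> (1/2) ^ p then (2 powr s) ^ p else 0)"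
    using assms(1) up by simp
  also have "\<dots> \<le> riesz s P x y"
    unfolding riesz_def using pP by (intro member_le_sum[of p "{..P}" "\<lambda>p. if dist x y \<le> (1/2) ^ p then (2 powr s) ^ p else 0"]) auto
  finally show ?thesis .
qed

text \<open>Cauchy--Schwarz for the numbers of points in the cells \<open>f = j\<close> of a partition: pairs within one
  cell have a large kernel.\<close>

lemma card_le_energy:
  fixes x :: "'i \<Rightarrow> 'a::metric_space"
  assumes I: "finite I" and J: "finite J" and f: "\<And>k. k \<in> I \<Longrightarrow> f k \<in> J"
    and close: "\<And>k l. \<lbrakk>k \<in> I; l \<in> I; f k = f l\<rbrakk> \<Longrightarrow> dist (x k) (x l) \<le> \<rho> (f k)"
    and \<rho>: "\<And>j. j \<in> J \<Longrightarrow> 0 < \<rho> j" "\<And>j. j \<in> J \<Longrightarrow> \<rho> j \<le> 1" "\<And>j. j \<in> J \<Longrightarrow> (1/2) ^ P \<le> \<rho> j"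
    and "0 \<le> s"
  shows "(real (card I))\<^sup>2 \<le>
    2 powr s * (\<Sum>j\<in>J. \<rho> j powr s) * (\<Sum>k\<in>I. \<Sum>l\<in>I. riesz s P (x k) (x l))"
proof -
  define n where "n = (\<lambda>j. real (card {k \<in> I. f k = j}))"
  define w where "w = (\<lambda>j. 2 powr s * \<rho> j powr s)"
  have w: "0 < w j" if "j \<in> J" for j using \<rho>(1)[OF that] by (simp add: w_def)
  have "real (card I) = (\<Sum>j\<in>J. n j)"
  proof -
    have "(\<Sum>k\<in>I. 1) = (\<Sum>j\<in>J. \<Sum>k\<in>{k \<in> I. f k = j}. 1::nat)"
      using I J f by (intro sum.group[symmetric]) auto
    then show ?thesis by (simp add: n_def flip: of_nat_sum)
  qed
  also have "\<dots> = (\<Sum>j\<in>J. (n j / sqrt (w j)) * sqrt (w j))"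
    using w by (intro sum.cong refl) (simp add: order_less_imp_not_eq2)
  finally have "(real (card I))\<^sup>2 = (\<Sum>j\<in>J. (n j / sqrt (w j)) * sqrt (w j))\<^sup>2" by simp
  also have "\<dots> \<le> (\<Sum>j\<in>J. (n j / sqrt (w j))\<^sup>2) * (\<Sum>j\<in>J. (sqrt (w j))\<^sup>2)"
    by (rule Cauchy_Schwarz_ineq_sum)
  also have "(\<Sum>j\<in>J. (sqrt (w j))\<^sup>2) = 2 powr s * (\<Sum>j\<in>J. \<rho> j powr s)"
    using w by (simp add: sum_distrib_left w_def less_imp_le)
  also have "(\<Sum>j\<in>J. (n j / sqrt (w j))\<^sup>2) = (\<Sum>j\<in>J. n j * n j * (1 / w j))"
    using w by (intro sum.cong refl) (simp add: power_divide power2_eq_square less_imp_le)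
  also have "\<dots> = (\<Sum>j\<in>J. \<Sum>k\<in>{k \<in> I. f k = j}. \<Sum>l\<in>{l \<in> I. f l = j}. 1 / w j)"
    by (simp add: n_def mult.assoc)
  also have "\<dots> \<le> (\<Sum>j\<in>J. \<Sum>k\<in>{k \<in> I. f k = j}. \<Sum>l\<in>I. riesz s P (x k) (x l))"
  proof (intro sum_mono)
    fix j k assume j: "j \<in> J" and k: "k \<in> {k \<in> I. f k = j}"
    have "(\<Sum>l\<in>{l \<in> I. f l = j}. 1 / w j) \<le> (\<Sum>l\<in>{l \<in> I. f l = j}. riesz s P (x k) (x l))"
      unfolding w_def
    proof (intro sum_mono riesz_ge)
      fix l assume "l \<in> {l \<in> I. f l = j}"
      then show "dist (x k) (x l) \<le> \<rho> j" using close[of k l] k by simp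
    qed (use \<rho>[OF j] \<open>0 \<le> s\<close> in auto)
    also have "\<dots> \<le> (\<Sum>l\<in>I. riesz s P (x k) (x l))"
      using I by (intro sum_mono2 riesz_nonneg) auto
    finally show "(\<Sum>l\<in>{l \<in> I. f l = j}. 1 / w j) \<le> (\<Sum>l\<in>I. riesz s P (x k) (x l))" .
  qed
  also have "\<dots> = (\<Sum>k\<in>I. \<Sum>l\<in>I. riesz s P (x k) (x l))"
    using I J f by (intro sum.group) auto
  finally show ?thesis
    by (simp add: mult_ac mult_right_mono mult_left_mono sum_nonneg)
qed

lemma fatten_radius:
  fixes D s e :: real
  assumes "0 \<le> D" "D < 1" "0 < s" "0 < e"
  obtains \<rho> where "D < \<rho>" "\<rho> \<le> 1" "\<rho> powr s \<le> D powr s + e"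
proof -
  have "((\<lambda>t. t powr s) \<longlongrightarrow> D powr s) (at_right D)"
    using assms by (intro tendsto_powr' tendsto_intros) (auto simp: eventually_at_filter)
  then have "\<forall>\<^sub>F t in at_right D. t powr s < D powr s + e"
    using assms(4) by (intro order_tendstoD) auto
  moreover have "\<forall>\<^sub>F t in at_right D. t < 1"
    using assms(2) by (rule eventually_at_right_less[THEN eventually_mono] | intro eventually_at_rightI[of D 1]) auto
  moreover have "\<forall>\<^sub>F t in at_right D. D < t" by (rule eventually_at_right_less)
  ultimately have "\<forall>\<^sub>F t in at_right D. t powr s < D powr s + e \<and> t < 1 \<and> D < t"
    by eventually_elim simp
  then obtain t where "t powr s < D powr s + e" "t < 1" "D < t"
    using eventually_happens[of _ "at_right D"] by (auto simp: trivial_limit_at_right_real)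
  then show ?thesis using that[of t] by simp
qed

text \<open>A cover is first fattened to an open one, at the expense of a factor \<open>2\<close> in the sum of powers; by
  compactness finitely many of the open sets suffice, and then their diameters are bounded below,
  so every sufficiently deep truncation level \<open>P\<close> of the kernel resolves all of them.\<close>

lemma energy_lower_bound:
  fixes S :: "'a::metric_space set"
  assumes S: "compact S" and s: "0 < s" "0 < \<eta>"
    and C: "\<And>i::nat. C i \<subseteq> S" "\<And>i. set_diameter dist (C i) \<le> ennreal (1/2)" "S \<subseteq> (\<Union>i. C i)"
    and sum: "(\<Sum>i. ennreal (enn2real (set_diameter dist (C i)) powr s)) < ennreal \<eta>"
  shows "\<exists>P0. \<forall>P\<ge>P0. \<forall>I (x :: nat \<Rightarrow> 'a). finite I \<and> x ` I \<subseteq> S \<longrightarrow>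
    (real (card I))\<^sup>2 \<le> 2 powr s * (2 * \<eta>) * (\<Sum>k\<in>I. \<Sum>l\<in>I. riesz s P (x k) (x l))"
proof -
  define D where "D = (\<lambda>i. enn2real (set_diameter dist (C i)))"
  have D: "0 \<le> D i" "D i \<le> 1/2" for i
    unfolding D_def by (simp, rule enn2real_leI[OF _ C(2)], simp)
  have "\<exists>\<rho>. D i < \<rho> \<and> \<rho> \<le> 1 \<and> \<rho> powr s \<le> D i powr s + \<eta> * (1/2) ^ Suc i" for i
  proof -
    have "D i < 1" "0 < \<eta> * (1/2) ^ Suc i" using D(2)[of i] s by auto
    from fatten_radius[OF D(1) this(1) s(1) this(2)] show ?thesis by blast
  qed
  then obtain \<rho> where \<rho>: "\<And>i. D i < \<rho> i" "\<And>i. \<rho> i \<le> 1"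
      "\<And>i. \<rho> i powr s \<le> D i powr s + \<eta> * (1/2) ^ Suc i" by metis
  have \<rho>0: "0 < \<rho> i" for i using \<rho>(1)[of i] D(1)[of i] by linarith
  define V where "V = (\<lambda>i. \<Union>x\<in>C i. ball x ((\<rho> i - D i) / 2))"
  have op: "open (V i)" for i unfolding V_def by auto
  have sub: "C i \<subseteq> V i" for i using \<rho>(1)[of i] by (force simp: V_def)
  have cov: "S \<subseteq> (\<Union>i\<in>UNIV. V i)" by (rule order_trans[OF C(3) UN_mono[OF order_refl sub]])
  obtain J where J: "finite J" "S \<subseteq> (\<Union>i\<in>J. V i)"
    by (rule compactE_image[OF S op cov])
  have close: "dist y z \<le> \<rho> i" if yz: "y \<in> V i" "z \<in> V i" for y z i
  proof -
    obtain y' z' where y': "y' \<in> C i" "dist y' y < (\<rho> i - D i) / 2"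
      and z': "z' \<in> C i" "dist z' z < (\<rho> i - D i) / 2" using yz by (auto simp: V_def)
    have "dist y' z' \<le> D i" unfolding D_def by (rule dist_le_set_diameter[OF y'(1) z'(1) C(2)])
    moreover have "dist y z \<le> dist y' y + dist y' z' + dist z' z"
      using dist_triangle[of y z y'] dist_triangle[of y' z z'] dist_commute[of y y'] by linarith
    ultimately show ?thesis using y' z' by argo
  qed
  have sum\<rho>: "(\<Sum>i\<in>J. \<rho> i powr s) \<le> 2 * \<eta>"
  proof -
    have "ennreal (\<Sum>i\<in>J. D i powr s) = (\<Sum>i\<in>J. ennreal (D i powr s))" by simp
    also have "\<dots> \<le> (\<Sum>i. ennreal (D i powr s))"
      using J(1) by (intro sum_le_suminf) auto
    also have "\<dots> < ennreal \<eta>" using sum by (simp add: D_def)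
    finally have 1: "(\<Sum>i\<in>J. D i powr s) \<le> \<eta>" using s by (simp add: ennreal_less_iff sum_nonneg)
    have "(\<Sum>i\<in>J. \<eta> * (1/2) ^ Suc i) \<le> (\<Sum>i. \<eta> * (1/2) ^ Suc i)"
      using J(1) s by (intro sum_le_suminf summable_mult sums_summable[OF power_half_series]) auto
    also have "\<dots> = \<eta>" using sums_mult[OF power_half_series, of \<eta>] by (simp add: sums_iff)
    finally have 2: "(\<Sum>i\<in>J. \<eta> * (1/2) ^ Suc i) \<le> \<eta>" .
    have "(\<Sum>i\<in>J. \<rho> i powr s) \<le> (\<Sum>i\<in>J. D i powr s + \<eta> * (1/2) ^ Suc i)"
      by (intro sum_mono \<rho>(3))
    then show ?thesis using 1 2 by (simp add: sum.distrib)
  qed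
  have "\<forall>\<^sub>F P in sequentially. \<forall>i\<in>J. (1/2) ^ P < \<rho> i"
  proof (intro eventually_ball_finite J ballI)
    fix i
    have "(\<lambda>P. (1/2 :: real) ^ P) \<longlonglongrightarrow> 0" by (rule LIMSEQ_realpow_zero) auto
    then show "\<forall>\<^sub>F P in sequentially. (1/2) ^ P < \<rho> i" using \<rho>0 by (rule order_tendstoD)
  qed
  then obtain P0 where P0: "\<And>P i. \<lbrakk>P \<ge> P0; i \<in> J\<rbrakk> \<Longrightarrow> (1/2) ^ P < \<rho> i"
    by (auto simp: eventually_sequentially)
  show ?thesis
  proof (intro exI[of _ P0] allI impI, elim conjE)
    fix P I and x :: "nat \<Rightarrow> 'a" assume P: "P \<ge> P0" and I: "finite I" "x ` I \<subseteq> S"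
    have "\<forall>k\<in>I. \<exists>j\<in>J. x k \<in> V j" using I(2) J(2) by blast
    then obtain f where f: "\<And>k. k \<in> I \<Longrightarrow> f k \<in> J" "\<And>k. k \<in> I \<Longrightarrow> x k \<in> V (f k)" by metis
    have "(real (card I))\<^sup>2 \<le>
        2 powr s * (\<Sum>j\<in>J. \<rho> j powr s) * (\<Sum>k\<in>I. \<Sum>l\<in>I. riesz s P (x k) (x l))"
    proof (rule card_le_energy[OF I(1) J(1) f(1)])
      fix k l assume "k \<in> I" "l \<in> I" "f k = f l"
      then show "dist (x k) (x l) \<le> \<rho> (f k)" using f(2)[of k] f(2)[of l] by (intro close) auto
    qed (use \<rho>0 \<rho>(2) P0[OF P] s in \<open>auto intro: less_imp_le\<close>)
    also have "\<dots> \<le> 2 powr s * (2 * \<eta>) * (\<Sum>k\<in>I. \<Sum>l\<in>I. riesz s P (x k) (x l))"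
      using sum\<rho> by (intro mult_right_mono mult_left_mono sum_nonneg riesz_nonneg) auto
    finally show "(real (card I))\<^sup>2 \<le> 2 powr s * (2 * \<eta>) * (\<Sum>k\<in>I. \<Sum>l\<in>I. riesz s P (x k) (x l))" .
  qed
qed

lemma hausdorff_measure_pos_if_energy_bounded:
  fixes S :: "'a::metric_space set" and x :: "nat \<Rightarrow> 'a" and I :: "nat \<Rightarrow> nat set"
  assumes S: "compact S" and st: "0 < t" "t \<le> s"
    and I: "\<And>P. finite (I P)" "\<And>P. I P \<noteq> {}" "\<And>P. x ` I P \<subseteq> S"
    and energy: "\<exists>\<^sub>F P in sequentially. (\<Sum>k\<in>I P. \<Sum>l\<in>I P. riesz s P (x k) (x l)) \<le> K * (real (card (I P)))\<^sup>2"
  shows "hausdorff_measure S dist t \<noteq> 0"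
proof
  assume 0: "hausdorff_measure S dist t = 0"
  define K' where "K' = max K 1"
  \<comment> \<open>small enough for the bound of \<open>energy_lower_bound\<close> to give \<open>c \<le> c / 2\<close> below\<close>
  define \<eta> where "\<eta> = 1 / (2 powr s * 4 * K')"
  have K': "1 \<le> K'" "K \<le> K'" by (simp_all add: K'_def)
  have \<eta>: "0 < \<eta>" using K' by (simp add: \<eta>_def)
  obtain C where C: "\<And>i::nat. C i \<subseteq> S" "\<And>i. set_diameter dist (C i) \<le> ennreal (1/2)" "S \<subseteq> (\<Union>i. C i)"
    "(\<Sum>i. ennreal (enn2real (set_diameter dist (C i)) powr t)) < ennreal \<eta>"
    using hausdorff_measure_eq_0D[OF 0, of "1/2" \<eta>] \<eta> by (metis half_gt_zero_iff zero_less_one)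
  have "(\<Sum>i. ennreal (enn2real (set_diameter dist (C i)) powr s)) \<le>
      (\<Sum>i. ennreal (enn2real (set_diameter dist (C i)) powr t))"
  proof (intro suminf_le ennreal_leI)
    fix i
    define D where "D = enn2real (set_diameter dist (C i))"
    have "0 \<le> D" "D \<le> 1/2" unfolding D_def by (simp, rule enn2real_leI[OF _ C(2)], simp)
    then show "D powr s \<le> D powr t" using st by (cases "D = 0") (auto intro: powr_mono')
  qed auto
  then have "(\<Sum>i. ennreal (enn2real (set_diameter dist (C i)) powr s)) < ennreal \<eta>"
    using C(4) by (rule order.strict_trans1)
  moreover have "0 < s" using st by simp
  ultimately obtain P0 where *: "\<forall>P\<ge>P0. \<forall>I (x :: nat \<Rightarrow> 'a). finite I \<and> x ` I \<subseteq> S \<longrightarrow>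
    (real (card I))\<^sup>2 \<le> 2 powr s * (2 * \<eta>) * (\<Sum>k\<in>I. \<Sum>l\<in>I. riesz s P (x k) (x l))"
    using energy_lower_bound[OF S _ \<eta> C(1-3)] by blast
  have P0: "(real (card (I P)))\<^sup>2 \<le>
      2 powr s * (2 * \<eta>) * (\<Sum>k\<in>I P. \<Sum>l\<in>I P. riesz s P (x k) (x l))" if "P \<ge> P0" for P
    using *[rule_format, OF that, of "I P" x] I by simp
  have "\<exists>\<^sub>F P in sequentially. (\<Sum>k\<in>I P. \<Sum>l\<in>I P. riesz s P (x k) (x l)) \<le> K * (real (card (I P)))\<^sup>2 \<and> P0 \<le> P"
    using energy eventually_ge_at_top[of P0] by (rule frequently_eventually_frequently)
  then obtain P where P: "(\<Sum>k\<in>I P. \<Sum>l\<in>I P. riesz s P (x k) (x l)) \<le> K * (real (card (I P)))\<^sup>2" "P0 \<le> P"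
    by (metis (no_types, lifting) frequently_ex)
  define c where "c = (real (card (I P)))\<^sup>2"
  have c: "0 < c" using I(1,2)[of P] by (simp add: c_def card_gt_0_iff)
  have "c \<le> 2 powr s * (2 * \<eta>) * (\<Sum>k\<in>I P. \<Sum>l\<in>I P. riesz s P (x k) (x l))"
    using P0[OF P(2)] by (simp add: c_def)
  also have "\<dots> \<le> 2 powr s * (2 * \<eta>) * (K' * c)"
  proof (intro mult_left_mono)
    have "K * c \<le> K' * c" using K' c by (intro mult_right_mono) auto
    then show "(\<Sum>k\<in>I P. \<Sum>l\<in>I P. riesz s P (x k) (x l)) \<le> K' * c" using P(1) by (simp add: c_def)
  qed (use \<eta> in auto)
  also have "\<dots> = c / 2" using K' by (simp add: \<eta>_def field_simps)
  finally show False using c by simp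
qed

section \<open>Covers of the limit tree\<close>

context gluing_points
begin

lemma coord_le_branch_length:
  assumes "x \<in> agg_tree a u n" "n \<ge> 1"
  shows "coord x i \<le> a (Suc i)"
  using assms
proof (induction rule: agg_tree_induct)
  case (root s)
  then show ?case using a_pos[of "Suc i"] by auto
next
  case (branch m s)
  have "coord (u m) m = 0" using agg_tree_low[OF branch(3,1)] by (simp add: low_def)
  then show ?case using branch by auto
qed

text \<open>Every point of the tree is a gluing point plus one piece of a branch.\<close>

lemma turns_le_Suc:
  assumes "x \<in> agg_tree a u N" "N \<ge> 1" "n \<ge> 1"
    and bound: "\<And>k. \<lbrakk>n \<le> k; k < 2 * n\<rbrakk> \<Longrightarrow> turns n (u k) \<le> b"
  shows "turns n x \<le> Suc b"
  using assms(1,2)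
proof (induction rule: agg_tree_induct)
  case (root s)
  have "{i \<in> {n..<2 * n}. coord (s *\<^sub>R unit_l1 0) i \<noteq> 0} = {}" using \<open>n \<ge> 1\<close> by auto
  then show ?case by (simp only: turns_def card.empty)
next
  case (branch m s)
  show ?case
  proof (cases "n \<le> m \<and> m < 2 * n \<and> s \<noteq> 0")
    case True
    then show ?thesis
      using turns_branch[of "u m" m n s] agg_tree_low[OF branch(3,1)] bound[of m] by simp
  next
    case False
    then have "{i \<in> {n..<2 * n}. coord (u m + s *\<^sub>R unit_l1 m) i \<noteq> 0} =
        {i \<in> {n..<2 * n}. coord (u m) i \<noteq> 0}" by auto
    then show ?thesis using branch.IH by (simp only: turns_def)
  qed
qed

lemma block_sum_le:
  assumes "x \<in> agg_tree a u N" "N \<ge> 1" "n \<ge> 1"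
    and "\<And>k. \<lbrakk>n \<le> k; k < 2 * n\<rbrakk> \<Longrightarrow> turns n (u k) \<le> b"
    and "\<And>i. n < i \<Longrightarrow> a i \<le> c" and "0 \<le> c"
  shows "(\<Sum>i\<in>{n..<2 * n}. coord x i) \<le> (real b + 1) * c"
proof -
  have "(\<Sum>i\<in>{n..<2 * n}. coord x i) = (\<Sum>i\<in>{i \<in> {n..<2 * n}. coord x i \<noteq> 0}. coord x i)"
    by (intro sum.mono_neutral_right) auto
  also have "\<dots> \<le> (\<Sum>i\<in>{i \<in> {n..<2 * n}. coord x i \<noteq> 0}. c)"
  proof (rule sum_mono)
    fix i assume "i \<in> {i \<in> {n..<2 * n}. coord x i \<noteq> 0}"
    then have "a (Suc i) \<le> c" by (intro assms(5)) simp
    then show "coord x i \<le> c" using coord_le_branch_length[OF assms(1,2), of i] by linarith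
  qed
  also have "\<dots> = real (turns n x) * c" by (simp add: turns_def)
  also have "\<dots> \<le> (real b + 1) * c"
    using turns_le_Suc[OF assms(1-4)] assms(6) by (intro mult_right_mono) auto
  finally show ?thesis .
qed

text \<open>Truncating the coordinates at \<open>n\<close> projects the tree onto \<open>T\<^sub>n\<close>.\<close>

lemma truncation_in_agg_tree:
  assumes "x \<in> agg_tree a u N" "N \<ge> 1" "n \<ge> 1"
  shows "\<exists>y\<in>agg_tree a u n. \<forall>i. coord y i = (if i < n then coord x i else 0)"
  using assms(1,2)
proof (induction rule: agg_tree_induct)
  case (root s)
  have "s *\<^sub>R unit_l1 0 \<in> agg_tree a u (Suc 0)" using root by (auto simp: agg_tree_1)
  then show ?case
    using agg_tree_mono[of "Suc 0" n a u] \<open>n \<ge> 1\<close> by (intro bexI[of _ "s *\<^sub>R unit_l1 0"]) auto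
next
  case (branch m s)
  show ?case
  proof (cases "m < n")
    case True
    have "u m + s *\<^sub>R unit_l1 m \<in> agg_tree a u (Suc m)"
      using branch by (auto simp: agg_tree_Suc branch_point_Suc)
    moreover from this have "u m + s *\<^sub>R unit_l1 m \<in> low (Suc m)" by (rule agg_tree_low) simp
    ultimately show ?thesis
      using agg_tree_mono[of "Suc m" n a u] True
      by (intro bexI[of _ "u m + s *\<^sub>R unit_l1 m"]) (auto intro!: lowD[OF agg_tree_low[OF branch(3,1)]])
  next
    case False
    obtain y where "y \<in> agg_tree a u n" "\<forall>i. coord y i = (if i < n then coord (u m) i else 0)"
      using branch.IH by blast
    then show ?thesis using False by (intro bexI[of _ y]) auto
  qed
qed

lemma dist_truncation_le:
  assumes "x \<in> agg_tree a u N" "N \<ge> 1"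
    and y: "\<And>i. coord y i = (if i < n then coord x i else 0)"
    and tail: "\<And>Q. (\<Sum>i\<in>{n..<Q}. coord x i) \<le> R"
  shows "dist x y \<le> R"
proof -
  have x: "nonneg x" "x \<in> low N" using nonneg_agg_tree agg_tree_low assms by blast+
  have "norm (x - y) = (\<Sum>i\<in>{n..<N}. \<bar>coord (x - y) i\<bar>)"
    unfolding norm_l1_def using x(2) by (intro suminf_finite) (auto simp: y low_def)
  also have "\<dots> = (\<Sum>i\<in>{n..<N}. coord x i)"
    using x(1) by (intro sum.cong) (auto simp: y nonneg_def)
  finally show ?thesis using tail[of N] by (simp add: dist_norm)
qed

text \<open>Cut each branch into pieces of length \<open>\<rho>\<close>; the one incomplete piece per branch accounts for the
  term \<open>n\<close>.\<close>

lemma agg_tree_cover: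
  assumes "n \<ge> 1" "0 < \<rho>"
  shows "\<exists>F. finite F \<and> real (card F) \<le> real n + (\<Sum>k=1..n. a k) / \<rho> \<and> agg_tree a u n \<subseteq> \<Union>F \<and>
    (\<forall>B\<in>F. \<forall>x\<in>B. \<forall>y\<in>B. dist x y \<le> \<rho>)"
proof -
  define G where "G = (\<lambda>k. nat \<lfloor>a k / \<rho>\<rfloor> + 1)"
  define B where "B = (\<lambda>(k, g). branch_point u k ` {real g * \<rho>..(real g + 1) * \<rho>})"
  define I where "I = (SIGMA k:{1..n}. {..<G k})"
  have "agg_tree a u n \<subseteq> \<Union>(B ` I)"
  proof
    fix x assume "x \<in> agg_tree a u n"
    then obtain k s where k: "k \<in> {1..n}" and s: "0 \<le> s" "s \<le> a k" "x = branch_point u k s"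
      by (auto simp: agg_tree_def)
    define g where "g = nat \<lfloor>s / \<rho>\<rfloor>"
    have "real g = of_int \<lfloor>s / \<rho>\<rfloor>" using s assms(2) by (simp add: g_def)
    then have "real g \<le> s / \<rho>" "s / \<rho> \<le> real g + 1" by linarith+
    then have "s \<in> {real g * \<rho>..(real g + 1) * \<rho>}" using assms(2) by (simp add: field_simps)
    moreover have "g < G k" unfolding g_def G_def
      using s assms(2) by (auto intro!: nat_mono floor_mono divide_right_mono simp: less_Suc_eq_le)
    ultimately show "x \<in> \<Union>(B ` I)"
      using k s by (intro UnionI[of "B (k, g)"]) (auto simp: I_def B_def)
  qed
  moreover have "dist x y \<le> \<rho>" if "D \<in> B ` I" "x \<in> D" "y \<in> D" for D x y
  proof -
    obtain k g where D: "D = branch_point u k ` {real g * \<rho>..(real g + 1) * \<rho>}"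
      using \<open>D \<in> B ` I\<close> by (auto simp: B_def)
    obtain s t where st: "x = branch_point u k s" "y = branch_point u k t"
      "s \<in> {real g * \<rho>..(real g + 1) * \<rho>}" "t \<in> {real g * \<rho>..(real g + 1) * \<rho>}"
      using \<open>x \<in> D\<close> \<open>y \<in> D\<close> D by blast
    have "dist x y = \<bar>s - t\<bar>" by (simp only: st branch_point_def dist_add_unit)
    also have "\<dots> \<le> \<rho>" using st by (auto simp: algebra_simps abs_le_iff)
    finally show ?thesis .
  qed
  moreover have "real (card (B ` I)) \<le> real n + (\<Sum>k=1..n. a k) / \<rho>"
  proof -
    have "finite I" by (simp add: I_def)
    then have "real (card (B ` I)) \<le> real (card I)" using card_image_le[of I B] by simp
    also have "\<dots> = (\<Sum>k=1..n. real (G k))" by (simp add: I_def)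
    also have "\<dots> \<le> (\<Sum>k=1..n. 1 + a k / \<rho>)"
    proof (rule sum_mono)
      fix k assume "k \<in> {1..n}"
      then have "0 \<le> a k / \<rho>" using a_pos[of k] assms(2) by simp
      then show "real (G k) \<le> 1 + a k / \<rho>" unfolding G_def by linarith
    qed
    also have "\<dots> = real n + (\<Sum>k=1..n. a k) / \<rho>" by (simp add: sum.distrib sum_divide_distrib)
    finally show ?thesis .
  qed
  moreover have "finite (B ` I)" by (simp add: I_def)
  ultimately show ?thesis by (intro exI[of _ "B ` I"]) blast
qed

lemma limit_cover:
  assumes n: "n \<ge> 1" and R: "0 < R"
    and near: "\<And>x N. \<lbrakk>N \<ge> 1; x \<in> agg_tree a u N\<rbrakk> \<Longrightarrow> \<exists>y\<in>agg_tree a u n. dist x y \<le> R"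
  shows "\<exists>F. finite F \<and> real (card F) \<le> real n + (\<Sum>k=1..n. a k) / R \<and>
    (\<forall>C\<in>F. C \<subseteq> agg_tree_limit a u \<and> (\<forall>x\<in>C. \<forall>y\<in>C. dist x y \<le> 5 * R)) \<and> agg_tree_limit a u \<subseteq> \<Union>F"
proof -
  obtain F where F: "finite F" "real (card F) \<le> real n + (\<Sum>k=1..n. a k) / R" "agg_tree a u n \<subseteq> \<Union>F"
    "\<And>B x y. \<lbrakk>B \<in> F; x \<in> B; y \<in> B\<rbrakk> \<Longrightarrow> dist x y \<le> R"
    using agg_tree_cover[OF n R] by blast
  define fat where "fat = (\<lambda>B. {x \<in> agg_tree_limit a u. \<exists>y\<in>B. dist x y \<le> 2 * R})"
  have "agg_tree_limit a u \<subseteq> \<Union>(fat ` F)"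
  proof
    fix x assume x: "x \<in> agg_tree_limit a u"
    then obtain x' where x': "x' \<in> (\<Union>n\<in>{1..}. agg_tree a u n)" "dist x' x < R"
      using R unfolding agg_tree_limit_def closure_approachable by blast
    then obtain y where y: "y \<in> agg_tree a u n" "dist x' y \<le> R" using near by auto
    then obtain B where "B \<in> F" "y \<in> B" using F(3) by blast
    moreover have "dist x y \<le> 2 * R" using x' y dist_triangle[of x y x'] by (simp add: dist_commute)
    ultimately show "x \<in> \<Union>(fat ` F)" using x by (auto simp: fat_def)
  qed
  moreover have "dist x y \<le> 5 * R" if "B \<in> F" "x \<in> fat B" "y \<in> fat B" for B x y
  proof -
    obtain x' y' where "x' \<in> B" "dist x x' \<le> 2 * R" "y' \<in> B" "dist y y' \<le> 2 * R"
      using \<open>x \<in> fat B\<close> \<open>y \<in> fat B\<close> by (auto simp: fat_def)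
    then show ?thesis
      using F(4)[OF \<open>B \<in> F\<close>, of x' y'] dist_triangle[of x y x'] dist_triangle[of x' y y']
      by (simp add: dist_commute)
  qed
  moreover have "real (card (fat ` F)) \<le> real n + (\<Sum>k=1..n. a k) / R"
    using F(1,2) card_image_le[of F fat] by linarith
  ultimately show ?thesis
    using F(1) by (intro exI[of _ "fat ` F"]) (auto simp: fat_def)
qed

text \<open>Polynomial rate \<open>\<gamma>\<close> of the Hausdorff distance to the finite trees, along powers of \<open>2\<close>.\<close>

definition approximable :: "real \<Rightarrow> bool" where
  "approximable \<gamma> \<longleftrightarrow> (\<exists>C>0. \<forall>\<^sub>F q in sequentially. \<forall>N\<ge>1. \<forall>x\<in>agg_tree a u N.
     \<exists>y\<in>agg_tree a u (2 ^ q). dist x y \<le> C * (2 ^ q) powr - \<gamma>)"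

text \<open>With \<open>n\<close> a large power of \<open>2\<close> and \<open>R\<close> a multiple of \<open>n\<close> to the power \<open>-\<gamma>\<close>, the number of sets
  \<open>n + A\<^sub>n / R\<close> is \<open>O(n)\<close>, since \<open>A\<^sub>n\<close> is at most \<open>n\<close> to the power \<open>1 - \<gamma>\<close>; and \<open>n R\<^sup>t\<close> tends to \<open>0\<close> because
  \<open>\<gamma> t > 1\<close>.\<close>

lemma small_covers:
  assumes "approximable \<gamma>" "0 < \<gamma>" "\<gamma> < \<alpha>" "1 < \<gamma> * t"
    and A: "exponent_le (\<lambda>i. \<Sum>k=1..i. a k) (1 - \<alpha>)" and "0 < \<eta>"
  shows "\<exists>F \<rho>. finite F \<and> (\<forall>B\<in>F. B \<subseteq> agg_tree_limit a u \<and> (\<forall>x\<in>B. \<forall>y\<in>B. dist x y \<le> \<rho>)) \<and>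
      agg_tree_limit a u \<subseteq> \<Union>F \<and> 0 \<le> \<rho> \<and> \<rho> \<le> \<eta> \<and> real (card F) * \<rho> powr t \<le> \<eta>"
proof -
  obtain C where C: "0 < C" and near: "\<forall>\<^sub>F q in sequentially. \<forall>N\<ge>1. \<forall>x\<in>agg_tree a u N.
     \<exists>y\<in>agg_tree a u (2 ^ q). dist x y \<le> C * (2 ^ q) powr - \<gamma>"
    using assms(1) by (auto simp: approximable_def)
  have "\<forall>\<^sub>F i in sequentially. (\<Sum>k=1..i. a k) \<le> real i powr (1 - \<alpha> + (\<alpha> - \<gamma>))"
    using A assms(3) unfolding exponent_le_def by (metis diff_gt_0_iff_gt)
  moreover have "filterlim (\<lambda>q::nat. 2 ^ q :: nat) sequentially sequentially"
    by (rule filterlim_subseq) (simp add: strict_mono_def)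
  ultimately have growth: "\<forall>\<^sub>F q in sequentially. (\<Sum>k=1..2 ^ q. a k) \<le> real (2 ^ q) powr (1 - \<alpha> + (\<alpha> - \<gamma>))"
    by (rule eventually_compose_filterlim)
  have "(\<lambda>q::nat. 5 * (C * (2 ^ q) powr - \<gamma>)) \<longlonglongrightarrow> 0"
    using assms(2) by real_asymp
  then have small: "\<forall>\<^sub>F q in sequentially. 5 * (C * (2 ^ q) powr - \<gamma>) < \<eta>"
    using \<open>0 < \<eta>\<close> by (rule order_tendstoD)
  define \<beta> where "\<beta> = \<gamma> * t - 1"
  have "0 < \<beta>" using assms(4) by (simp add: \<beta>_def)
  then have "(\<lambda>q::nat. (1 + 1 / C) * (5 * C) powr t * (2 ^ q) powr - \<beta>) \<longlonglongrightarrow> 0"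
    by real_asymp
  then have "\<forall>\<^sub>F q in sequentially. (1 + 1 / C) * (5 * C) powr t * (2 ^ q) powr - \<beta> < \<eta>"
    using \<open>0 < \<eta>\<close> by (rule order_tendstoD)
  with near growth small have "\<forall>\<^sub>F q in sequentially. (\<forall>N\<ge>1. \<forall>x\<in>agg_tree a u N.
     \<exists>y\<in>agg_tree a u (2 ^ q). dist x y \<le> C * (2 ^ q) powr - \<gamma>) \<and>
     (\<Sum>k=1..2 ^ q. a k) \<le> real (2 ^ q) powr (1 - \<alpha> + (\<alpha> - \<gamma>)) \<and> 5 * (C * (2 ^ q) powr - \<gamma>) < \<eta> \<and>
     (1 + 1 / C) * (5 * C) powr t * (2 ^ q) powr - \<beta> < \<eta>"
    by eventually_elim simp
  then obtain q where q: "\<forall>N\<ge>1. \<forall>x\<in>agg_tree a u N. \<exists>y\<in>agg_tree a u (2 ^ q). dist x y \<le> C * (2 ^ q) powr - \<gamma>"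
    "(\<Sum>k=1..2 ^ q. a k) \<le> real (2 ^ q) powr (1 - \<alpha> + (\<alpha> - \<gamma>))"
    "5 * (C * (2 ^ q) powr - \<gamma>) < \<eta>" "(1 + 1 / C) * (5 * C) powr t * (2 ^ q) powr - \<beta> < \<eta>"
    using eventually_happens'[OF sequentially_bot] by blast
  define n :: real where "n = 2 ^ q"
  define R where "R = C * n powr - \<gamma>"
  have n: "0 < n" by (simp add: n_def)
  have R: "0 < R" using C n by (simp add: R_def)
  obtain F where F: "finite F" "real (card F) \<le> real (2 ^ q) + (\<Sum>k=1..2 ^ q. a k) / R"
    "\<forall>B\<in>F. B \<subseteq> agg_tree_limit a u \<and> (\<forall>x\<in>B. \<forall>y\<in>B. dist x y \<le> 5 * R)"
    "agg_tree_limit a u \<subseteq> \<Union>F"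
    using limit_cover[of "2 ^ q" R] R q(1) by (auto simp: R_def n_def)
  have "real (card F) \<le> n + n powr (1 - \<gamma>) / R"
  proof -
    have "(\<Sum>k=1..2 ^ q. a k) / R \<le> n powr (1 - \<gamma>) / R"
      using q(2) R by (intro divide_right_mono) (auto simp: n_def)
    then show ?thesis using F(2) by (simp add: n_def)
  qed
  also have "\<dots> = (1 + 1 / C) * n"
    using n C by (simp add: R_def powr_diff powr_minus field_simps)
  finally have "real (card F) * (5 * R) powr t \<le> (1 + 1 / C) * n * (5 * R) powr t"
    by (intro mult_right_mono) auto
  also have "\<dots> = (1 + 1 / C) * (5 * C) powr t * n powr - \<beta>"
  proof -
    have "(5 * R) powr t = (5 * C) powr t * n powr (- \<gamma> * t)"
      using C n by (simp add: R_def powr_mult powr_powr mult.assoc[symmetric])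
    moreover have "n * n powr (- \<gamma> * t) = n powr - \<beta>"
      using n by (simp add: \<beta>_def powr_add powr_diff powr_minus field_simps)
    ultimately show ?thesis by (simp add: mult.assoc mult.left_commute)
  qed
  finally have "real (card F) * (5 * R) powr t \<le> \<eta>" using q(4) by (simp add: n_def)
  then show ?thesis
    using F(1,3,4) R q(3) by (intro exI[of _ F] exI[of _ "5 * R"]) (auto simp: R_def n_def)
qed

lemma hausdorff_measure_0_if_approximable:
  assumes "approximable \<gamma>" "0 < \<gamma>" "\<gamma> < \<alpha>" "1 < \<gamma> * t"
    and "exponent_le (\<lambda>i. \<Sum>k=1..i. a k) (1 - \<alpha>)"
  shows "hausdorff_measure (agg_tree_limit a u) dist t = 0"
proof (rule hausdorff_measure_eq_0I)
  show "0 < t" using assms(2,4) by (smt (verit) zero_less_mult_pos)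
qed (rule small_covers[OF assms])

text \<open>Totally bounded and closed in a complete space. The proof applies \<open>small_covers\<close> with an
  arbitrary exponent above \<open>1 / \<gamma>\<close>, say \<open>2 / \<gamma>\<close>.\<close>

lemma compact_if_approximable:
  assumes "approximable \<gamma>" "0 < \<gamma>" "\<gamma> < \<alpha>" "exponent_le (\<lambda>i. \<Sum>k=1..i. a k) (1 - \<alpha>)"
  shows "compact (agg_tree_limit a u)"
proof -
  have "\<exists>k. finite k \<and> agg_tree_limit a u \<subseteq> (\<Union>x\<in>k. ball x e)" if "0 < e" for e
  proof -
    have "1 < \<gamma> * (2 / \<gamma>)" "0 < e / 2" using assms(2) that by simp_all
    from small_covers[OF assms(1-3) this(1) assms(4) this(2)]
    obtain F \<rho> where F: "finite F" "\<forall>B\<in>F. B \<subseteq> agg_tree_limit a u \<and> (\<forall>x\<in>B. \<forall>y\<in>B. dist x y \<le> \<rho>)"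
      "agg_tree_limit a u \<subseteq> \<Union>F" "\<rho> \<le> e / 2" by (elim exE conjE) (rule that)
    define c where "c = (\<lambda>B::l1 set. SOME x. x \<in> B)"
    have "x \<in> (\<Union>x\<in>c ` F. ball x e)" if x: "x \<in> agg_tree_limit a u" for x
    proof -
      obtain B where B: "B \<in> F" "x \<in> B" using F(3) x by blast
      then have "c B \<in> B" unfolding c_def by (intro someI[of "\<lambda>x. x \<in> B"])
      then have "dist (c B) x \<le> \<rho>" using F(2) B by blast
      then have "dist (c B) x < e" using F(4) \<open>0 < e\<close> by linarith
      then show ?thesis using B by auto
    qed
    then show ?thesis using F(1) by (intro exI[of _ "c ` F"]) auto
  qed
  moreover have "closed (agg_tree_limit a u)" by (simp add: agg_tree_limit_def)
  ultimately show ?thesis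
    unfolding compact_eq_totally_bounded using complete_eq_closed[THEN iffD2] by blast
qed

text \<open>The distance of a point to its truncation at \<open>2\<^sup>q\<close> is a sum of dyadic blocks of coordinates, bounded
  by a geometric series.\<close>

lemma approximable_if_block_sums:
  assumes \<gamma>: "0 < \<gamma>"
    and block: "\<forall>\<^sub>F n in sequentially. \<forall>N\<ge>1. \<forall>x\<in>agg_tree a u N.
      (\<Sum>i\<in>{n..<2 * n}. coord x i) \<le> real n powr - \<gamma>"
  shows "approximable \<gamma>"
proof -
  define \<theta> :: real where "\<theta> = 2 powr - \<gamma>"
  have \<theta>: "0 < \<theta>" "\<theta> < 1" using \<gamma> by (simp_all add: \<theta>_def powr_less_one)
  have \<theta>q: "(2 ^ q) powr - \<gamma> = \<theta> ^ q" for q :: nat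
    by (simp add: \<theta>_def powr_realpow[symmetric] powr_powr powr_power mult.commute)
  obtain n0 where n0: "\<And>n N x. \<lbrakk>n \<ge> n0; N \<ge> 1; x \<in> agg_tree a u N\<rbrakk> \<Longrightarrow>
      (\<Sum>i\<in>{n..<2 * n}. coord x i) \<le> real n powr - \<gamma>"
    using block by (auto simp: eventually_sequentially)
  have "\<exists>y\<in>agg_tree a u (2 ^ q). dist x y \<le> 1 / (1 - \<theta>) * (2 ^ q) powr - \<gamma>"
    if q: "q \<ge> n0" and x: "N \<ge> 1" "x \<in> agg_tree a u N" for q N x
  proof -
    have nn: "0 \<le> coord x i" for i using nonneg_agg_tree[OF x(2,1)] by (simp add: nonneg_def)
    have dyadic: "(\<Sum>i\<in>{2 ^ q..<2 ^ (q + m)}. coord x i) \<le> (\<Sum>j<m. \<theta> ^ (q + j))" for m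
    proof (induction m)
      case (Suc m)
      have "{2 ^ q..<2 ^ (q + Suc m)} = {2 ^ q..<2 ^ (q + m)} \<union> {2 ^ (q + m)..<2 * 2 ^ (q + m) :: nat}"
        by (auto simp: power_increasing intro: order_trans[of _ "2 ^ (q + m)"])
          (meson less_le_trans not_less one_le_numeral power_increasing le_add1)+
      then have "(\<Sum>i\<in>{2 ^ q..<2 ^ (q + Suc m)}. coord x i) =
          (\<Sum>i\<in>{2 ^ q..<2 ^ (q + m)}. coord x i) + (\<Sum>i\<in>{2 ^ (q + m)..<2 * 2 ^ (q + m)}. coord x i)"
        by (simp only:) (intro sum.union_disjoint; auto)
      also have "(\<Sum>i\<in>{2 ^ (q + m)..<2 * 2 ^ (q + m)}. coord x i) \<le> real (2 ^ (q + m)) powr - \<gamma>"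
      proof (rule n0[OF _ x])
        have "q + m < 2 ^ (q + m)" by (rule less_exp)
        then show "n0 \<le> 2 ^ (q + m)" using q by linarith
      qed
      also have "real (2 ^ (q + m)) powr - \<gamma> = \<theta> ^ (q + m)" using \<theta>q[of "q + m"] by simp
      finally show ?case using Suc.IH by simp
    qed simp
    have tail: "(\<Sum>i\<in>{2 ^ q..<Q}. coord x i) \<le> 1 / (1 - \<theta>) * (2 ^ q) powr - \<gamma>" for Q
    proof -
      have "Q < 2 ^ Q" by (rule less_exp)
      also have "(2::nat) ^ Q \<le> 2 ^ (q + Q)" by (intro power_increasing) auto
      finally have "(\<Sum>i\<in>{2 ^ q..<Q}. coord x i) \<le> (\<Sum>i\<in>{2 ^ q..<2 ^ (q + Q)}. coord x i)"
        by (intro sum_mono2 nn) auto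
      also have "\<dots> \<le> (\<Sum>j<Q. \<theta> ^ (q + j))" by (rule dyadic)
      also have "\<dots> = \<theta> ^ q * (\<Sum>j<Q. \<theta> ^ j)" by (simp add: power_add sum_distrib_left)
      also have "\<dots> \<le> \<theta> ^ q * (\<Sum>j. \<theta> ^ j)"
        using \<theta> by (intro mult_left_mono sum_le_suminf) auto
      also have "\<dots> = 1 / (1 - \<theta>) * (2 ^ q) powr - \<gamma>"
        using \<theta> by (simp add: suminf_geometric \<theta>q)
      finally show ?thesis .
    qed
    obtain y where "y \<in> agg_tree a u (2 ^ q)" "\<forall>i. coord y i = (if i < 2 ^ q then coord x i else 0)"
      using truncation_in_agg_tree[OF x(2,1), of "2 ^ q"] by auto
    then show ?thesis using dist_truncation_le[OF x(2,1) _ tail] by blast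
  qed
  then have "\<forall>\<^sub>F q in sequentially. \<forall>N\<ge>1. \<forall>x\<in>agg_tree a u N.
      \<exists>y\<in>agg_tree a u (2 ^ q). dist x y \<le> 1 / (1 - \<theta>) * (2 ^ q) powr - \<gamma>"
    unfolding eventually_sequentially by (intro exI[of _ n0] allI impI ballI)
  moreover have "0 < 1 / (1 - \<theta>)" using \<theta> by simp
  ultimately show ?thesis unfolding approximable_def by blast
qed

end

section \<open>Almost sure approximation by the finite trees\<close>

lemma one_minus_power_le_exp:
  fixes q :: real
  assumes "0 \<le> q" "q \<le> 1"
  shows "(1 - q) ^ m \<le> exp (- (q * real m))"
proof -
  have "(1 - q) ^ m \<le> exp (- q) ^ m"
    using exp_ge_add_one_self[of "- q"] assms by (intro power_mono) auto
  also have "\<dots> = exp (- (q * real m))" by (simp add: exp_of_nat_mult[symmetric] mult.commute)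
  finally show ?thesis .
qed

context uniform_aggregation
begin

lemma A_ratio_ge:
  assumes "exponent_le A (1 - \<alpha>)" "exponent_ge A (1 - \<alpha>)" and e: "0 < e"
  shows "\<forall>\<^sub>F n in sequentially. real n powr (- 3 * e) \<le> A n / A (2 * n)"
proof -
  have "\<forall>\<^sub>F n in sequentially. A n \<ge> real n powr (1 - \<alpha> - e)"
    using assms by (simp add: exponent_ge_def)
  moreover have "\<forall>\<^sub>F n in sequentially. A (2 * n) \<le> real (2 * n) powr (1 - \<alpha> + e)"
  proof -
    have "\<forall>\<^sub>F n in sequentially. A n \<le> real n powr (1 - \<alpha> + e)"
      using assms by (simp add: exponent_le_def)
    moreover have "filterlim (\<lambda>n::nat. 2 * n) sequentially sequentially"
      by (rule filterlim_subseq) (simp add: strict_mono_def)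
    ultimately show ?thesis by (rule eventually_compose_filterlim)
  qed
  moreover have "\<forall>\<^sub>F n::nat in sequentially. 2 powr (1 - \<alpha> + e) \<le> real n powr e"
    using e by real_asymp
  moreover have "\<forall>\<^sub>F n::nat in sequentially. 1 \<le> n" by (rule eventually_ge_at_top)
  ultimately show ?thesis
  proof eventually_elim
    case (elim n)
    define x where "x = real n"
    have x: "0 < x" using elim(4) by (simp add: x_def)
    have "x powr (- 3 * e) * A (2 * n) \<le> x powr (- 3 * e) * (2 powr (1 - \<alpha> + e) * x powr (1 - \<alpha> + e))"
      using elim(2) by (intro mult_left_mono) (simp_all add: powr_mult x_def)
    also have "\<dots> \<le> x powr (- 3 * e) * (x powr e * x powr (1 - \<alpha> + e))"
      using elim(3) by (intro mult_left_mono mult_right_mono) (simp_all add: x_def)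
    also have "\<dots> = x powr (1 - \<alpha> - e)" using x by (simp add: powr_add[symmetric])
    also have "\<dots> \<le> A n" using elim(1) by (simp add: x_def)
    finally show ?case using A_pos[of "2 * n"] elim(4) by (simp add: x_def pos_le_divide_eq)
  qed
qed

text \<open>The mean number of turns is at most about \<open>n\<close> to the power \<open>3 e\<close>; allowing \<open>n\<close> to the power \<open>6 e\<close>
  makes the probability of an excess smaller than any power of \<open>n\<close>, so that Borel--Cantelli applies
  even after a union over \<open>n \<le> k < 2 n\<close>.\<close>

lemma AE_turns_small:
  assumes "exponent_le A (1 - \<alpha>)" "exponent_ge A (1 - \<alpha>)" and e: "0 < e"
  defines "b \<equiv> \<lambda>n::nat. nat \<lceil>real n powr (6 * e)\<rceil>"
  shows "AE w in M. \<forall>\<^sub>F n in sequentially. \<forall>k. n \<le> k \<longrightarrow> k < 2 * n \<longrightarrow> turns n (U k w) \<le> b n"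
proof -
  define E where "E = (\<lambda>n. \<Union>k\<in>{n..<2*n} \<inter> {1..}. {w \<in> space M. b n \<le> turns n (U k w)})"
  have ev: "{w \<in> space M. m \<le> turns n (U k w)} \<in> sets M" if "k \<in> {n..<2*n} \<inter> {1..}" for m n k
  proof -
    have [measurable]: "U k \<in> borel_measurable M" using that by simp
    show ?thesis by measurable
  qed
  have E: "E n \<in> sets M" for n unfolding E_def using ev by (intro sets.finite_UN) auto
  have "\<forall>\<^sub>F n in sequentially. norm (prob (E n)) \<le> inverse (real n ^ 2)"
  proof -
    have "\<forall>\<^sub>F n in sequentially. real n * exp (- (real n powr (3 * e))) \<le> inverse (real n ^ 2)"
      using e by real_asymp
    moreover have "\<forall>\<^sub>F n::nat in sequentially. 1 \<le> n" by (rule eventually_ge_at_top)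
    ultimately show ?thesis using A_ratio_ge[OF assms(1-3)]
    proof eventually_elim
      case (elim n)
      define q where "q = A n / A (2 * n)"
      have q: "0 \<le> q" "q \<le> 1"
        using A_pos[of n] A_pos[of "2 * n"] A_mono[of n "2 * n"] elim(2) by (simp_all add: q_def)
      have "real n powr (3 * e) = real n powr (- 3 * e) * real n powr (6 * e)"
        by (simp add: powr_add[symmetric])
      also have "\<dots> \<le> q * real (b n)"
        using elim(3) q(1) unfolding b_def q_def
        by (intro mult_mono real_nat_ceiling_ge) auto
      finally have qb: "real n powr (3 * e) \<le> q * real (b n)" .
      have "prob (E n) \<le> (\<Sum>k\<in>{n..<2*n} \<inter> {1..}. prob {w \<in> space M. b n \<le> turns n (U k w)})"
        unfolding E_def using ev by (intro finite_measure_subadditive_finite) auto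
      also have "\<dots> \<le> (\<Sum>k\<in>{n..<2*n} \<inter> {1..}. exp (- (real n powr (3 * e))))"
      proof (rule sum_mono)
        fix k assume k: "k \<in> {n..<2*n} \<inter> {1..}"
        have "prob {w \<in> space M. b n \<le> turns n (U k w)} \<le> (1 - q) ^ b n"
          unfolding q_def using k elim(2) by (intro prob_turns_ge) auto
        also have "\<dots> \<le> exp (- (q * real (b n)))" using q by (rule one_minus_power_le_exp)
        also have "\<dots> \<le> exp (- (real n powr (3 * e)))" using qb by simp
        finally show "prob {w \<in> space M. b n \<le> turns n (U k w)} \<le> exp (- (real n powr (3 * e)))" .
      qed
      also have "\<dots> \<le> real n * exp (- (real n powr (3 * e)))"
      proof -
        have "card ({n..<2*n} \<inter> {1..}) \<le> card {n..<2*n}" by (intro card_mono) auto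
        then show ?thesis by simp
      qed
      also note elim(1)
      finally show ?case by simp
    qed
  qed
  then have "summable (\<lambda>n. prob (E n))"
    by (rule summable_comparison_test_ev) (rule inverse_power_summable, simp)
  then have "AE w in M. \<forall>\<^sub>F n in sequentially. w \<in> space M - E n"
    using E by (intro borel_cantelli_AE1) (auto simp: less_top[symmetric])
  then show ?thesis
  proof eventually_elim
    case (elim w)
    have "\<forall>\<^sub>F n::nat in sequentially. 1 \<le> n" by (rule eventually_ge_at_top)
    with elim show ?case
    proof eventually_elim
      case (elim n)
      show ?case
      proof (intro allI impI)
        fix k assume "n \<le> k" "k < 2 * n"
        then have "\<not> b n \<le> turns n (U k w)" using elim by (auto simp: E_def)
        then show "turns n (U k w) \<le> b n" by simp
      qed
    qed
  qed
qed

lemma AE_approximable: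
  assumes "exponent_le a (- \<alpha>)" "exponent_le A (1 - \<alpha>)" "exponent_ge A (1 - \<alpha>)"
    and \<gamma>: "0 < \<gamma>" "\<gamma> < \<alpha>"
  shows "AE w in M. gluing_points.approximable a (\<lambda>k. U k w) \<gamma>"
proof -
  \<comment> \<open>the losses are \<open>6 e\<close> from the number of turns and \<open>e\<close> from the branch lengths; the
    remaining \<open>e\<close> absorbs constants\<close>
  define e where "e = (\<alpha> - \<gamma>) / 8"
  have e: "0 < e" "\<alpha> = \<gamma> + 8 * e" using \<gamma> by (simp_all add: e_def field_simps)
  define b where "b = (\<lambda>n::nat. nat \<lceil>real n powr (6 * e)\<rceil>)"
  have a_le: "\<forall>\<^sub>F n in sequentially. \<forall>i>n. a i \<le> real n powr (- \<alpha> + e)"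
  proof -
    have "\<forall>\<^sub>F i in sequentially. a i \<le> real i powr (- \<alpha> + e)"
      using assms(1) e(1) by (simp add: exponent_le_def)
    then obtain n0 where n0: "\<And>i. i \<ge> n0 \<Longrightarrow> a i \<le> real i powr (- \<alpha> + e)"
      by (auto simp: eventually_sequentially)
    have "a i \<le> real n powr (- \<alpha> + e)" if "n \<ge> max 1 n0" "i > n" for n i
    proof -
      have "a i \<le> real i powr (- \<alpha> + e)" using that by (intro n0) auto
      also have "\<dots> \<le> real n powr (- \<alpha> + e)" using that e \<gamma>(1) by (intro powr_mono2') auto
      finally show ?thesis .
    qed
    then show ?thesis unfolding eventually_sequentially by blast
  qed
  have small: "\<forall>\<^sub>F n::nat in sequentially. (real n powr (6 * e) + 2) * real n powr (- \<alpha> + e) \<le> real n powr - \<gamma>"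
    unfolding e(2) using e(1) by real_asymp
  show ?thesis
    using AE_turns_small[OF assms(2,3) e(1)] AE_gluing_points
  proof eventually_elim
    case (elim w)
    interpret gluing_points a "\<lambda>k. U k w" by (rule elim)
    have "\<forall>\<^sub>F n::nat in sequentially. 1 \<le> n" by (rule eventually_ge_at_top)
    with elim(1) a_le small have "\<forall>\<^sub>F n in sequentially. \<forall>N\<ge>1. \<forall>x\<in>agg_tree a (\<lambda>k. U k w) N.
        (\<Sum>i\<in>{n..<2 * n}. coord x i) \<le> real n powr - \<gamma>"
    proof eventually_elim
      case (elim n)
      show ?case
      proof (intro allI impI ballI)
        fix N x assume x: "1 \<le> N" "x \<in> agg_tree a (\<lambda>k. U k w) N"
        have "(\<Sum>i\<in>{n..<2 * n}. coord x i) \<le> (real (b n) + 1) * real n powr (- \<alpha> + e)"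
          using elim by (intro block_sum_le[OF x(2,1)]) (auto simp: b_def)
        also have "\<dots> \<le> (real n powr (6 * e) + 2) * real n powr (- \<alpha> + e)"
        proof (rule mult_right_mono)
          have "real (b n) = of_int \<lceil>real n powr (6 * e)\<rceil>"
            by (simp add: b_def)
          then show "real (b n) + 1 \<le> real n powr (6 * e) + 2" by linarith
        qed simp
        also note elim(3)
        finally show "(\<Sum>i\<in>{n..<2 * n}. coord x i) \<le> real n powr - \<gamma>" .
      qed
    qed
    then show ?case by (rule approximable_if_block_sums[OF \<gamma>(1)])
  qed
qed

end

section \<open>Energy of the gluing points\<close>

text \<open>The index from which gluing points resolve the distance \<open>2\<close> to the power \<open>-p\<close>.\<close>

definition scale :: "real \<Rightarrow> nat \<Rightarrow> nat" where
  "scale s p = nat \<lceil>(2 powr s) ^ p\<rceil>"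

lemma scale_bounds:
  assumes "0 < s"
  shows "(2 powr s) ^ p \<le> real (scale s p)" "real (scale s p) \<le> 2 * (2 powr s) ^ p"
    "1 \<le> scale s p"
proof -
  have x: "1 \<le> (2 powr s) ^ p" using assms by (intro one_le_power) (simp add: ge_one_powr_ge_zero)
  then show 1: "(2 powr s) ^ p \<le> real (scale s p)" unfolding scale_def by linarith
  have "real (scale s p) \<le> (2 powr s) ^ p + 1" unfolding scale_def using x by linarith
  then show "real (scale s p) \<le> 2 * (2 powr s) ^ p" using x by linarith
  show "1 \<le> scale s p" using x 1 by linarith
qed

lemma scale_mono: "\<lbrakk>0 < s; p \<le> P\<rbrakk> \<Longrightarrow> scale s p \<le> scale s P"
  unfolding scale_def by (intro nat_mono ceiling_mono power_increasing) (simp_all add: ge_one_powr_ge_zero)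

text \<open>Fatou: the lower limit of the \<open>X n\<close> has a finite expectation.\<close>

lemma (in prob_space) AE_frequently_bounded:
  fixes X :: "nat \<Rightarrow> 'a \<Rightarrow> real"
  assumes int: "\<And>n. integrable M (X n)" and nn: "\<And>n w. 0 \<le> X n w" and B: "\<And>n. expectation (X n) \<le> B"
  shows "AE w in M. \<exists>K. \<exists>\<^sub>F n in sequentially. X n w \<le> K"
proof -
  have [measurable]: "X n \<in> borel_measurable M" for n using int by auto
  have "(\<integral>\<^sup>+w. liminf (\<lambda>n. ennreal (X n w)) \<partial>M) \<le> liminf (\<lambda>n. \<integral>\<^sup>+w. ennreal (X n w) \<partial>M)"
    by (rule nn_integral_liminf) measurable
  also have "\<dots> \<le> liminf (\<lambda>n::nat. ennreal B)"
  proof (intro Liminf_mono always_eventually allI)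
    fix n
    have "(\<integral>\<^sup>+w. ennreal (X n w) \<partial>M) = ennreal (expectation (X n))"
      using int nn by (intro nn_integral_eq_integral) auto
    then show "(\<integral>\<^sup>+w. ennreal (X n w) \<partial>M) \<le> ennreal B" using B by (simp add: ennreal_leI)
  qed
  also have "\<dots> = ennreal B" by (simp add: Liminf_const)
  finally have "(\<integral>\<^sup>+w. liminf (\<lambda>n. ennreal (X n w)) \<partial>M) \<noteq> \<infinity>"
    by (auto simp: top_unique)
  then have "AE w in M. liminf (\<lambda>n. ennreal (X n w)) \<noteq> \<infinity>"
    by (intro nn_integral_PInf_AE) measurable
  then show ?thesis
  proof eventually_elim
    case (elim w)
    define L where "L = enn2real (liminf (\<lambda>n. ennreal (X n w)))"
    have L: "liminf (\<lambda>n. ennreal (X n w)) = ennreal L" "0 \<le> L"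
      using elim by (simp_all add: L_def less_top)
    have "\<exists>\<^sub>F n in sequentially. X n w \<le> L + 1"
    proof (rule ccontr)
      assume "\<not> (\<exists>\<^sub>F n in sequentially. X n w \<le> L + 1)"
      then have "\<forall>\<^sub>F n in sequentially. \<not> X n w \<le> L + 1" by (simp add: frequently_def)
      then have "\<forall>\<^sub>F n in sequentially. ennreal (L + 1) \<le> ennreal (X n w)"
        by eventually_elim (auto intro: ennreal_leI)
      then have "ennreal (L + 1) \<le> ennreal L" using L Liminf_bounded by metis
      then show False using L(2) by simp
    qed
    then show ?case by blast
  qed
qed

context uniform_aggregation
begin

lemma A_inverse_bounds:
  assumes "exponent_ge A (1 - \<alpha>)" "\<alpha> < \<gamma>" "0 < \<alpha>"
  shows "\<exists>C>0. \<forall>N\<ge>1. (\<Sum>m=1..<N. 1 / A m) \<le> C * real N powr \<gamma> \<and> 1 / A N \<le> C * real N powr (\<gamma> - 1)"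
proof -
  define e where "e = (\<gamma> - \<alpha>) / 2"
  have e: "0 < e" "\<gamma> = \<alpha> + 2 * e" using assms(2) by (simp_all add: e_def field_simps)
  have "\<forall>\<^sub>F n in sequentially. A n \<ge> real n powr (1 - \<alpha> - e)"
    using assms e by (simp add: exponent_ge_def)
  then obtain n0 where n0: "\<And>n. n \<ge> n0 \<Longrightarrow> A n \<ge> real n powr (1 - \<alpha> - e)"
    by (auto simp: eventually_sequentially)
  define f where "f = (\<lambda>n. real n powr (1 - \<alpha> - e) / A n)"
  define C where "C = Max (insert 1 (f ` {1..n0}))"
  have C1: "1 \<le> C" by (simp add: C_def)
  have f: "f n \<le> C" if "1 \<le> n" for n
  proof (cases "n \<le> n0")
    case True
    then show ?thesis unfolding C_def using that by (intro Max_ge) auto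
  next
    case False
    then have "f n \<le> 1" using n0[of n] A_pos[OF that] by (simp add: f_def)
    then show ?thesis using C1 by simp
  qed
  have inv: "1 / A n \<le> C * real n powr (\<alpha> + e - 1)" if "1 \<le> n" for n
  proof -
    have "1 / A n = f n * real n powr (\<alpha> + e - 1)"
      using that by (simp add: f_def powr_add[symmetric])
    then show ?thesis using f[OF that] by (simp add: mult_right_mono)
  qed
  have summ: "summable (\<lambda>n. real n powr (- 1 - e))"
    using e by (simp add: summable_real_powr_iff)
  define Z where "Z = (\<Sum>n. real n powr (- 1 - e))"
  have Z: "0 \<le> Z" unfolding Z_def by (intro suminf_nonneg summ) simp
  show ?thesis
  proof (intro exI[of _ "C * (1 + Z)"] conjI allI impI)
    show "0 < C * (1 + Z)" using C1 Z by (intro mult_pos_pos) auto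
    fix N :: nat assume N: "1 \<le> N"
    \<comment> \<open>splitting off \<open>m powr \<gamma> \<le> N powr \<gamma>\<close> leaves the terms of a convergent series\<close>
    have "(\<Sum>m=1..<N. 1 / A m) \<le> (\<Sum>m=1..<N. C * real N powr \<gamma> * real m powr (- 1 - e))"
    proof (rule sum_mono)
      fix m assume m: "m \<in> {1..<N}"
      have "1 / A m \<le> C * real m powr (\<alpha> + e - 1)" using m by (intro inv) auto
      also have "real m powr (\<alpha> + e - 1) = real m powr \<gamma> * real m powr (- 1 - e)"
        by (simp add: powr_add[symmetric] e(2) algebra_simps)
      also have "\<dots> \<le> real N powr \<gamma> * real m powr (- 1 - e)"
        using m assms by (intro mult_right_mono powr_mono2) auto
      finally show "1 / A m \<le> C * real N powr \<gamma> * real m powr (- 1 - e)" using C1 by simp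
    qed
    also have "\<dots> = C * real N powr \<gamma> * (\<Sum>m=1..<N. real m powr (- 1 - e))"
      by (simp add: sum_distrib_left)
    also have "\<dots> \<le> C * real N powr \<gamma> * Z"
      unfolding Z_def using C1 by (intro mult_left_mono sum_le_suminf summ) auto
    also have "\<dots> \<le> C * (1 + Z) * real N powr \<gamma>"
      using C1 by (simp add: algebra_simps)
    finally show "(\<Sum>m=1..<N. 1 / A m) \<le> C * (1 + Z) * real N powr \<gamma>" .
    have "1 / A N \<le> C * real N powr (\<alpha> + e - 1)" using N by (rule inv)
    also have "\<dots> \<le> C * real N powr (\<gamma> - 1)"
      using N C1 e by (intro mult_left_mono powr_mono) auto
    also have "\<dots> \<le> C * (1 + Z) * real N powr (\<gamma> - 1)"
      using C1 Z by (intro mult_right_mono) auto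
    finally show "1 / A N \<le> C * (1 + Z) * real N powr (\<gamma> - 1)" .
  qed
qed

lemma prob_close_dyadic:
  assumes "exponent_ge A (1 - \<alpha>)" "0 < \<alpha>" and s: "0 < s" "s < 1 / \<alpha>"
  shows "\<exists>D>0. \<forall>p l k. scale s p \<le> l \<longrightarrow> l < k \<longrightarrow>
    prob {w \<in> space M. dist (U k w) (U l w) \<le> (1/2) ^ p} \<le> D / (2 powr s) ^ p"
proof -
  define \<gamma> where "\<gamma> = 1 / s"
  have \<gamma>: "\<alpha> < \<gamma>" "0 < \<gamma>" using s assms(2) by (simp_all add: \<gamma>_def field_simps)
  obtain C where C: "0 < C" and
    bnd: "\<And>N. 1 \<le> N \<Longrightarrow> (\<Sum>m=1..<N. 1 / A m) \<le> C * real N powr \<gamma>"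
      "\<And>N. 1 \<le> N \<Longrightarrow> 1 / A N \<le> C * real N powr (\<gamma> - 1)"
    using A_inverse_bounds[OF assms(1) \<gamma>(1) assms(2)] by blast
  define K where "K = 2 * C * 2 powr \<gamma>"
  define D where "D = (3 * exp K + 4) * (C * 2 powr \<gamma>)"
  have "prob {w \<in> space M. dist (U k w) (U l w) \<le> (1/2) ^ p} \<le> D / (2 powr s) ^ p"
    if "scale s p \<le> l" "l < k" for p l k
  proof -
    define N r where "N = scale s p" and "r = (1/2 :: real) ^ p"
    have N: "(2 powr s) ^ p \<le> real N" "real N \<le> 2 * (2 powr s) ^ p" "1 \<le> N"
      unfolding N_def by (rule scale_bounds[OF s(1)])+
    have r: "0 < r" by (simp add: r_def)
    have rN: "r * real N powr \<gamma> \<le> 2 powr \<gamma>"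
    proof -
      have "real N powr \<gamma> \<le> (2 * (2 powr s) ^ p) powr \<gamma>" using N \<gamma> by (intro powr_mono2) auto
      also have "\<dots> = 2 powr \<gamma> * 2 ^ p"
      proof -
        have "((2 powr s) ^ p) powr \<gamma> = 2 powr (s * real p * \<gamma>)"
          by (simp add: powr_power powr_powr mult_ac)
        also have "s * real p * \<gamma> = real p" using s by (simp add: \<gamma>_def)
        finally show ?thesis by (simp add: powr_mult powr_realpow)
      qed
      finally have "r * real N powr \<gamma> \<le> r * (2 powr \<gamma> * 2 ^ p)" using r by (intro mult_left_mono) auto
      then show ?thesis by (simp add: r_def power_one_over field_simps)
    qed
    have "2 * r * (\<Sum>m=1..<N. 1 / A m) \<le> K"
    proof -
      have "2 * r * (\<Sum>m=1..<N. 1 / A m) \<le> 2 * r * (C * real N powr \<gamma>)"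
        using r bnd(1)[OF N(3)] by (intro mult_left_mono) auto
      also have "\<dots> = 2 * C * (r * real N powr \<gamma>)" by simp
      also have "\<dots> \<le> K" unfolding K_def using C rN by (intro mult_left_mono) auto
      finally show ?thesis .
    qed
    then have "prob {w \<in> space M. dist (U k w) (U l w) \<le> r} \<le> (3 * exp K + 4) * r / A N"
      using that r N(3) by (intro prob_close) (auto simp: N_def)
    also have "\<dots> = (3 * exp K + 4) * r * (1 / A N)" by simp
    also have "\<dots> \<le> (3 * exp K + 4) * r * (C * real N powr (\<gamma> - 1))"
      using r bnd(2)[OF N(3)] by (intro mult_left_mono mult_nonneg_nonneg add_nonneg_nonneg) auto
    also have "\<dots> = (3 * exp K + 4) * C * (r * real N powr \<gamma>) / real N"
      using N(3) by (simp add: powr_diff)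
    also have "\<dots> \<le> D / real N"
      unfolding D_def using C rN N(3)
      by (intro divide_right_mono) (auto simp: mult.assoc intro!: mult_left_mono add_nonneg_nonneg)
    also have "\<dots> \<le> D / (2 powr s) ^ p"
      using N C by (intro divide_left_mono mult_pos_pos) (auto simp: D_def intro!: mult_nonneg_nonneg add_nonneg_nonneg)
    finally show ?thesis by (simp add: r_def)
  qed
  moreover have "0 < D" using C by (simp add: D_def add_pos_pos)
  ultimately show ?thesis by blast
qed

definition energy :: "real \<Rightarrow> nat set \<Rightarrow> nat \<Rightarrow> 'w \<Rightarrow> real" where
  "energy s I P w = (\<Sum>k\<in>I. \<Sum>l\<in>I. riesz s P (U k w) (U l w))"

lemma expectation_energy:
  assumes "finite I" "\<And>k. k \<in> I \<Longrightarrow> 1 \<le> k"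
  shows "integrable M (energy s I P)"
    and "expectation (energy s I P) = (\<Sum>p\<le>P. (2 powr s) ^ p *
      (\<Sum>k\<in>I. \<Sum>l\<in>I. prob {w \<in> space M. dist (U k w) (U l w) \<le> (1/2) ^ p}))"
proof -
  let ?E = "\<lambda>p k l. {w \<in> space M. dist (U k w) (U l w) \<le> (1/2) ^ p}"
  let ?g = "\<lambda>w. \<Sum>k\<in>I. \<Sum>l\<in>I. \<Sum>p\<le>P. (2 powr s) ^ p * indicator (?E p k l) w"
  have ev: "?E p k l \<in> sets M" if "k \<in> I" "l \<in> I" for p k l
    using that assms(2) by (intro events_close) auto
  have eq: "energy s I P w = ?g w" if "w \<in> space M" for w
    unfolding energy_def riesz_def using that by (intro sum.cong refl) (auto simp: indicator_def)
  have int: "integrable M (\<lambda>w. (2 powr s) ^ p * indicator (?E p k l) w)" if "k \<in> I" "l \<in> I" for p k l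
    using ev[OF that] by (intro integrable_mult_right integrable_real_indicator) (auto simp: less_top[symmetric])
  then have "integrable M ?g" by (intro Bochner_Integration.integrable_sum)
  then show "integrable M (energy s I P)"
    by (subst Bochner_Integration.integrable_cong[OF refl eq])
  have "expectation (energy s I P) = expectation ?g" by (intro Bochner_Integration.integral_cong refl eq)
  also have "\<dots> = (\<Sum>k\<in>I. \<Sum>l\<in>I. \<Sum>p\<le>P. (2 powr s) ^ p * prob (?E p k l))"
  proof -
    define h where "h = (\<lambda>p k l w. (2 powr s) ^ p * indicator (?E p k l) w :: real)"
    have h: "integrable M (h p k l)" "expectation (h p k l) = (2 powr s) ^ p * prob (?E p k l)"
      if "k \<in> I" "l \<in> I" for k l p
      using int[OF that] ev[OF that] unfolding h_def by (simp_all add: Int_absorb1 sets.sets_into_space)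
    have "expectation (\<lambda>w. \<Sum>k\<in>I. \<Sum>l\<in>I. \<Sum>p\<le>P. h p k l w) =
        (\<Sum>k\<in>I. \<Sum>l\<in>I. \<Sum>p\<le>P. expectation (h p k l))"
      using h(1) by (simp add: Bochner_Integration.integral_sum Bochner_Integration.integrable_sum)
    then show ?thesis using h(2) by (simp add: h_def)
  qed
  also have "\<dots> = (\<Sum>k\<in>I. \<Sum>p\<le>P. \<Sum>l\<in>I. (2 powr s) ^ p * prob (?E p k l))"
    by (intro sum.cong refl sum.swap)
  also have "\<dots> = (\<Sum>p\<le>P. \<Sum>k\<in>I. \<Sum>l\<in>I. (2 powr s) ^ p * prob (?E p k l))"
    by (rule sum.swap)
  finally show "expectation (energy s I P) = (\<Sum>p\<le>P. (2 powr s) ^ p *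
      (\<Sum>k\<in>I. \<Sum>l\<in>I. prob (?E p k l)))" by (simp add: sum_distrib_left)
qed

text \<open>Off the diagonal the kernel contributes a geometric series of ratio \<open>2\<close> to the power \<open>s - s'\<close>. The
  diagonal contributes \<open>n\<close> times the same powers of \<open>2\<^sup>s\<close>, and \<open>n = scale s' P\<close> is large enough for this
  to be of the same order: this is what fixes the relation between \<open>n\<close> and the truncation level \<open>P\<close>.\<close>

lemma expectation_energy_le:
  assumes "exponent_ge A (1 - \<alpha>)" "0 < \<alpha>" and s: "0 < s" "s < s'" "s' < 1 / \<alpha>"
  shows "\<exists>B. \<forall>P. expectation (energy s {scale s' P..<2 * scale s' P} P) \<le> B * (real (scale s' P))\<^sup>2"
proof -
  obtain D where D: "0 < D" and close: "\<And>p l k. \<lbrakk>scale s' p \<le> l; l < k\<rbrakk> \<Longrightarrow>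
      prob {w \<in> space M. dist (U k w) (U l w) \<le> (1/2) ^ p} \<le> D / (2 powr s') ^ p"
    using prob_close_dyadic[OF assms(1,2), of s'] s by auto
  define \<theta> :: real where "\<theta> = 2 powr s / 2 powr s'"
  have \<theta>: "0 \<le> \<theta>" "\<theta> < 1" using s by (simp_all add: \<theta>_def)
  have "expectation (energy s {scale s' P..<2 * scale s' P} P) \<le> (1 + D) / (1 - \<theta>) * (real (scale s' P))\<^sup>2" for P
  proof -
    define n where "n = scale s' P"
    define I where "I = {n..<2 * n}"
    have n: "1 \<le> n" "(2 powr s') ^ P \<le> real n" using scale_bounds[of s' P] s by (simp_all add: n_def)
    let ?pr = "\<lambda>p k l. prob {w \<in> space M. dist (U k w) (U l w) \<le> (1/2) ^ p}"
    have pairs: "(\<Sum>k\<in>I. \<Sum>l\<in>I. ?pr p k l) \<le> (1 + D) / (2 powr s') ^ p * (real n)\<^sup>2" if p: "p \<le> P" for p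
    proof -
      have one: "?pr p k l \<le> (if k = l then 1 else 0) + D / (2 powr s') ^ p" if "k \<in> I" "l \<in> I" for k l
      proof -
        have "scale s' p \<le> n" unfolding n_def using p s by (intro scale_mono) auto
        then have "scale s' p \<le> k" "scale s' p \<le> l" using that by (auto simp: I_def)
        then show ?thesis
          using close[of p l k] close[of p k l] prob_le_1 D
          by (cases k l rule: linorder_cases) (auto simp: dist_commute intro: add_increasing2)
      qed
      have "(\<Sum>k\<in>I. \<Sum>l\<in>I. ?pr p k l) \<le> (\<Sum>k\<in>I. \<Sum>l\<in>I. (if k = l then 1 else 0) + D / (2 powr s') ^ p)"
        by (intro sum_mono one)
      also have "\<dots> = real n + (real n)\<^sup>2 * (D / (2 powr s') ^ p)"
        by (simp add: sum.distrib I_def power2_eq_square distrib_left)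
      also have "\<dots> \<le> (real n)\<^sup>2 * (1 / (2 powr s') ^ p) + (real n)\<^sup>2 * (D / (2 powr s') ^ p)"
      proof (rule add_right_mono)
        have "(2 powr s') ^ p \<le> (2 powr s') ^ P" using p s by (intro power_increasing) (auto simp: ge_one_powr_ge_zero)
        then have "(2 powr s') ^ p \<le> real n" using n(2) by linarith
        then have "real n * (2 powr s') ^ p \<le> real n * real n" by (intro mult_left_mono) auto
        then show "real n \<le> (real n)\<^sup>2 * (1 / (2 powr s') ^ p)"
          by (simp add: power2_eq_square pos_le_divide_eq)
      qed
      finally show ?thesis by (simp add: algebra_simps add_divide_distrib)
    qed
    have "expectation (energy s I P) = (\<Sum>p\<le>P. (2 powr s) ^ p * (\<Sum>k\<in>I. \<Sum>l\<in>I. ?pr p k l))"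
      using n(1) by (intro expectation_energy) (auto simp: I_def)
    also have "\<dots> \<le> (\<Sum>p\<le>P. (2 powr s) ^ p * ((1 + D) / (2 powr s') ^ p * (real n)\<^sup>2))"
      by (intro sum_mono mult_left_mono pairs) auto
    also have "\<dots> = (1 + D) * (real n)\<^sup>2 * (\<Sum>p\<le>P. \<theta> ^ p)"
      by (simp add: sum_distrib_left \<theta>_def power_divide mult_ac)
    also have "\<dots> \<le> (1 + D) * (real n)\<^sup>2 * (\<Sum>p. \<theta> ^ p)"
      using \<theta> D by (intro mult_left_mono sum_le_suminf) auto
    also have "\<dots> = (1 + D) / (1 - \<theta>) * (real n)\<^sup>2" using \<theta> by (simp add: suminf_geometric)
    finally show ?thesis by (simp add: I_def n_def)
  qed
  then show ?thesis by blast
qed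

lemma AE_energy_bounded:
  assumes "exponent_ge A (1 - \<alpha>)" "0 < \<alpha>" and s: "0 < s" "s < s'" "s' < 1 / \<alpha>"
  shows "AE w in M. \<exists>K. \<exists>\<^sub>F P in sequentially.
    energy s {scale s' P..<2 * scale s' P} P w \<le> K * (real (scale s' P))\<^sup>2"
proof -
  obtain B where B: "\<And>P. expectation (energy s {scale s' P..<2 * scale s' P} P) \<le> B * (real (scale s' P))\<^sup>2"
    using expectation_energy_le[OF assms] by blast
  have n: "1 \<le> scale s' P" for P using scale_bounds(3)[of s' P] s by simp
  define X where "X = (\<lambda>P w. energy s {scale s' P..<2 * scale s' P} P w / (real (scale s' P))\<^sup>2)"
  have sq: "0 < (real (scale s' P))\<^sup>2" for P using n[of P] by simp
  have "AE w in M. \<exists>K. \<exists>\<^sub>F P in sequentially. X P w \<le> K"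
  proof (rule AE_frequently_bounded)
    fix P
    have int: "integrable M (energy s {scale s' P..<2 * scale s' P} P)"
      using n[of P] by (intro expectation_energy) auto
    then show "integrable M (X P)" by (simp add: X_def)
    show "expectation (X P) \<le> B"
      using B[of P] sq[of P] by (simp add: X_def pos_divide_le_eq)
    show "0 \<le> X P w" for w
      unfolding X_def energy_def by (intro divide_nonneg_nonneg sum_nonneg riesz_nonneg) auto
  qed
  then show ?thesis using sq by (simp add: X_def pos_divide_le_eq)
qed

end

section \<open>Almost sure compactness and dimension of the limit tree\<close>

theorem theorem1:
  fixes a :: "nat \<Rightarrow> real" and \<alpha> :: real
    and M :: "'w measure" and U :: "nat \<Rightarrow> 'w \<Rightarrow> l1"
  assumes "\<And>i. i \<ge> 1 \<Longrightarrow> a i > 0"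
    and "0 < \<alpha>" and "\<alpha> \<le> 1"
    and "exponent_le a (- \<alpha>)"
    and "exponent_eq (\<lambda>i. \<Sum>k = 1..i. a k) (1 - \<alpha>)"
    and "uniform_gluing M a U"
  shows "AE \<omega> in M.
           (let T = agg_tree_limit a (\<lambda>k. U k \<omega>); d = length_metric T
            in real_tree T d \<and> compact_space (Metric_space.mtopology T d) \<and>
               hausdorff_dim T d = ereal (1 / \<alpha>))"
proof -
  interpret prob_space M using assms(6) by (simp add: uniform_gluing_def)
  interpret uniform_aggregation M a U
    by unfold_locales (use assms in auto)
  have "A = (\<lambda>i. \<Sum>k = 1..i. a k)" by (simp add: A_def fun_eq_iff)
  then have exps: "exponent_le A (1 - \<alpha>)" "exponent_ge A (1 - \<alpha>)"
    using assms(5) by (simp_all add: exponent_eq_def)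
  \<comment> \<open>a sequence increasing to \<open>1\<close>: the almost sure statements for \<open>\<gamma> < \<alpha>\<close> and \<open>s < 1 / \<alpha>\<close> are only
    combined for countably many exponents\<close>
  define c where "c = (\<lambda>j::nat. 1 - 1 / (real j + 2))"
  have c: "0 < c j" "c j < 1" "c j < c (Suc j)" for j by (simp_all add: c_def field_simps)
  have c_lim: "c \<longlonglongrightarrow> 1" unfolding c_def by real_asymp
  have "AE \<omega> in M. \<forall>j. gluing_points.approximable a (\<lambda>k. U k \<omega>) (\<alpha> * c j)"
    unfolding AE_all_countable using assms(2,4) exps c by (intro allI AE_approximable) auto
  moreover have "AE \<omega> in M. \<forall>j. \<exists>K. \<exists>\<^sub>F P in sequentially.
      energy (c j / \<alpha>) {scale (c (Suc j) / \<alpha>) P..<2 * scale (c (Suc j) / \<alpha>) P} P \<omega>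
        \<le> K * (real (scale (c (Suc j) / \<alpha>) P))\<^sup>2"
    unfolding AE_all_countable using assms(2) exps c
    by (intro allI AE_energy_bounded) (auto simp: divide_strict_right_mono)
  ultimately show ?thesis using AE_gluing_points
  proof eventually_elim
    case (elim \<omega>)
    interpret gluing_points a "\<lambda>k. U k \<omega>" by (rule elim(3))
    define T where "T = agg_tree_limit a (\<lambda>k. U k \<omega>)"
    have anc: "ancestral T" unfolding T_def by (rule ancestral_agg_tree_limit)
    note tree = ancestral_real_tree[OF anc]
    have comp: "compact T"
      unfolding T_def using elim(1) assms(2) c[of 0] exps(1)
      by (intro compact_if_approximable[of "\<alpha> * c 0" \<alpha>]) (auto simp: A_def[abs_def])
    have "Metric_space.mtopology T (length_metric T) = top_of_set T"
      using tree by (intro mtopology_eq_subspace) (auto simp: real_tree_def)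
    then have "compact_space (Metric_space.mtopology T (length_metric T))"
      using comp by (simp add: compact_space_subtopology)
    moreover have "hausdorff_dim T (length_metric T) = ereal (1 / \<alpha>)"
    proof -
      have "hausdorff_dim T (length_metric T) = hausdorff_dim T dist"
        using tree(2) by (rule hausdorff_dim_cong)
      also have "\<dots> = ereal (1 / \<alpha>)"
      proof (rule antisym)
        show "hausdorff_dim T dist \<le> ereal (1 / \<alpha>)"
        proof (rule ereal_le_epsilon2)
          fix e :: real assume e: "0 < e"
          define t where "t = 1 / \<alpha> + e"
          have t: "0 < t" using e assms(2) by (simp add: t_def add_pos_pos)
          have "(\<lambda>j. \<alpha> * c j * t) \<longlonglongrightarrow> \<alpha> * 1 * t" by (intro tendsto_intros c_lim)
          moreover have "1 < \<alpha> * 1 * t" using e assms(2) by (simp add: t_def distrib_left)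
          ultimately have "\<forall>\<^sub>F j in sequentially. 1 < \<alpha> * c j * t" by (rule order_tendstoD)
          then obtain j where j: "1 < \<alpha> * c j * t" using eventually_happens'[OF sequentially_bot] by blast
          have "hausdorff_measure T dist t = 0"
            unfolding T_def using elim(1) assms(2) c[of j] j exps(1)
            by (intro hausdorff_measure_0_if_approximable[of "\<alpha> * c j" \<alpha>]) (auto simp: A_def[abs_def])
          then have "hausdorff_dim T dist \<le> ereal t"
            unfolding hausdorff_dim_def using t by (intro INF_lower) auto
          then show "hausdorff_dim T dist \<le> ereal (1 / \<alpha>) + ereal e" by (simp add: t_def)
        qed
      next
        show "ereal (1 / \<alpha>) \<le> hausdorff_dim T dist"
          unfolding hausdorff_dim_def
        proof (rule INF_greatest)
          fix t assume t: "t \<in> {s. 0 < s \<and> hausdorff_measure T dist s = 0}"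
          have "1 / \<alpha> \<le> t"
          proof (rule ccontr)
            assume "\<not> 1 / \<alpha> \<le> t"
            moreover have "(\<lambda>j. c j / \<alpha>) \<longlonglongrightarrow> 1 / \<alpha>" using assms(2) by (intro tendsto_intros c_lim) auto
            ultimately have "\<forall>\<^sub>F j in sequentially. t < c j / \<alpha>" by (intro order_tendstoD) auto
            then obtain j where j: "t < c j / \<alpha>" using eventually_happens'[OF sequentially_bot] by blast
            define n where "n = scale (c (Suc j) / \<alpha>)"
            have n: "1 \<le> n P" for P
              using scale_bounds(3)[of "c (Suc j) / \<alpha>" P] c(1)[of "Suc j"] assms(2) by (simp add: n_def)
            obtain K where K: "\<exists>\<^sub>F P in sequentially. energy (c j / \<alpha>) {n P..<2 * n P} P \<omega> \<le> K * (real (n P))\<^sup>2"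
              using elim(2) unfolding n_def by blast
            have UT: "U k \<omega> \<in> T" if "1 \<le> k" for k
              unfolding T_def agg_tree_limit_def
              using u_in[OF that] that by (intro closure_subset[THEN subsetD]) auto
            have "hausdorff_measure T dist t \<noteq> 0"
            proof (rule hausdorff_measure_pos_if_energy_bounded[OF comp, of t "c j / \<alpha>" "\<lambda>P. {n P..<2 * n P}" "\<lambda>k. U k \<omega>" K])
              show "\<exists>\<^sub>F P in sequentially.
                  (\<Sum>k\<in>{n P..<2 * n P}. \<Sum>l\<in>{n P..<2 * n P}. riesz (c j / \<alpha>) P (U k \<omega>) (U l \<omega>))
                  \<le> K * (real (card {n P..<2 * n P}))\<^sup>2"
                using K by (simp add: energy_def)
              show "{n P..<2 * n P} \<noteq> {}" for P using n[of P] by simp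
              show "(\<lambda>k. U k \<omega>) ` {n P..<2 * n P} \<subseteq> T" for P using n[of P] UT by auto
            qed (use t j in auto)
            then show False using t by simp
          qed
          then show "ereal (1 / \<alpha>) \<le> ereal t" by simp
        qed
      qed
      finally show ?thesis .
    qed
    ultimately show ?case using tree(1) by (simp add: T_def Let_def)
  qed
qed

end
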